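(* Let $\Omega$ be a domain in $\mathbf{R}^n$, $k\in\{1,\dots,n\}$, and let $u\in C^2(\Omega)\cap\Phi^k(\Omega)$ satisfy $u\le0$ in $\Omega$. Then for any subdomain $\Omega'\subset\subset\Omega$ there are the estimates $$\int_{\Omega'}|Du|^qF_l[u]\le C\Big(\int_\Omega|u|\Big)^{q+l}$$ for all $l=0,\dots,k-1$ and $0\le q<\frac{n(k-l)}{n-k}$ (with no upper restriction on $q<\infty$ when $k=n$), where $C$ is a constant depending only on $\Omega,\Omega',n,k,l$ and $q$.
   Context: For $\lambda\in\mathbf{R}^n$, $S_j(\lambda)=\sum_{i_1<\dots<i_j}\lambda_{i_1}\cdots\lambda_{i_j}$ and $S_0\equiv1$. For $v\in C^2$, $F_j[v]=S_j(\lambda(D^2v))$ with $\lambda(D^2v)$ the eigenvalues of the Hessian; in particular $F_0\equiv1$. For $u\in C^2(\Omega)$, $u\in\Phi^k(\Omega)$ means $F_j[u]\ge0$ in $\Omega$ for $j=1,\dots,k$. *)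

theory Defs
  imports "HOL-Analysis.Analysis"
begin

definition S_sym :: "nat \<Rightarrow> (real^'n) \<Rightarrow> real" where
  "S_sym j lam = (\<Sum>I\<in>{I::'n set. card I = j}. \<Prod>i\<in>I. lam $ i)"

definition eigvals :: "real^'n^'n \<Rightarrow> real^'n" where
  "eigvals A = (SOME lam. \<exists>P. orthogonal_matrix P \<and>
      A = P ** (\<chi> i j. if i = j then lam $ i else 0) ** transpose P)"

text \<open>F_j[u](x) = S_j(lambda(D^2 u(x))), where H is the Hessian of u.\<close>
definition Fk :: "nat \<Rightarrow> ((real^'n) \<Rightarrow> real^'n^'n) \<Rightarrow> (real^'n) \<Rightarrow> real" where
  "Fk j H x = S_sym j (eigvals (H x))"

text \<open>u is C^2 on the open set Omega with gradient Du and Hessian H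
  (H x $ i $ j is the j-th partial derivative of the i-th partial derivative).\<close>
definition C2_with :: "(real^'n) set \<Rightarrow> ((real^'n) \<Rightarrow> real) \<Rightarrow> ((real^'n) \<Rightarrow> real^'n)
    \<Rightarrow> ((real^'n) \<Rightarrow> real^'n^'n) \<Rightarrow> bool" where
  "C2_with \<Omega> u Du H \<longleftrightarrow>
     (\<forall>x\<in>\<Omega>. (u has_derivative (\<lambda>h. Du x \<bullet> h)) (at x)) \<and>
     (\<forall>x\<in>\<Omega>. (Du has_derivative (\<lambda>h. H x *v h)) (at x)) \<and>
     continuous_on \<Omega> H"

definition PhiK :: "nat \<Rightarrow> (real^'n) set \<Rightarrow> ((real^'n) \<Rightarrow> real^'n^'n) \<Rightarrow> bool" where
  "PhiK k \<Omega> H \<longleftrightarrow> (\<forall>j\<in>{1..k}. \<forall>x\<in>\<Omega>. Fk j H x \<ge> 0)"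

text \<open>Real power with the convention t^0 = 1 (also for t = 0).\<close>
definition rpow :: "real \<Rightarrow> real \<Rightarrow> real" where
  "rpow t q = (if q = 0 then 1 else t powr q)"

end

theory Submission
  imports Defs "HOL-Computational_Algebra.Fundamental_Theorem_Algebra"
    "HOL-Computational_Algebra.Formal_Power_Series"
begin

text \<open>
  Write \<open>T\<^sub>l\<close> for the \<open>l\<close>-th Newton transformation of the Hessian and \<open>\<rho> = 1 + |Du|\<^sup>2\<close>. The rows of
  \<open>T\<^sub>l\<close> are divergence free, so \<open>\<rho>\<^bsup>\<alpha>/2\<^esup> T\<^bsub>l-1\<^esub> Du\<close> has divergence
  \<open>\<rho>\<^bsup>\<alpha>/2\<^esup> (l F\<^sub>l + (\<alpha>/\<rho>) (F\<^sub>l |Du|\<^sup>2 - Du \<bullet> T\<^sub>l Du))\<close>. Newton's inequalities bound this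
  below by \<open>c \<rho>\<^bsup>\<alpha>/2\<^esup> F\<^sub>l\<close> with \<open>c > 0\<close> as soon as \<open>\<alpha> < n(k-l)/(n-k)\<close>. Integrating against a
  cutoff function trades one order \<open>l\<close> for one power of \<open>|Du|\<close>, which reduces the theorem to \<open>l = 0\<close>.
  For \<open>l = 0\<close> and \<open>k \<ge> 2\<close> the Hessian is dominated by \<open>F\<^sub>1\<close>, so the case \<open>l = 1\<close> of the same
  step controls the full gradient of \<open>\<rho>\<^bsup>q/2\<^esup>\<close>; Sobolev's inequality for \<open>W\<^bsup>1,1\<^esup>\<close> improves the
  exponent \<open>q\<close> by any factor below \<open>n/(n-1)\<close>, and iterating reaches every \<open>q < nk/(n-k)\<close>. The first
  exponents (all those needed for \<open>k = 1\<close>) come from a Caccioppoli inequality for powers of \<open>1 - u\<close>.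
  Scaling \<open>u\<close> reduces everything to \<open>\<integral>|u| \<le> 1\<close>.
\<close>

section \<open>Newton's inequalities\<close>

text \<open>The obstacle is regularity: \<open>u\<close> is only C^2, so the Newton transformations
  of its Hessian are merely continuous and their divergence vanishes only weakly. The weak identity
  is proved for the Jacobian of any C^1 vector field, symmetric or not: \<open>Du\<close> must be
  cut off to live on the whole space, and the Jacobian of the product is no longer symmetric. The
  threshold n(k-l)/(n-k) is algebraic. Deleting a negative eigenvalue can raise S_l, but while S_1,
  ..., S_k are nonnegative at most by the factor f = k(n-l)/(n(k-l)), attained when the other
  eigenvalues agree and S_k = 0. The admissible \<alpha> are those with l + \<alpha> - \<alpha> f >
  0. Every estimate loses some domain. Instead of tracking nested subdomains, boundedness is tested
  against all cutoffs at once, uniformly over all normalised \<open>u\<close>; a right-hand side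
  with a larger cutoff is then a bound of the same kind.\<close>

text \<open>The number \<open>d\<close> of factors is the degree that enters Laguerre's inequality.
  Since \<open>c\<close> may be 0, the zero polynomial qualifies for every \<open>d\<close>, which
  keeps the notion closed under differentiation.\<close>

definition real_rooted :: "nat \<Rightarrow> real poly \<Rightarrow> bool" where
  "real_rooted d p \<longleftrightarrow> (\<exists>c rs. length rs = d \<and> p = smult c (\<Prod>r\<leftarrow>rs. [:- r, 1:]))"

lemma pderiv_linear_mult: "pderiv ([:- r, 1:] * p) = p + [:- r, 1:] * pderiv p"
  for r :: "'a::idom"
proof -
  have "pderiv [:- r, 1:] = 1" by (simp add: pderiv_pCons)
  then show ?thesis by (simp only: pderiv_mult mult_1_right add.commute)
qed

text \<open>Laguerre's inequality at \<open>0\<close> is Newton's inequality for the three lowest coefficients; the others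
  follow since derivatives of real-rooted polynomials are real-rooted.\<close>

lemma laguerre_prod:
  fixes rs :: "real list" and x :: real
  defines "p \<equiv> (\<Prod>r\<leftarrow>rs. [:- r, 1:])"
  shows "real (length rs) * (poly p x * poly (pderiv (pderiv p)) x)
           \<le> (real (length rs) - 1) * (poly (pderiv p) x)\<^sup>2"
  unfolding p_def
proof (induction rs)
  case Nil
  then show ?case by simp
next
  case (Cons r rs)
  define p where "p = (\<Prod>r\<leftarrow>rs. [:- r, 1:])"
  define d where "d = real (length rs)"
  define s where "s = x - r"
  define a where "a = poly p x"
  define b where "b = poly (pderiv p) x"
  define c where "c = poly (pderiv (pderiv p)) x"
  have IH: "d * (a * c) \<le> (d - 1) * b\<^sup>2"
    using Cons.IH by (simp add: p_def d_def a_def b_def c_def)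
  define q where "q = [:- r, 1:] * p"
  have q0: "poly q x = s * a" by (simp add: q_def s_def a_def algebra_simps)
  have q1: "poly (pderiv q) x = s * b + a"
    unfolding q_def pderiv_linear_mult by (simp add: s_def a_def b_def algebra_simps)
  have q2: "poly (pderiv (pderiv q)) x = s * c + 2 * b"
    unfolding q_def pderiv_linear_mult pderiv_add by (simp add: s_def a_def b_def c_def algebra_simps)
  have "(d + 1) * ((s * a) * (s * c + 2 * b)) \<le> d * (s * b + a)\<^sup>2"
  proof (cases "rs = []")
    case True
    then show ?thesis by (simp add: d_def a_def b_def c_def p_def)
  next
    case False
    then have d: "d > 0" by (simp add: d_def)
    have "(d + 1) * s\<^sup>2 * (d * (a * c)) \<le> (d + 1) * s\<^sup>2 * ((d - 1) * b\<^sup>2)"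
      using d by (intro mult_left_mono IH) auto
    \<comment> \<open>Multiplied by \<open>d\<close>, the claim is the induction hypothesis times
      \<open>(d + 1) * s^2\<close> plus exactly this square.\<close>
    moreover have "0 \<le> (s * b - d * a)\<^sup>2" by simp
    ultimately have "d * ((d + 1) * ((s * a) * (s * c + 2 * b))) \<le> d * (d * (s * b + a)\<^sup>2)"
      by (simp add: algebra_simps power2_eq_square)
    then show ?thesis using d by (simp only: mult_le_cancel_left_pos)
  qed
  then have "(d + 1) * (poly q x * poly (pderiv (pderiv q)) x) \<le> d * (poly (pderiv q) x)\<^sup>2"
    by (simp only: q0 q1 q2)
  then show ?case by (simp add: q_def p_def d_def add.commute)
qed

lemma real_rooted_laguerre:
  assumes "real_rooted d p"
  shows "real d * (poly p x * poly (pderiv (pderiv p)) x) \<le> (real d - 1) * (poly (pderiv p) x)\<^sup>2"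
proof -
  obtain c rs where d: "length rs = d" and p: "p = smult c (\<Prod>r\<leftarrow>rs. [:- r, 1:])"
    using assms by (auto simp: real_rooted_def)
  have "c\<^sup>2 * (real d * (poly (\<Prod>r\<leftarrow>rs. [:- r, 1:]) x * poly (pderiv (pderiv (\<Prod>r\<leftarrow>rs. [:- r, 1:]))) x))
      \<le> c\<^sup>2 * ((real d - 1) * (poly (pderiv (\<Prod>r\<leftarrow>rs. [:- r, 1:])) x)\<^sup>2)"
    using laguerre_prod[of rs x] d by (intro mult_left_mono) auto
  then show ?thesis
    by (simp add: p pderiv_smult power2_eq_square algebra_simps)
qed

text \<open>P'/P is the sum of 1/(z - r) over the real roots r, and each summand has imaginary part
  of sign opposite to \<open>Im z\<close>. Multiplying by |P|^2 avoids the quotient and lets the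
  induction run on polynomials. Hence P' has no zero off the real axis.\<close>

lemma gauss_lucas_im:
  fixes rs :: "real list" and z :: complex
  defines "P \<equiv> (\<Prod>r\<leftarrow>rs. [:- complex_of_real r, 1:])"
  assumes "Im z \<noteq> 0"
  shows "poly P z \<noteq> 0 \<and> (rs \<noteq> [] \<longrightarrow> Im z * Im (poly (pderiv P) z * cnj (poly P z)) < 0)"
  unfolding P_def
proof (induction rs)
  case Nil
  then show ?case by simp
next
  case (Cons r rs)
  define p where "p = (\<Prod>r\<leftarrow>rs. [:- complex_of_real r, 1:])"
  define w where "w = z - of_real r"
  have w: "w \<noteq> 0" "Im w = Im z" using assms by (auto simp: w_def complex_eq_iff)
  have p0: "poly p z \<noteq> 0" using Cons.IH by (simp add: p_def)
  have p1: "Im z * Im (poly (pderiv p) z * cnj (poly p z)) \<le> 0"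
    using Cons.IH by (cases "rs = []") (auto simp: p_def)
  have e: "poly (pderiv ([:- complex_of_real r, 1:] * p)) z * cnj (poly ([:- complex_of_real r, 1:] * p) z)
      = of_real ((cmod (poly p z))\<^sup>2) * cnj w + of_real ((cmod w)\<^sup>2) * (poly (pderiv p) z * cnj (poly p z))"
    unfolding complex_norm_square pderiv_linear_mult
    by (simp add: w_def algebra_simps)
  have "Im z * Im (poly (pderiv ([:- complex_of_real r, 1:] * p)) z * cnj (poly ([:- complex_of_real r, 1:] * p) z))
     = - ((cmod (poly p z))\<^sup>2 * (Im z)\<^sup>2) + (cmod w)\<^sup>2 * (Im z * Im (poly (pderiv p) z * cnj (poly p z)))"
    unfolding e by (simp add: w power2_eq_square algebra_simps)
  moreover have "(cmod (poly p z))\<^sup>2 * (Im z)\<^sup>2 > 0" using p0 assms by simp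
  moreover have "(cmod w)\<^sup>2 * (Im z * Im (poly (pderiv p) z * cnj (poly p z))) \<le> 0"
    using p1 by (simp add: mult_nonneg_nonpos)
  ultimately have "Im z * Im (poly (pderiv ([:- complex_of_real r, 1:] * p)) z * cnj (poly ([:- complex_of_real r, 1:] * p) z)) < 0"
    by linarith
  moreover have "poly ([:- complex_of_real r, 1:] * p) z \<noteq> 0"
    using p0 w by (simp add: w_def algebra_simps)
  ultimately show ?case by (simp add: p_def)
qed

section \<open>Derivatives of real-rooted polynomials, by factorisation over the complex
  numbers\<close>

abbreviation cpoly :: "real poly \<Rightarrow> complex poly" where
  "cpoly \<equiv> map_poly complex_of_real"

lemma cpoly_mult: "cpoly (p * q) = cpoly p * cpoly q"
  by (rule poly_eqI) (simp add: coeff_map_poly coeff_mult)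

lemma cpoly_prod_list: "cpoly (\<Prod>r\<leftarrow>rs. [:- r, 1:]) = (\<Prod>r\<leftarrow>rs. [:- complex_of_real r, 1:])"
  by (induction rs) (simp_all add: cpoly_mult map_poly_pCons del: mult_pCons_left mult_pCons_right)

lemma cpoly_pderiv: "cpoly (pderiv p) = pderiv (cpoly p)"
  by (rule poly_eqI) (simp add: coeff_map_poly coeff_pderiv)

lemma cpoly_smult: "cpoly (smult c p) = smult (of_real c) (cpoly p)"
  by (rule poly_eqI) (simp add: coeff_map_poly)

lemma cpoly_inj: "cpoly p = cpoly q \<Longrightarrow> p = q"
  by (metis coeff_map_poly of_real_0 of_real_eq_iff poly_eqI)

lemma complex_poly_factors:
  fixes p :: "complex poly"
  shows "\<exists>c zs. length zs = degree p \<and> p = smult c (\<Prod>z\<leftarrow>zs. [:- z, 1:])"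
proof (induction "degree p" arbitrary: p)
  case 0
  then obtain c where "p = [:c:]" by (metis degree_eq_zeroE)
  then show ?case by (intro exI[of _ c] exI[of _ "[]"]) simp
next
  case (Suc d)
  then have "\<not> constant (poly p)" by (simp add: constant_degree)
  then obtain z where "poly p z = 0" using fundamental_theorem_of_algebra by blast
  then obtain q where q: "p = [:- z, 1:] * q" by (metis poly_eq_0_iff_dvd dvdE)
  then have "q \<noteq> 0" using Suc.hyps by auto
  then have "degree p = Suc (degree q)" unfolding q by (subst degree_mult_eq) auto
  then have "d = degree q" using Suc.hyps by simp
  from Suc.hyps(1)[OF this] obtain c zs where "length zs = degree q" "q = smult c (\<Prod>z\<leftarrow>zs. [:- z, 1:])"
    by blast
  then show ?case
    using q \<open>degree p = Suc (degree q)\<close>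
    by (intro exI[of _ c] exI[of _ "z # zs"]) (simp del: mult_pCons_left)
qed

lemma real_rooted_pderiv:
  assumes "real_rooted (Suc d) p"
  shows "real_rooted d (pderiv p)"
proof (cases "pderiv p = 0")
  case True
  then show ?thesis unfolding real_rooted_def
    by (intro exI[of _ 0] exI[of _ "replicate d 0"]) simp
next
  case False
  obtain c rs where l: "length rs = Suc d" and p: "p = smult c (\<Prod>r\<leftarrow>rs. [:- r, 1:])"
    using assms by (auto simp: real_rooted_def)
  have c: "c \<noteq> 0" using False p by auto
  have lin: "degree (\<Prod>r\<leftarrow>xs. [:- r, 1:]) = length xs \<and> lead_coeff (\<Prod>r\<leftarrow>xs. [:- r, 1:]) = 1"
    for xs :: "real list"
  proof (induction xs)
    case (Cons a xs)
    let ?P = "\<Prod>r\<leftarrow>xs. [:- r, 1:]"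
    have "?P \<noteq> 0" using Cons by auto
    then have "degree ([:- a, 1:] * ?P) = Suc (length xs)"
      by (subst degree_mult_eq) (use Cons in auto)
    moreover have "lead_coeff ([:- a, 1:] * ?P) = 1"
      unfolding lead_coeff_mult conjunct2[OF Cons.IH] by simp
    ultimately show ?case by (simp only: list.map prod_list.Cons list.size add_Suc_right add_0_right)
  qed simp
  have deg: "degree (\<Prod>r\<leftarrow>xs. [:- r, 1:]) = length xs" for xs :: "real list"
    using lin[of xs] by (rule conjunct1)
  have dp: "degree (pderiv p) = d" by (simp add: degree_pderiv p c deg l)
  obtain e zs where zs: "length zs = degree (cpoly (pderiv p))"
    "cpoly (pderiv p) = smult e (\<Prod>z\<leftarrow>zs. [:- z, 1:])"
    using complex_poly_factors by blast
  have dc: "degree (cpoly (pderiv p)) = d"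
    by (simp add: degree_map_poly dp)
  have real: "Im z = 0" if mem: "z \<in> set zs" for z
  proof (rule ccontr)
    assume im: "Im z \<noteq> 0"
    have "poly (cpoly (pderiv p)) z = 0"
    proof -
      obtain ys ws where "zs = ys @ z # ws" using mem by (meson split_list)
      then show ?thesis unfolding zs(2) by simp
    qed
    then have "poly (pderiv (\<Prod>r\<leftarrow>rs. [:- complex_of_real r, 1:])) z = 0"
      unfolding cpoly_pderiv p cpoly_smult cpoly_prod_list pderiv_smult using c by simp
    with gauss_lucas_im[OF im, of rs] l show False by auto
  qed
  have zs': "zs = map complex_of_real (map Re zs)"
    unfolding map_map o_def using real by (intro map_idI[symmetric]) (simp add: complex_eq_iff)
  \<comment> \<open>Real roots are not enough, the scalar has to be real as well. The product is
    monic of degree \<open>d\<close>, so \<open>e\<close> is a coefficient of the real polynomial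
    \<open>pderiv p\<close>.\<close>
  have e: "e = of_real (Re e)"
  proof -
    have pe: "(\<Prod>z\<leftarrow>zs. [:- z, 1:]) = cpoly (\<Prod>r\<leftarrow>map Re zs. [:- r, 1:])"
      unfolding cpoly_prod_list by (subst zs') (simp add: o_def)
    have "coeff (\<Prod>r\<leftarrow>map Re zs. [:- r, 1:]) d = 1"
      using conjunct2[OF lin[of "map Re zs"]] unfolding deg length_map zs(1) dc .
    then have "coeff (cpoly (pderiv p)) d = e"
      unfolding zs(2) pe by (simp add: coeff_map_poly)
    then have "e = of_real (coeff (pderiv p) d)" by (simp add: coeff_map_poly)
    then show ?thesis by simp
  qed
  have "cpoly (pderiv p) = cpoly (smult (Re e) (\<Prod>r\<leftarrow>map Re zs. [:- r, 1:]))"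
    unfolding zs(2) cpoly_smult cpoly_prod_list e[symmetric]
    by (subst zs') (simp add: o_def)
  then have "pderiv p = smult (Re e) (\<Prod>r\<leftarrow>map Re zs. [:- r, 1:])" by (rule cpoly_inj)
  then show ?thesis unfolding real_rooted_def using zs(1) dc by (metis length_map)
qed

lemma real_rooted_higher_pderiv:
  "real_rooted (d + m) p \<Longrightarrow> real_rooted d ((pderiv ^^ m) p)"
proof (induction m arbitrary: d)
  case (Suc m)
  then have "real_rooted (Suc d) ((pderiv ^^ m) p)" by simp
  then show ?case using real_rooted_pderiv by simp
qed simp

text \<open>An arbitrary index set replaces \<open>UNIV\<close> of \<open>S_sym\<close> so that
  single eigenvalues can be removed; the arguments below compare \<open>esym\<close> on
  \<open>A\<close> and on \<open>insert a A\<close>.\<close>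

definition esym :: "('a \<Rightarrow> real) \<Rightarrow> 'a set \<Rightarrow> nat \<Rightarrow> real" where
  "esym x A j = (\<Sum>I | I \<subseteq> A \<and> card I = j. \<Prod>i\<in>I. x i)"

lemma esym_0: "finite A \<Longrightarrow> esym x A 0 = 1"
proof -
  assume "finite A"
  then have "{I. I \<subseteq> A \<and> card I = 0} = {{}}" by (auto dest: finite_subset)
  then show ?thesis by (simp add: esym_def)
qed

lemma esym_gt: "finite A \<Longrightarrow> card A < j \<Longrightarrow> esym x A j = 0"
proof -
  assume "finite A" "card A < j"
  then have "card I \<noteq> j" if "I \<subseteq> A" for I
    using card_mono[OF \<open>finite A\<close> that] by simp
  then have "{I. I \<subseteq> A \<and> card I = j} = {}" by blast
  then show ?thesis by (simp only: esym_def sum.empty)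
qed

lemma esym_insert:
  assumes "finite A" "a \<notin> A"
  shows "esym x (insert a A) (Suc j) = esym x A (Suc j) + x a * esym x A j"
proof -
  have fin: "finite {I. I \<subseteq> A \<and> card I = m}" for m using assms by simp
  have eq: "{I. I \<subseteq> insert a A \<and> card I = Suc j}
     = {I. I \<subseteq> A \<and> card I = Suc j} \<union> insert a ` {I. I \<subseteq> A \<and> card I = j}" (is "?L = ?R")
  proof (intro equalityI subsetI)
    fix I assume I: "I \<in> ?L"
    then have f: "finite I" using assms by (auto dest: finite_subset)
    show "I \<in> ?R"
    proof (cases "a \<in> I")
      case True
      then have "I = insert a (I - {a})" "card (I - {a}) = j" "I - {a} \<subseteq> A" using I f by auto
      then show ?thesis by blast
    qed (use I in auto)
  next
    fix I assume "I \<in> ?R"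
    moreover have "card (insert a J) = Suc (card J)" if "J \<subseteq> A" for J
    proof -
      have "finite J" "a \<notin> J" using that assms by (auto dest: finite_subset)
      then show ?thesis by simp
    qed
    ultimately show "I \<in> ?L" by auto
  qed
  have "esym x (insert a A) (Suc j) = esym x A (Suc j)
      + (\<Sum>I \<in> insert a ` {I. I \<subseteq> A \<and> card I = j}. \<Prod>i\<in>I. x i)"
    unfolding esym_def eq using assms fin by (subst sum.union_disjoint) auto
  also have "(\<Sum>I \<in> insert a ` {I. I \<subseteq> A \<and> card I = j}. \<Prod>i\<in>I. x i)
      = (\<Sum>I | I \<subseteq> A \<and> card I = j. \<Prod>i\<in>insert a I. x i)"
    using assms by (subst sum.reindex) (auto simp: inj_on_def)
  also have "\<dots> = (\<Sum>I | I \<subseteq> A \<and> card I = j. x a * (\<Prod>i\<in>I. x i))"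
  proof (rule sum.cong[OF refl])
    fix I assume "I \<in> {I. I \<subseteq> A \<and> card I = j}"
    then have "finite I" "a \<notin> I" using assms by (auto dest: finite_subset)
    then show "(\<Prod>i\<in>insert a I. x i) = x a * (\<Prod>i\<in>I. x i)" by simp
  qed
  finally show ?thesis by (simp add: esym_def sum_distrib_left)
qed

text \<open>Vieta's formulas. The linear factors have roots \<open>- x i\<close>, so no alternating
  signs occur.\<close>

lemma coeff_prod_esym:
  assumes "finite A"
  shows "m \<le> card A \<Longrightarrow> coeff (\<Prod>i\<in>A. [:x i, 1:]) m = esym x A (card A - m)"
  using assms
proof (induction A arbitrary: m rule: finite_induct)
  case empty
  then show ?case by (simp add: esym_0)
next
  case (insert a A)
  let ?P = "\<Prod>i\<in>A. [:x i, 1:]"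
  have P: "(\<Prod>i\<in>insert a A. [:x i, 1:]) = smult (x a) ?P + pCons 0 ?P"
    using insert by simp
  have d: "degree ?P \<le> card A"
    using degree_prod_sum_le[OF insert.hyps(1), of "\<lambda>i. [:x i, 1:]"] by simp
  show ?case
  proof (cases m)
    case 0
    then show ?thesis
      unfolding P using insert.hyps insert.IH[of 0]
      by (simp add: esym_insert esym_gt)
  next
    case (Suc m')
    show ?thesis
    proof (cases "m' = card A")
      case True
      have "coeff ?P (Suc m') = 0" using d True by (intro coeff_eq_0) simp
      then show ?thesis unfolding P Suc using insert.hyps insert.IH[of m'] True
        by (simp add: esym_0)
    next
      case False
      then have m: "Suc m' \<le> card A" using insert Suc by simp
      have "card A - m' = Suc (card A - Suc m')" using m by simp
      then show ?thesis unfolding P Suc using insert.hyps insert.IH[of m'] insert.IH[of "Suc m'"] m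
        by (simp add: esym_insert)
    qed
  qed
qed

lemma real_rooted_prod:
  assumes "finite A"
  shows "real_rooted (card A) (\<Prod>i\<in>A. [:x i, 1:])"
  using assms
proof (induction A rule: finite_induct)
  case empty
  have "(1 :: real poly) = smult 1 1" by simp
  then show ?case unfolding real_rooted_def by (intro exI[of _ 1] exI[of _ "[]"]) simp
next
  case (insert a A)
  then obtain c rs where "length rs = card A" "(\<Prod>i\<in>A. [:x i, 1:]) = smult c (\<Prod>r\<leftarrow>rs. [:- r, 1:])"
    by (auto simp: real_rooted_def)
  then show ?case unfolding real_rooted_def using insert.hyps
    by (intro exI[of _ c] exI[of _ "- x a # rs"]) (simp del: mult_pCons_left)
qed

lemma newton_inequality:
  assumes "finite A" "Suc (Suc j) \<le> card A"
  shows "real (j + 2) * real (card A - j) * (esym x A j * esym x A (Suc (Suc j)))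
      \<le> real (j + 1) * real (card A - Suc j) * (esym x A (Suc j))\<^sup>2"
proof -
  define N where "N = card A"
  define m where "m = N - Suc (Suc j)"
  have N: "N = j + 2 + m" using assms by (simp add: m_def N_def)
  define P where "P = (\<Prod>i\<in>A. [:x i, 1:])"
  define Q where "Q = (pderiv ^^ m) P"
  have "real_rooted (j + 2) Q"
    unfolding Q_def using real_rooted_prod[OF assms(1), of x] N
    by (intro real_rooted_higher_pderiv) (simp add: P_def N_def)
  from real_rooted_laguerre[OF this, of 0]
  have *: "real (j + 2) * (poly Q 0 * poly (pderiv (pderiv Q)) 0) \<le> real (j + 1) * (poly (pderiv Q) 0)\<^sup>2"
    by simp
  \<comment> \<open>Differentiating m times multiplies the coefficients of order m, m+1, m+2 by m!,
    (m+1)!/1! and (m+2)!/2!, which the library expresses through \<open>pochhammer\<close>.\<close>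
  have poch: "pochhammer 1 m = (fact m :: real)" "pochhammer 2 m = (fact (m + 1) :: real)"
      "2 * pochhammer 3 m = (fact (m + 2) :: real)"
  proof -
    show "pochhammer 1 m = (fact m :: real)" by (simp add: pochhammer_fact)
    show "pochhammer 2 m = (fact (m + 1) :: real)"
      using pochhammer_rec[of "1::real" m] pochhammer_fact[of "Suc m", where ?'a=real] by simp
    show "2 * pochhammer 3 m = (fact (m + 2) :: real)"
      using pochhammer_rec[of "1::real" "Suc m"] pochhammer_rec[of "2::real" m]
        pochhammer_fact[of "Suc (Suc m)", where ?'a=real] by simp
  qed
  have c: "coeff P i = esym x A (N - i)" if "i \<le> N" for i
    unfolding P_def N_def using that assms N_def by (intro coeff_prod_esym) auto
  have "coeff P m = esym x A (Suc (Suc j))" "coeff P (Suc m) = esym x A (Suc j)"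
      "coeff P (Suc (Suc m)) = esym x A j"
    using c[of m] c[of "Suc m"] c[of "Suc (Suc m)"] N by simp_all
  note cP = this
  have q0: "poly Q 0 = fact m * esym x A (Suc (Suc j))"
    using poch(1) by (simp add: Q_def poly_0_coeff_0 coeff_higher_pderiv cP del: fact_Suc)
  have q1: "poly (pderiv Q) 0 = fact (m + 1) * esym x A (Suc j)"
    using poch(2) by (simp add: Q_def poly_0_coeff_0 coeff_pderiv coeff_higher_pderiv cP del: fact_Suc)
  have q2: "poly (pderiv (pderiv Q)) 0 = fact (m + 2) * esym x A j"
    using poch(3)
    by (simp add: Q_def poly_0_coeff_0 coeff_pderiv coeff_higher_pderiv cP del: fact_Suc
        flip: mult.assoc)
  have f: "(fact m * fact (m + 1) :: real) > 0" by simp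
  have "fact m * fact (m + 1) * (real (j + 2) * real (m + 2) * (esym x A j * esym x A (Suc (Suc j))))
     \<le> fact m * fact (m + 1) * (real (j + 1) * real (m + 1) * (esym x A (Suc j))\<^sup>2)"
    using * unfolding q0 q1 q2 by (simp add: power2_eq_square algebra_simps)
  then have "real (j + 2) * real (m + 2) * (esym x A j * esym x A (Suc (Suc j)))
     \<le> real (j + 1) * real (m + 1) * (esym x A (Suc j))\<^sup>2"
    using f by (simp only: mult_le_cancel_left_pos)
  then show ?thesis using N by (simp add: N_def[symmetric])
qed

text \<open>At a first failure e_(j+1)(A) < 0, the nonnegative values of orders j+1 and j+2 on the
  larger set give, after elimination of \<open>x a\<close>, e_(j+1)^2 <= e_j e_(j+2). This
  contradicts Newton's inequality, whose constant is strictly smaller than 1.\<close>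

lemma esym_remove_nonneg:
  assumes "finite A" "a \<notin> A" and pos: "\<And>j. j \<le> k \<Longrightarrow> 0 \<le> esym x (insert a A) j"
  shows "j < k \<Longrightarrow> 0 \<le> esym x A j"
proof (induction j)
  case 0
  then show ?case using assms by (simp add: esym_0)
next
  case (Suc j)
  show ?case
  proof (rule ccontr)
    assume "\<not> 0 \<le> esym x A (Suc j)"
    define e0 e1 e2 t where "e0 = esym x A j" and "e1 = esym x A (Suc j)"
      and "e2 = esym x A (Suc (Suc j))" and "t = x a"
    have e1: "e1 < 0" using \<open>\<not> 0 \<le> esym x A (Suc j)\<close> by (simp add: e1_def)
    have e0: "0 \<le> e0" using Suc by (simp add: e0_def)
    have a1: "0 \<le> e1 + t * e0"
      using pos[of "Suc j"] Suc.prems by (simp add: esym_insert assms(1,2) e1_def t_def e0_def)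
    have a2: "0 \<le> e2 + t * e1"
      using pos[of "Suc (Suc j)"] Suc.prems by (simp add: esym_insert assms(1,2) e1_def t_def e2_def)
    have "e1 * (e1 + t * e0) \<le> 0" using e1 a1 by (simp add: mult_nonpos_nonneg)
    moreover have "0 \<le> e0 * (e2 + t * e1)" using e0 a2 by simp
    ultimately have ge: "e1\<^sup>2 \<le> e0 * e2" by (simp add: algebra_simps power2_eq_square)
    have e1p: "0 < e1\<^sup>2" using e1 by simp
    show False
    proof (cases "Suc (Suc j) \<le> card A")
      case False
      then have "e2 = 0" using assms by (simp add: e2_def esym_gt)
      then show False using ge e1p by simp
    next
      case True
      from newton_inequality[OF assms(1) True, of x]
      have n: "real (j + 2) * real (card A - j) * (e0 * e2) \<le> real (j + 1) * real (card A - Suc j) * e1\<^sup>2"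
        by (simp add: e0_def e1_def e2_def)
      have "real (j + 2) * real (card A - j) * e1\<^sup>2 \<le> real (j + 2) * real (card A - j) * (e0 * e2)"
        using ge by (intro mult_left_mono) auto
      with n have "real (j + 2) * real (card A - j) * e1\<^sup>2 \<le> real (j + 1) * real (card A - Suc j) * e1\<^sup>2"
        by linarith
      moreover have "real (j + 1) * real (card A - Suc j) < real (j + 2) * real (card A - j)"
        using True by (intro mult_strict_mono) auto
      ultimately show False using mult_strict_right_mono[OF _ e1p] by (meson not_le)
    qed
  qed
qed

text \<open>Downward induction on the order. For \<open>Suc i = k\<close> the claim is just
  nonnegativity of S_k on the larger set, and Newton's inequality carries the ratio of consecutive
  orders from \<open>Suc i\<close> to \<open>i\<close>. The constants are sharp: equality holds if
  all entries over \<open>A\<close> are equal and S_k vanishes.\<close>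

lemma esym_ratio:
  assumes "finite A" "a \<notin> A" and pos: "\<And>j. j \<le> k \<Longrightarrow> 0 \<le> esym x (insert a A) j"
    and t: "x a < 0" and k: "k \<le> card A" and i: "Suc i \<le> k"
  shows "real k * (real (card A) - real i) * (- x a * esym x A i)
      \<le> real (Suc i) * (real (card A) + 1 - real k) * esym x A (Suc i)"
  using i
proof (induction "k - Suc i" arbitrary: i)
  case 0
  then have ki: "k = Suc i" by simp
  have "0 \<le> esym x A (Suc i) + x a * esym x A i"
    using pos[of k] by (simp add: ki esym_insert assms(1,2))
  then have "real k * (real (card A) - real i) * (- x a * esym x A i)
      \<le> real k * (real (card A) - real i) * esym x A (Suc i)"
    using k ki by (intro mult_left_mono) auto
  then show ?case by (simp add: ki algebra_simps)
next
  case (Suc d)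
  define e0 e1 e2 t N K where "e0 = esym x A i" and "e1 = esym x A (Suc i)"
      and "e2 = esym x A (Suc (Suc i))" and "t = - x a" and "N = real (card A)" and "K = real k"
  have lt: "Suc (Suc i) \<le> k" using Suc.hyps(2) by simp
  have IH: "K * (N - real i - 1) * (t * e1) \<le> (real i + 2) * (N + 1 - K) * e2"
    using Suc.hyps(1)[of "Suc i"] Suc.hyps(2) lt
    by (simp add: e1_def e2_def t_def N_def K_def algebra_simps)
  have e0: "0 \<le> e0" and e1: "0 \<le> e1"
    using esym_remove_nonneg[OF assms(1,2) pos, of k i] esym_remove_nonneg[OF assms(1,2) pos, of k "Suc i"] lt
    by (auto simp: e0_def e1_def)
  have "0 \<le> e1 - t * e0"
    using pos[of "Suc i"] lt by (simp add: esym_insert assms(1,2) e0_def e1_def t_def)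
  have tp: "t > 0" using t by (simp add: t_def)
  have Ni: "real i + 2 \<le> N" and KN: "K \<le> N" using lt k by (auto simp: N_def K_def)
  \<comment> \<open>The general argument cancels a factor \<open>e1\<close>, so
    \<open>e1 = 0\<close> is treated first; there \<open>t * e0\<close> is squeezed to 0.\<close>
  have "K * (N - real i) * (t * e0) \<le> (real i + 1) * (N + 1 - K) * e1"
  proof (cases "e1 = 0")
    case True
    then have "t * e0 = 0" using \<open>0 \<le> e1 - t * e0\<close> tp e0 by (simp add: mult_le_0_iff)
    then show ?thesis using True by auto
  next
    case False
    have nw: "(real i + 2) * (N - real i) * (e0 * e2) \<le> (real i + 1) * (N - real i - 1) * e1\<^sup>2"
      using newton_inequality[OF assms(1), of i x] lt k
      by (simp add: e0_def e1_def e2_def N_def algebra_simps of_nat_diff)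
    have "(N - real i) * e0 * (K * (N - real i - 1) * (t * e1))
        \<le> (N - real i) * e0 * ((real i + 2) * (N + 1 - K) * e2)"
      using Ni e0 by (intro mult_left_mono IH) auto
    also have "\<dots> = (N + 1 - K) * ((real i + 2) * (N - real i) * (e0 * e2))"
      by (simp add: algebra_simps)
    also have "\<dots> \<le> (N + 1 - K) * ((real i + 1) * (N - real i - 1) * e1\<^sup>2)"
      using KN by (intro mult_left_mono nw) auto
    finally have "((N - real i - 1) * e1) * (K * (N - real i) * (t * e0))
        \<le> ((N - real i - 1) * e1) * ((real i + 1) * (N + 1 - K) * e1)"
      by (simp add: power2_eq_square mult_ac)
    moreover have "(N - real i - 1) * e1 > 0" using Ni e1 False by simp
    ultimately show ?thesis by (simp only: mult_le_cancel_left_pos)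
  qed
  then show ?case by (simp add: e0_def e1_def t_def N_def K_def add_ac)
qed

text \<open>If \<open>x a\<close> were negative, every \<open>esym x A j\<close> would vanish in
  turn, starting from \<open>j = card A\<close> and descending to \<open>j = 0\<close>, where the
  value is 1.\<close>

lemma esym_all_nonneg:
  assumes "finite A" "a \<notin> A" and pos: "\<And>j. j \<le> card (insert a A) \<Longrightarrow> 0 \<le> esym x (insert a A) j"
  shows "0 \<le> x a"
proof (rule ccontr)
  assume t: "\<not> 0 \<le> x a"
  have n: "card (insert a A) = Suc (card A)" using assms by simp
  have nn: "0 \<le> esym x A j" if "j \<le> card A" for j
    using esym_remove_nonneg[OF assms(1,2) pos, of "Suc (card A)" j] that n by simp
  have "esym x A (card A - d) = 0" if "d \<le> card A" for d
    using that
  proof (induction d)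
    case 0
    have "0 \<le> x a * esym x A (card A)"
      using pos[of "Suc (card A)"] n by (simp add: esym_insert assms(1,2) esym_gt)
    then show ?case using t nn[of "card A"] by (simp add: zero_le_mult_iff)
  next
    case (Suc d)
    have e: "card A - d = Suc (card A - Suc d)" using Suc by simp
    have "0 \<le> esym x A (Suc (card A - Suc d)) + x a * esym x A (card A - Suc d)"
      using pos[of "Suc (card A - Suc d)"] n by (simp add: esym_insert assms(1,2))
    then have "0 \<le> x a * esym x A (card A - Suc d)" using Suc e by simp
    then show ?case using t nn[of "card A - Suc d"] by (simp add: zero_le_mult_iff)
  qed
  from this[of "card A"] show False using assms by (simp add: esym_0)
qed

text \<open>The right-hand side is l S_l + \<alpha> (S_l - S_l without \<open>a\<close>), the
  divergence expression in one eigendirection. If \<open>x a >= 0\<close>, removal of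
  \<open>a\<close> does not increase S_l; if \<open>x a < 0\<close>, \<open>esym_ratio\<close>
  bounds the increase. The bound \<open>c <= real l\<close> is kept for replacing |v|^2 by a larger
  number later.\<close>

lemma esym_lower_bound:
  assumes "1 \<le> l" "l \<le> k" "k \<le> n" "0 \<le> \<alpha>"
    and "k = n \<or> \<alpha> * real (n - k) < real (n * (k - l))"
  shows "\<exists>c>0. c \<le> real l \<and> (\<forall>A a (x :: 'a \<Rightarrow> real). finite A \<longrightarrow> a \<notin> A \<longrightarrow> card (insert a A) = n \<longrightarrow>
      (\<forall>j\<le>k. 0 \<le> esym x (insert a A) j) \<longrightarrow>
      c * esym x (insert a A) l \<le> (real l + \<alpha>) * esym x (insert a A) l - \<alpha> * esym x A l)"
proof -
  \<comment> \<open>This is l + \<alpha> - \<alpha> f, where f = k(n-l)/(n(k-l)) is the largest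
    possible quotient of S_l without \<open>a\<close> by S_l. For \<open>k = n\<close> no entry is
    negative and \<open>real l\<close> itself works.\<close>
  define c where "c = (if k = n then real l else real l * (1 - \<alpha> * real (n - k) / real (n * (k - l))))"
  have lk: "l < k" "k < n" if "k \<noteq> n"
  proof -
    show "k < n" using that assms by simp
    then have "0 < real (n * (k - l))"
      using assms that by (metis (no_types, lifting) le_less_trans mult_nonneg_nonneg of_nat_0_le_iff)
    then show "l < k" using assms(2) by (cases "k = l") auto
  qed
  have c0: "0 < c"
    using assms lk unfolding c_def by (auto simp: divide_less_eq)
  have cl: "c \<le> real l"
    using assms(1,4) unfolding c_def by (auto simp: mult_le_cancel_left1)
  have "c * esym x (insert a A) l \<le> (real l + \<alpha>) * esym x (insert a A) l - \<alpha> * esym x A l"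
    if A: "finite A" "a \<notin> A" "card (insert a A) = n" and pos: "\<And>j. j \<le> k \<Longrightarrow> 0 \<le> esym x (insert a A) j"
    for A a and x :: "'a \<Rightarrow> real"
  proof -
    obtain i where i: "l = Suc i" using assms(1) by (cases l) auto
    define E e where "E = esym x (insert a A) l" and "e = esym x A l"
    have E: "E = e + x a * esym x A i" by (simp add: E_def e_def i esym_insert A)
    have E0: "0 \<le> E" using pos assms by (simp add: E_def)
    have ei: "0 \<le> esym x A i" using esym_remove_nonneg[OF A(1,2) pos, of k i] assms(2) i by simp
    have "c * E \<le> (real l + \<alpha>) * E - \<alpha> * e"
    proof (cases "0 \<le> x a")
      case True
      then have "0 \<le> \<alpha> * (E - e)" using E ei assms(4) by simp
      moreover have "c * E \<le> real l * E" using cl E0 by (rule mult_right_mono)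
      ultimately show ?thesis by (simp add: algebra_simps)
    next
      case False
      then have kn: "k \<noteq> n" using esym_all_nonneg[OF A(1,2), of x] pos A(3) by auto
      note lk = lk[OF kn]
      have cA: "real (card A) = real n - 1" "card A = n - 1" using A by auto
      have "real k * (real n - real l) * (- x a * esym x A i) \<le> real l * (real n - real k) * e"
        using esym_ratio[OF A(1,2) pos, of k i] False lk cA by (simp add: i e_def algebra_simps)
      then have "real k * (real n - real l) * (e - E) \<le> real l * (real n - real k) * e"
        by (simp add: E)
      then have "(real n * (real k - real l)) * e \<le> (real k * (real n - real l)) * E"
        by (simp add: algebra_simps)
      then have ee: "e \<le> (real k * (real n - real l)) * E / (real n * (real k - real l))"
        using lk by (subst pos_le_divide_eq) (auto simp: mult_ac)
      have "(real l + \<alpha>) * E - \<alpha> * ((real k * (real n - real l)) * E / (real n * (real k - real l))) = c * E"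
        using lk by (simp add: c_def of_nat_diff field_simps)
      moreover have "\<alpha> * e \<le> \<alpha> * ((real k * (real n - real l)) * E / (real n * (real k - real l)))"
        using ee assms(4) by (rule mult_left_mono)
      ultimately show ?thesis by linarith
    qed
    then show ?thesis by (simp add: E_def e_def)
  qed
  then show ?thesis using c0 cl by blast
qed

text \<open>Double counting: a subset with \<open>Suc j\<close> elements arises once for each of its
  elements.\<close>

lemma sum_esym_remove:
  assumes "finite A"
  shows "(\<Sum>i\<in>A. x i * esym x (A - {i}) j) = real (Suc j) * esym x A (Suc j)"
proof -
  have e: "x i * esym x (A - {i}) j = (\<Sum>I | I \<subseteq> A \<and> card I = Suc j. if i \<in> I then \<Prod>i\<in>I. x i else 0)"
    if "i \<in> A" for i
  proof -
    have b: "bij_betw (insert i) {I. I \<subseteq> A - {i} \<and> card I = j} {I. I \<subseteq> A \<and> card I = Suc j \<and> i \<in> I}"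
    proof (rule bij_betw_byWitness[where f' = "\<lambda>I. I - {i}"])
      have "finite I" if "I \<subseteq> A" for I using that assms finite_subset by blast
      then show "insert i ` {I. I \<subseteq> A - {i} \<and> card I = j} \<subseteq> {I. I \<subseteq> A \<and> card I = Suc j \<and> i \<in> I}"
        using \<open>i \<in> A\<close> by (auto simp: subset_Diff_insert)
      show "(\<lambda>I. I - {i}) ` {I. I \<subseteq> A \<and> card I = Suc j \<and> i \<in> I} \<subseteq> {I. I \<subseteq> A - {i} \<and> card I = j}"
        by auto
    qed auto
    have "x i * esym x (A - {i}) j = (\<Sum>I | I \<subseteq> A - {i} \<and> card I = j. \<Prod>i\<in>insert i I. x i)"
      unfolding esym_def sum_distrib_left
    proof (rule sum.cong[OF refl])
      fix I assume "I \<in> {I. I \<subseteq> A - {i} \<and> card I = j}"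
      then have "finite I" "i \<notin> I" using assms by (auto dest: finite_subset)
      then show "x i * (\<Prod>i\<in>I. x i) = (\<Prod>i\<in>insert i I. x i)" by simp
    qed
    also have "\<dots> = (\<Sum>I | I \<subseteq> A \<and> card I = Suc j \<and> i \<in> I. \<Prod>i\<in>I. x i)"
      by (rule sum.reindex_bij_betw[OF b])
    also have "\<dots> = (\<Sum>I | I \<subseteq> A \<and> card I = Suc j. if i \<in> I then \<Prod>i\<in>I. x i else 0)"
      using assms by (subst sum.inter_filter[symmetric]) (auto intro!: sum.cong)
    finally show ?thesis .
  qed
  have "(\<Sum>i\<in>A. x i * esym x (A - {i}) j)
      = (\<Sum>i\<in>A. \<Sum>I | I \<subseteq> A \<and> card I = Suc j. if i \<in> I then \<Prod>i\<in>I. x i else 0)"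
    using e by (rule sum.cong[OF refl])
  also have "\<dots> = (\<Sum>I | I \<subseteq> A \<and> card I = Suc j. \<Sum>i\<in>A. if i \<in> I then \<Prod>i\<in>I. x i else 0)"
    by (rule sum.swap)
  also have "\<dots> = (\<Sum>I | I \<subseteq> A \<and> card I = Suc j. real (Suc j) * (\<Prod>i\<in>I. x i))"
  proof (rule sum.cong[OF refl])
    fix I assume "I \<in> {I. I \<subseteq> A \<and> card I = Suc j}"
    then have I: "I \<subseteq> A" "card I = Suc j" by auto
    have "(\<Sum>i\<in>A. if i \<in> I then \<Prod>i\<in>I. x i else 0) = (\<Sum>i\<in>A \<inter> I. \<Prod>i\<in>I. x i)"
      by (rule sum.inter_restrict[OF assms, symmetric])
    also have "A \<inter> I = I" using I by blast
    finally show "(\<Sum>i\<in>A. if i \<in> I then \<Prod>i\<in>I. x i else 0) = real (Suc j) * (\<Prod>i\<in>I. x i)"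
      using I by simp
  qed
  finally show ?thesis by (simp add: esym_def sum_distrib_left)
qed

lemma esym_remove:
  assumes "finite A" "i \<in> A"
  shows "esym x A (Suc j) = esym x (A - {i}) (Suc j) + x i * esym x (A - {i}) j"
  using esym_insert[of "A - {i}" i x j] assms by (simp add: insert_absorb)

lemma esym_1: "finite A \<Longrightarrow> esym x A 1 = (\<Sum>i\<in>A. x i)"
proof -
  assume "finite A"
  then have "(\<Sum>i\<in>A. x i * esym x (A - {i}) 0) = (\<Sum>i\<in>A. x i)" by (simp add: esym_0)
  then show ?thesis using sum_esym_remove[OF \<open>finite A\<close>, of x 0] by (simp only: One_nat_def of_nat_1 mult_1)
qed

lemma sum_squares_esym:
  assumes "finite A"
  shows "(\<Sum>i\<in>A. (x i)\<^sup>2) = (esym x A 1)\<^sup>2 - 2 * esym x A 2"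
proof -
  have "2 * esym x A 2 = (\<Sum>i\<in>A. x i * esym x (A - {i}) 1)"
    using sum_esym_remove[OF assms, of x 1] by (simp add: numeral_2_eq_2)
  also have "\<dots> = (\<Sum>i\<in>A. x i * esym x A 1 - (x i)\<^sup>2)"
  proof (rule sum.cong[OF refl])
    fix i assume "i \<in> A"
    then show "x i * esym x (A - {i}) 1 = x i * esym x A 1 - (x i)\<^sup>2"
      using esym_remove[OF assms, of i x 0] assms by (simp add: esym_0 power2_eq_square algebra_simps)
  qed
  also have "\<dots> = (esym x A 1)\<^sup>2 - (\<Sum>i\<in>A. (x i)\<^sup>2)"
    unfolding sum_subtractf sum_distrib_right[symmetric] esym_1[OF assms, symmetric] power2_eq_square ..
  finally show ?thesis by simp
qed

lemma sum_esym_remove':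
  assumes "finite A"
  shows "(\<Sum>i\<in>A. esym x (A - {i}) j) = (real (card A) - real j) * esym x A j"
proof (cases j)
  case 0
  then show ?thesis using assms by (simp add: esym_0)
next
  case (Suc j')
  have "(\<Sum>i\<in>A. esym x (A - {i}) j) = (\<Sum>i\<in>A. esym x A j - x i * esym x (A - {i}) j')"
    using esym_remove[OF assms] by (intro sum.cong) (auto simp: Suc)
  then show ?thesis using sum_esym_remove[OF assms, of x j']
    by (simp add: sum_subtractf Suc algebra_simps)
qed

section \<open>Spectral theorem\<close>

lemma symmetric_inner_matrix:
  fixes A :: "real^'n^'n"
  assumes "transpose A = A"
  shows "(A *v x) \<bullet> y = x \<bullet> (A *v y)"
  using dot_lmul_matrix[of x A y] transpose_matrix_vector[of A x] assms by simp

text \<open>A maximiser \<open>v\<close> of the Rayleigh quotient on the unit sphere of the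
  invariant subspace is an eigenvector. The candidate error \<open>w = A v - \<mu> v\<close> lies in
  the subspace and is orthogonal to \<open>v\<close>, so it can itself serve as direction of
  variation.\<close>

lemma matrix_symmetric_inner_eigenvector:
  fixes A :: "real^'n^'n"
  assumes A: "transpose A = A" and S: "subspace S" "\<And>x. x \<in> S \<Longrightarrow> A *v x \<in> S" "S \<noteq> {0}"
  shows "\<exists>v\<in>S. norm v = 1 \<and> (\<exists>c. A *v v = c *\<^sub>R v)"
proof -
  define f where "f = (\<lambda>x. x \<bullet> (A *v x))"
  obtain x0 where x0: "x0 \<in> S" "x0 \<noteq> 0" using S subspace_0 by blast
  have "compact (S \<inter> sphere 0 1)"
    by (intro closed_Int_compact closed_subspace S(1) compact_sphere)
  moreover have "(1 / norm x0) *\<^sub>R x0 \<in> S \<inter> sphere 0 1"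
    using x0 S(1) by (simp add: subspace_scale)
  then have "S \<inter> sphere 0 1 \<noteq> {}" by blast
  moreover have "continuous_on (S \<inter> sphere 0 1) f"
    unfolding f_def by (intro continuous_intros)
  ultimately obtain v where v: "v \<in> S" "norm v = 1" and max: "\<And>y. y \<in> S \<Longrightarrow> norm y = 1 \<Longrightarrow> f y \<le> f v"
    using continuous_attains_sup[of "S \<inter> sphere 0 1" f] by fastforce
  define \<mu> where "\<mu> = f v"
  have le: "f y \<le> \<mu> * (y \<bullet> y)" if "y \<in> S" for y
  proof (cases "y = 0")
    case False
    have "f ((1 / norm y) *\<^sub>R y) \<le> \<mu>"
      unfolding \<mu>_def using that False S(1) by (intro max) (auto simp: subspace_scale)
    then have "f y / (norm y)\<^sup>2 \<le> \<mu>"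
      by (simp add: f_def matrix_vector_mult_scaleR power2_eq_square)
    then show ?thesis using False by (simp add: divide_le_eq dot_square_norm)
  qed (simp add: f_def)
  define w where "w = A *v v - \<mu> *\<^sub>R v"
  have vv: "v \<bullet> v = 1" using v by (simp add: dot_square_norm)
  have wS: "w \<in> S" unfolding w_def using S v by (simp add: subspace_diff subspace_scale)
  have wv: "w \<bullet> v = 0"
    unfolding w_def inner_diff_left inner_scaleR_left vv using inner_commute[of "A *v v" v]
    by (simp add: \<mu>_def f_def)
  have wAv: "w \<bullet> (A *v v) = w \<bullet> w"
  proof -
    have "A *v v = w + \<mu> *\<^sub>R v" by (simp add: w_def)
    then show ?thesis by (simp add: inner_add_right wv)
  qed
  define a where "a = w \<bullet> w"
  define d where "d = \<mu> * a - f w"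
  have ineq: "2 * t * a \<le> t\<^sup>2 * d" for t
  proof -
    have "v + t *\<^sub>R w \<in> S" using v wS S by (simp add: subspace_add subspace_scale)
    from le[OF this] have "f (v + t *\<^sub>R w) \<le> \<mu> * (1 + t\<^sup>2 * a)"
      using vv wv by (simp add: inner_add_left inner_add_right inner_commute a_def power2_eq_square mult.assoc)
    moreover have "f (v + t *\<^sub>R w) = \<mu> + 2 * t * a + t\<^sup>2 * f w"
      using symmetric_inner_matrix[OF A, of v w] wAv
      by (simp add: f_def \<mu>_def a_def matrix_vector_right_distrib matrix_vector_mult_scaleR
          inner_add_left inner_add_right inner_commute power2_eq_square algebra_simps)
    ultimately show ?thesis by (simp add: d_def algebra_simps)
  qed
  have "a = 0"
  proof (rule ccontr)
    assume "a \<noteq> 0"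
    then have a: "a > 0" by (simp add: a_def)
    \<comment> \<open>Small enough that \<open>t * d <= a\<close>, whereas \<open>ineq\<close>
      demands \<open>2 * a <= t * d\<close>.\<close>
    define t where "t = a / (\<bar>d\<bar> + 1)"
    have t: "t > 0" using a by (simp add: t_def add_nonneg_pos)
    have "t * (2 * a) \<le> t * (t * d)" using ineq[of t] by (simp add: power2_eq_square algebra_simps)
    then have "2 * a \<le> t * d" using t by simp
    also have "\<dots> \<le> t * (\<bar>d\<bar> + 1)" using t by (intro mult_left_mono) auto
    also have "\<dots> = a" by (simp add: t_def)
    finally show False using a by simp
  qed
  then have "A *v v = \<mu> *\<^sub>R v" by (simp add: a_def w_def)
  then show ?thesis using v by blast
qed

text \<open>Symmetry makes the orthogonal complement of an eigenvector inside \<open>S\<close>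
  invariant again, and its dimension is smaller.\<close>

lemma symmetric_matrix_eigenbasis:
  fixes A :: "real^'n^'n"
  assumes A: "transpose A = A" and "subspace S" "\<And>x. x \<in> S \<Longrightarrow> A *v x \<in> S"
  shows "\<exists>B. pairwise orthogonal B \<and> (\<forall>b\<in>B. norm b = 1 \<and> (\<exists>c. A *v b = c *\<^sub>R b)) \<and> B \<subseteq> S \<and> span B = S"
  using assms(2,3)
proof (induction "dim S" arbitrary: S rule: less_induct)
  case less
  show ?case
  proof (cases "S = {0}")
    case True
    then show ?thesis by (intro exI[of _ "{}"]) simp
  next
    case False
    obtain v c where v: "v \<in> S" "norm v = 1" "A *v v = c *\<^sub>R v"
      using matrix_symmetric_inner_eigenvector[OF A less.prems False] by blast
    define S' where "S' = {x \<in> S. v \<bullet> x = 0}"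
    have S': "subspace S'"
      using less.prems(1) unfolding S'_def subspace_def by (auto simp: inner_add_right)
    have vv: "v \<bullet> v = 1" using v by (simp add: dot_square_norm)
    have inv: "A *v x \<in> S'" if "x \<in> S'" for x
      using that less.prems(2) symmetric_inner_matrix[OF A, of v x] v(3) unfolding S'_def by simp
    have "v \<notin> S'" using vv by (simp add: S'_def)
    then have "S' \<subset> S" using v(1) unfolding S'_def by blast
    then have "span S' \<subset> span S"
      unfolding span_eq_iff[THEN iffD2, OF S'] span_eq_iff[THEN iffD2, OF less.prems(1)] .
    then have "dim S' < dim S" by (rule dim_psubset)
    from less.hyps[OF this S' inv] obtain B where B: "pairwise orthogonal B"
      "\<forall>b\<in>B. norm b = 1 \<and> (\<exists>c. A *v b = c *\<^sub>R b)" "B \<subseteq> S'" "span B = S'" by blast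
    have "S \<subseteq> span (insert v B)"
    proof
      fix x assume x: "x \<in> S"
      have "x - (v \<bullet> x) *\<^sub>R v \<in> span B"
        unfolding B(4) S'_def using x v less.prems(1) vv
        by (auto simp: subspace_diff subspace_scale inner_diff_right)
      then show "x \<in> span (insert v B)" by (auto simp: span_insert)
    qed
    moreover have "span (insert v B) \<subseteq> S"
      using B(3) v(1) less.prems(1) by (intro span_minimal) (auto simp: S'_def)
    moreover have "pairwise orthogonal (insert v B)"
      using B(1,3) by (auto simp: pairwise_insert S'_def orthogonal_def inner_commute)
    ultimately show ?thesis
      using B v by (intro exI[of _ "insert v B"]) (auto simp: S'_def)
  qed
qed

definition diag_mat :: "real^'n \<Rightarrow> real^'n^'n" where
  "diag_mat lam = (\<chi> i j. if i = j then lam $ i else 0)"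

theorem symmetric_matrix_diagonalizable:
  fixes A :: "real^'n^'n"
  assumes A: "transpose A = A"
  shows "\<exists>lam P. orthogonal_matrix P \<and> A = P ** diag_mat lam ** transpose P"
proof -
  obtain B where B: "pairwise orthogonal B" "\<And>b. b \<in> B \<Longrightarrow> norm b = 1"
    "\<And>b. b \<in> B \<Longrightarrow> \<exists>c. A *v b = c *\<^sub>R b" "span B = UNIV"
    using symmetric_matrix_eigenbasis[OF A, of UNIV] by (auto simp: subspace_UNIV)
  have "0 \<notin> B" using B(2) by force
  then have ind: "independent B" using B(1) by (rule pairwise_orthogonal_independent[rotated])
  have fin: "finite B" using ind independent_imp_finite by blast
  have "card B = CARD('n)" using dim_eq_card[of B UNIV] ind B(4) by simp
  then obtain f :: "'n \<Rightarrow> real^'n" where f: "bij_betw f UNIV B"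
    using finite_same_card_bij[OF finite_class.finite_UNIV fin] by auto
  have "\<forall>j. \<exists>c. A *v f j = c *\<^sub>R f j" using f B(3) by (auto simp: bij_betw_def)
  then obtain c where c: "\<And>j. A *v f j = c j *\<^sub>R f j" by metis
  define P where "P = (\<chi> i j. f j $ i)"
  have col: "column j P = f j" for j by (simp add: P_def column_def vec_eq_iff)
  have P: "orthogonal_matrix P"
    unfolding orthogonal_matrix_orthonormal_columns col
  proof (intro conjI allI impI)
    fix i j
    have "f i \<in> B" "f j \<in> B" using f by (auto simp: bij_betw_def)
    then show "norm (f i) = 1" using B(2) by blast
    assume "i \<noteq> j"
    then have "f i \<noteq> f j" using f by (auto simp: bij_betw_def inj_on_def)
    then show "orthogonal (f i) (f j)"
      using B(1) \<open>f i \<in> B\<close> \<open>f j \<in> B\<close> by (auto simp: pairwise_def)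
  qed
  have "A ** P = P ** diag_mat (\<chi> j. c j)"
  proof -
    have "(A ** P) $ i $ j = (P ** diag_mat (\<chi> j. c j)) $ i $ j" for i j
    proof -
      have "(A ** P) $ i $ j = (A *v f j) $ i"
        by (simp add: matrix_matrix_mult_def matrix_vector_mult_def P_def)
      also have "\<dots> = f j $ i * c j" by (simp add: c)
      also have "\<dots> = (P ** diag_mat (\<chi> j. c j)) $ i $ j"
        by (simp add: matrix_matrix_mult_def P_def diag_mat_def if_distrib cong: if_cong)
      finally show ?thesis .
    qed
    then show ?thesis by (simp add: vec_eq_iff)
  qed
  moreover have "A = A ** P ** transpose P"
    using P by (simp add: orthogonal_matrix_def flip: matrix_mul_assoc)
  ultimately have "A = P ** diag_mat (\<chi> j. c j) ** transpose P" by simp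
  then show ?thesis using P by blast
qed

section \<open>Newton transformations\<close>

text \<open>The Faddeev--LeVerrier recursion: it yields \<open>S\<^sub>l\<close> as a polynomial in the entries of \<open>M\<close>, without
  reference to eigenvalues.\<close>

primrec NT :: "nat \<Rightarrow> real^'n^'n \<Rightarrow> real^'n^'n" where
  "NT 0 M = mat 1"
| "NT (Suc l) M = (trace (NT l M ** M) / real (Suc l)) *\<^sub>R mat 1 - NT l M ** M"

definition sg :: "nat \<Rightarrow> real^'n^'n \<Rightarrow> real" where
  "sg l M = (case l of 0 \<Rightarrow> 1 | Suc m \<Rightarrow> trace (NT m M ** M) / real l)"

lemma sg_0 [simp]: "sg 0 M = 1"
  by (simp add: sg_def)

lemma trace_NT_mult: "trace (NT l M ** M) = real (Suc l) * sg (Suc l) M"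
  by (simp add: sg_def)

lemma NT_Suc: "NT (Suc l) M = sg (Suc l) M *\<^sub>R mat 1 - NT l M ** M"
  by (simp add: sg_def)

definition eig_decomp :: "real^'n^'n \<Rightarrow> real^'n^'n \<Rightarrow> real^'n \<Rightarrow> bool" where
  "eig_decomp M P lam \<longleftrightarrow> orthogonal_matrix P \<and> M = P ** diag_mat lam ** transpose P"

text \<open>The eigenvalues of \<open>NT j M\<close> when \<open>lam\<close> lists those of
  \<open>M\<close>: in each eigendirection the corresponding entry of \<open>lam\<close> is left
  out.\<close>

definition esym_at :: "real^'n \<Rightarrow> nat \<Rightarrow> real^'n" where
  "esym_at lam j = (\<chi> i. esym (($) lam) (UNIV - {i}) j)"

lemma S_sym_esym: "S_sym j lam = esym (($) lam) UNIV j"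
  by (simp add: S_sym_def esym_def)

lemma diag_mat_mult: "diag_mat x ** diag_mat y = diag_mat (\<chi> i. x $ i * y $ i)"
  by (simp add: vec_eq_iff diag_mat_def matrix_matrix_mult_def mult_delta_left)

lemma trace_diag_mat: "trace (diag_mat x) = (\<Sum>i\<in>UNIV. x $ i)"
  by (simp add: trace_def diag_mat_def)

lemma matrix_conj_mult:
  fixes P A B :: "real^'n^'n"
  assumes "orthogonal_matrix P"
  shows "(P ** A ** transpose P) ** (P ** B ** transpose P) = P ** (A ** B) ** transpose P"
proof -
  have "(P ** A ** transpose P) ** (P ** B ** transpose P)
     = P ** A ** (transpose P ** P) ** B ** transpose P"
    by (simp only: matrix_mul_assoc)
  also have "transpose P ** P = mat 1" using assms by (simp add: orthogonal_matrix)
  finally show ?thesis by (simp only: matrix_mul_rid matrix_mul_assoc)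
qed

lemma trace_conj:
  fixes P A :: "real^'n^'n"
  assumes "orthogonal_matrix P"
  shows "trace (P ** A ** transpose P) = trace A"
proof -
  have "trace (P ** A ** transpose P) = trace (transpose P ** (P ** A))"
    using trace_mul_sym[of "P ** A" "transpose P"] .
  then show ?thesis using assms by (simp add: matrix_mul_assoc orthogonal_matrix)
qed

lemma NT_diag: "NT l (diag_mat lam) = diag_mat (esym_at lam l)"
  and sg_diag: "sg l (diag_mat lam) = S_sym l lam"
proof -
  have *: "NT l (diag_mat lam) = diag_mat (esym_at lam l) \<Longrightarrow> sg (Suc l) (diag_mat lam) = S_sym (Suc l) lam" for l
    using sum_esym_remove[of UNIV "($) lam" l]
    by (simp add: sg_def diag_mat_mult trace_diag_mat esym_at_def S_sym_esym mult.commute del: of_nat_Suc)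
  have NT: "NT l (diag_mat lam) = diag_mat (esym_at lam l)" for l
  proof (induction l)
    case 0
    then show ?case by (simp add: vec_eq_iff diag_mat_def esym_at_def esym_0 mat_def)
  next
    case (Suc l)
    have "esym (($) lam) UNIV (Suc l) - esym (($) lam) (UNIV - {i}) l * lam $ i = esym (($) lam) (UNIV - {i}) (Suc l)" for i
      using esym_remove[of UNIV i "($) lam" l] by simp
    then show ?case
      unfolding NT_Suc *[OF Suc] Suc diag_mat_mult S_sym_esym
      by (simp add: vec_eq_iff diag_mat_def esym_at_def mat_def)
  qed
  then show "NT l (diag_mat lam) = diag_mat (esym_at lam l)" .
  show "sg l (diag_mat lam) = S_sym l lam"
    by (cases l) (auto simp: * NT S_sym_esym esym_0)
qed

lemma NT_conj:
  assumes P: "orthogonal_matrix P"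
  shows "NT l (P ** A ** transpose P) = P ** NT l A ** transpose P"
proof (induction l)
  case 0
  then show ?case using P by (simp add: orthogonal_matrix_def)
next
  case (Suc l)
  have sub: "P ** (c *\<^sub>R mat 1 - B) ** transpose P = c *\<^sub>R mat 1 - P ** B ** transpose P" for c B
  proof -
    have "P ** (c *\<^sub>R mat 1 - B) = c *\<^sub>R P - P ** B"
      by (simp add: vec_eq_iff matrix_matrix_mult_def mat_def right_diff_distrib sum_subtractf
          if_distrib[of "\<lambda>x. _ * x"] mult.commute cong: if_cong)
    then have "P ** (c *\<^sub>R mat 1 - B) ** transpose P = c *\<^sub>R (P ** transpose P) - P ** B ** transpose P"
      by (simp add: vec_eq_iff matrix_matrix_mult_def algebra_simps sum_subtractf sum_distrib_left)
    then show ?thesis using P by (simp add: orthogonal_matrix_def)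
  qed
  show ?case
    by (simp only: NT.simps Suc.IH matrix_conj_mult[OF P] trace_conj[OF P] sub)
qed

lemma sg_conj:
  assumes P: "orthogonal_matrix P"
  shows "sg l (P ** A ** transpose P) = sg l A"
  by (cases l) (simp_all only: sg_def NT_conj[OF P] matrix_conj_mult[OF P] trace_conj[OF P] nat.case)

lemma sg_eig: "eig_decomp M P lam \<Longrightarrow> sg l M = esym (($) lam) UNIV l"
  by (simp add: eig_decomp_def sg_conj sg_diag S_sym_esym)

lemma eig_decomp_exists:
  fixes M :: "real^'n^'n"
  assumes "transpose M = M"
  obtains P lam where "eig_decomp M P lam"
  using symmetric_matrix_diagonalizable[OF assms] unfolding eig_decomp_def by blast

text \<open>\<open>eigvals\<close> is a choice, meaningful only if some orthogonal diagonalisation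
  exists; symmetry of the Hessian supplies one. The result does not depend on the choice because
  \<open>sg\<close> is invariant under orthogonal conjugation.\<close>

lemma Fk_sg:
  assumes "transpose (H x) = H x"
  shows "Fk l H x = sg l (H x)"
proof -
  have "\<exists>lam P. orthogonal_matrix P \<and> H x = P ** diag_mat lam ** transpose P"
    by (rule symmetric_matrix_diagonalizable[OF assms])
  then have "\<exists>P. orthogonal_matrix P \<and> H x = P ** diag_mat (eigvals (H x)) ** transpose P"
    unfolding eigvals_def diag_mat_def by (rule someI_ex)
  then obtain P where "eig_decomp (H x) P (eigvals (H x))" by (auto simp: eig_decomp_def)
  from sg_eig[OF this] show ?thesis by (simp add: Fk_def S_sym_esym)
qed

lemma orthogonal_norm:
  fixes P :: "real^'n^'n"
  assumes "orthogonal_matrix P"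
  shows "norm (P *v x) = norm x"
  using assms orthogonal_transformation_matrix[of "(*v) P"]
  by (simp add: orthogonal_transformation)

lemma diag_mat_vector: "diag_mat x *v y = (\<chi> i. x $ i * y $ i)"
  by (simp add: vec_eq_iff diag_mat_def matrix_vector_mult_def mult_delta_left)

lemma conj_inner:
  fixes P :: "real^'n^'n"
  shows "w \<bullet> ((P ** diag_mat d ** transpose P) *v v)
    = (\<Sum>i\<in>UNIV. d $ i * (transpose P *v w) $ i * (transpose P *v v) $ i)"
proof -
  have "w \<bullet> ((P ** diag_mat d ** transpose P) *v v) = (transpose P *v w) \<bullet> (diag_mat d *v (transpose P *v v))"
    using dot_lmul_matrix[of w P "diag_mat d *v (transpose P *v v)"]
    by (simp only: matrix_vector_mul_assoc[symmetric] transpose_matrix_vector)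
  then show ?thesis unfolding diag_mat_vector inner_vec_def by (simp add: mult_ac)
qed

lemma NT_inner_eig:
  assumes "eig_decomp M P lam"
  shows "w \<bullet> (NT l M *v v)
    = (\<Sum>i\<in>UNIV. esym (($) lam) (UNIV - {i}) l * (transpose P *v w) $ i * (transpose P *v v) $ i)"
proof -
  have "NT l M = P ** diag_mat (esym_at lam l) ** transpose P"
    using assms by (simp add: eig_decomp_def NT_conj NT_diag)
  then show ?thesis by (simp add: conj_inner esym_at_def)
qed

text \<open>For \<open>l < k\<close> the eigenvalues of \<open>NT l M\<close> are nonnegative with
  sum (n - l) S_l, so the trace dominates the bilinear form.\<close>

lemma NT_bound:
  fixes M :: "real^'n^'n"
  assumes M: "transpose M = M" and pos: "\<And>j. j \<le> k \<Longrightarrow> 0 \<le> sg j M" and l: "l < k"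
  shows "\<bar>w \<bullet> (NT l M *v v)\<bar> \<le> real CARD('n) * sg l M * (norm w * norm v)"
proof -
  obtain P lam where E: "eig_decomp M P lam" using eig_decomp_exists[OF M] .
  then have P: "orthogonal_matrix (transpose P)" by (simp add: eig_decomp_def)
  let ?e = "\<lambda>i. esym (($) lam) (UNIV - {i}) l"
  define tw tv where "tw = transpose P *v w" and "tv = transpose P *v v"
  have ntw: "norm tw = norm w" "norm tv = norm v" unfolding tw_def tv_def by (rule orthogonal_norm[OF P])+
  have e: "0 \<le> ?e i" for i
    using esym_remove_nonneg[of "UNIV - {i}" i k "($) lam" l] pos l by (simp add: sg_eig[OF E] insert_absorb)
  have "\<bar>w \<bullet> (NT l M *v v)\<bar> \<le> (\<Sum>i\<in>UNIV. \<bar>?e i * tw $ i * tv $ i\<bar>)"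
    unfolding NT_inner_eig[OF E, where w=w and l=l and v=v, folded tw_def tv_def] by (rule sum_abs)
  also have "\<dots> \<le> (\<Sum>i\<in>UNIV. ?e i * (norm w * norm v))"
  proof (rule sum_mono)
    fix i
    have "\<bar>tw $ i * tv $ i\<bar> \<le> norm w * norm v"
      unfolding abs_mult using component_le_norm_cart[of tw i] component_le_norm_cart[of tv i]
      by (intro mult_mono) (simp_all add: ntw)
    then have "?e i * \<bar>tw $ i * tv $ i\<bar> \<le> ?e i * (norm w * norm v)" using e by (rule mult_left_mono)
    then show "\<bar>?e i * tw $ i * tv $ i\<bar> \<le> ?e i * (norm w * norm v)"
      using e[of i] by (simp add: abs_mult mult.assoc)
  qed
  also have "\<dots> = (real CARD('n) - real l) * sg l M * (norm w * norm v)"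
    using sum_esym_remove'[of UNIV "($) lam" l] by (simp add: sg_eig[OF E] flip: sum_distrib_right)
  also have "\<dots> \<le> real CARD('n) * sg l M * (norm w * norm v)"
    using pos[of l] l by (intro mult_right_mono) auto
  finally show ?thesis .
qed

text \<open>In an eigenbasis of \<open>M\<close> both sides become sums over eigendirections
  weighted by squared coordinates of \<open>v\<close>, and \<open>esym_lower_bound\<close> applies
  to each. The excess of \<rho> over |v|^2 is covered by \<open>c <= real l\<close>.\<close>

lemma NT_lower_bound:
  assumes "1 \<le> l" "l \<le> k" "k \<le> CARD('n)" "0 \<le> \<alpha>"
    and "k = CARD('n) \<or> \<alpha> * real (CARD('n) - k) < real (CARD('n) * (k - l))"
  shows "\<exists>c>0. \<forall>(M :: real^'n^'n) v \<rho>. transpose M = M \<longrightarrow> (\<forall>j\<le>k. 0 \<le> sg j M) \<longrightarrow> (norm v)\<^sup>2 \<le> \<rho> \<longrightarrow>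
      c * sg l M * \<rho> \<le> real l * sg l M * \<rho> + \<alpha> * (sg l M * (norm v)\<^sup>2 - v \<bullet> (NT l M *v v))"
proof -
  from esym_lower_bound[OF assms, where 'a='n] obtain c where c: "c > 0" "c \<le> real l"
    and cc: "\<forall>A a (x :: 'n \<Rightarrow> real). finite A \<longrightarrow> a \<notin> A \<longrightarrow> card (insert a A) = CARD('n) \<longrightarrow>
      (\<forall>j\<le>k. 0 \<le> esym x (insert a A) j) \<longrightarrow>
      c * esym x (insert a A) l \<le> (real l + \<alpha>) * esym x (insert a A) l - \<alpha> * esym x A l"
    by (elim exE conjE) rule
  have "c * sg l M * \<rho> \<le> real l * sg l M * \<rho> + \<alpha> * (sg l M * (norm v)\<^sup>2 - v \<bullet> (NT l M *v v))"
    if M: "transpose M = M" and pos: "\<forall>j\<le>k. 0 \<le> sg j M" and \<rho>: "(norm v)\<^sup>2 \<le> \<rho>"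
    for M :: "real^'n^'n" and v \<rho>
  proof -
    obtain P lam where E: "eig_decomp M P lam" using eig_decomp_exists[OF M] .
    then have P: "orthogonal_matrix (transpose P)" by (simp add: eig_decomp_def)
    let ?e = "\<lambda>i. esym (($) lam) (UNIV - {i}) l"
    define tv where "tv = transpose P *v v"
    have ntv: "norm tv = norm v" unfolding tv_def by (rule orthogonal_norm[OF P])
    have nv: "(norm v)\<^sup>2 = (\<Sum>i\<in>UNIV. (tv $ i)\<^sup>2)"
      unfolding ntv[symmetric] power2_norm_eq_inner by (simp add: inner_vec_def power2_eq_square)
    have tm: "c * sg l M \<le> (real l + \<alpha>) * sg l M - \<alpha> * ?e i" for i
      using cc[rule_format, of "UNIV - {i}" i "($) lam"] pos by (simp add: sg_eig[OF E] insert_absorb)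
    have "c * sg l M * (norm v)\<^sup>2 = (\<Sum>i\<in>UNIV. (c * sg l M) * (tv $ i)\<^sup>2)"
      by (simp add: nv sum_distrib_left)
    also have "\<dots> \<le> (\<Sum>i\<in>UNIV. ((real l + \<alpha>) * sg l M - \<alpha> * ?e i) * (tv $ i)\<^sup>2)"
      using tm by (intro sum_mono mult_right_mono) auto
    also have "\<dots> = (real l + \<alpha>) * sg l M * (norm v)\<^sup>2 - \<alpha> * (v \<bullet> (NT l M *v v))"
      unfolding NT_inner_eig[OF E, where w=v and l=l and v=v, folded tv_def] nv
      by (simp add: sum_subtractf sum.distrib sum_distrib_left power2_eq_square algebra_simps)
    finally have 1: "c * sg l M * (norm v)\<^sup>2 \<le> (real l + \<alpha>) * sg l M * (norm v)\<^sup>2 - \<alpha> * (v \<bullet> (NT l M *v v))" .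
    have "0 \<le> (real l - c) * sg l M * (\<rho> - (norm v)\<^sup>2)"
      using c pos assms(2) \<rho> by simp
    with 1 show ?thesis by (simp add: algebra_simps)
  qed
  then show ?thesis using c by blast
qed

text \<open>The squares of the eigenvalues sum to S_1^2 - 2 S_2 <= S_1^2 once S_2 >= 0. In dimension
  one the trace is the only eigenvalue.\<close>

lemma hessian_le_trace:
  fixes M :: "real^'n^'n"
  assumes M: "transpose M = M" and pos: "\<And>j. j \<le> k \<Longrightarrow> 0 \<le> sg j M" and k: "2 \<le> k \<or> CARD('n) = 1 \<and> k = 1"
  shows "norm (M *v v) \<le> sg 1 M * norm v"
proof -
  obtain P lam where E: "eig_decomp M P lam" using eig_decomp_exists[OF M] .
  then have P: "orthogonal_matrix P" "orthogonal_matrix (transpose P)" by (simp_all add: eig_decomp_def)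
  have s1: "0 \<le> sg 1 M" using pos[of 1] k by auto
  have lam: "\<bar>lam $ i\<bar> \<le> sg 1 M" for i
  proof (cases "2 \<le> k")
    case True
    have "(lam $ i)\<^sup>2 \<le> (\<Sum>i\<in>UNIV. (lam $ i)\<^sup>2)" by (rule member_le_sum) auto
    also have "\<dots> = (sg 1 M)\<^sup>2 - 2 * sg 2 M"
      using sum_squares_esym[of UNIV "($) lam"] by (simp add: sg_eig[OF E])
    also have "\<dots> \<le> (sg 1 M)\<^sup>2" using pos[OF True] by simp
    finally show ?thesis using abs_le_square_iff[of "lam $ i" "sg 1 M"] s1 by simp
  next
    case False
    then obtain j where "UNIV = {j :: 'n}" using k False card_1_singletonE[of "UNIV :: 'n set"] by auto
    then have "UNIV = {i}" by (metis UNIV_I singletonD)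
    then have "sum (($) lam) UNIV = sum (($) lam) {i}" by (rule arg_cong)
    then have "sum (($) lam) UNIV = lam $ i" by simp
    then have "sg 1 M = lam $ i" using esym_1[of UNIV "($) lam"] by (simp add: sg_eig[OF E])
    then show ?thesis using s1 by simp
  qed
  define tv where "tv = transpose P *v v"
  have "norm (M *v v) = norm (P *v (diag_mat lam *v tv))"
  proof -
    have "M = P ** diag_mat lam ** transpose P" using E by (simp add: eig_decomp_def)
    then have "M *v v = P *v (diag_mat lam *v tv)"
      by (simp only: tv_def matrix_vector_mul_assoc matrix_mul_assoc)
    then show ?thesis by (rule arg_cong)
  qed
  also have "\<dots> = norm (\<chi> i. lam $ i * tv $ i)" by (simp add: orthogonal_norm[OF P(1)] diag_mat_vector)
  also have "\<dots> \<le> norm (sg 1 M *\<^sub>R tv)"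
    using lam s1 by (intro norm_le_componentwise_cart) (simp add: abs_mult mult_right_mono)
  also have "\<dots> = sg 1 M * norm v" using s1 orthogonal_norm[OF P(2), of v] by (simp add: tv_def)
  finally show ?thesis .
qed

text \<open>With \<open>S' = P S\<close> and \<open>\<delta>\<close> a variation for which \<open>\<delta>P = (X Q)'\<close>, the series \<open>W = \<delta>S - X Q S\<close>
  satisfies \<open>W' = P W\<close> and \<open>W(0) = 0\<close>, hence vanishes. For \<open>P\<close> built from power sums this is
  \<open>\<delta>S\<^bsub>l+1\<^esub> = tr(T\<^sub>l \<delta>M)\<close>.\<close>

lemma fps_newton_variation:
  fixes s ds P Q :: "nat \<Rightarrow> real"
  assumes s: "\<And>l. real (Suc l) * s (Suc l) = (\<Sum>i\<le>l. P i * s (l - i))"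
    and ds: "\<And>l. real (Suc l) * ds (Suc l) = (\<Sum>i\<le>l. P i * ds (l - i) + real (Suc i) * Q i * s (l - i))"
    and ds0: "ds 0 = 0"
  shows "ds (Suc l) = (\<Sum>i\<le>l. Q i * s (l - i))"
proof -
  define S dS PP XQ where "S = Abs_fps s" and "dS = Abs_fps ds" and "PP = Abs_fps P" and "XQ = fps_X * Abs_fps Q"
  have S: "fps_deriv S = PP * S"
    by (rule fps_ext) (use s in \<open>simp add: S_def PP_def fps_mult_nth atMost_atLeast0 del: of_nat_Suc\<close>)
  have XQ: "fps_deriv XQ = Abs_fps (\<lambda>i. real (Suc i) * Q i)"
    by (rule fps_ext) (simp add: XQ_def algebra_simps)
  have dS: "fps_deriv dS = PP * dS + fps_deriv XQ * S"
    unfolding XQ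
    by (rule fps_ext) (use ds in \<open>simp add: S_def dS_def PP_def fps_mult_nth atMost_atLeast0 sum.distrib del: of_nat_Suc\<close>)
  define W where "W = dS - XQ * S"
  have W: "fps_deriv W = PP * W"
    by (simp add: W_def S dS algebra_simps)
  have "fps_nth W n = 0" for n
  proof (induction n rule: less_induct)
    case (less n)
    show ?case
    proof (cases n)
      case 0
      then show ?thesis by (simp add: W_def dS_def ds0 XQ_def)
    next
      case (Suc m)
      have "real (Suc m) * fps_nth W (Suc m) = fps_nth (PP * W) m" using W by (metis fps_deriv_nth Suc_eq_plus1)
      also have "\<dots> = 0" unfolding fps_mult_nth using less Suc by (intro sum.neutral) auto
      finally show ?thesis using Suc by simp
    qed
  qed
  then have "fps_nth dS (Suc l) = fps_nth (XQ * S) (Suc l)" by (metis W_def eq_iff_diff_eq_0 fps_sub_nth)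
  also have "\<dots> = fps_nth (Abs_fps Q * S) l" by (simp add: XQ_def mult.assoc)
  finally show ?thesis by (simp add: dS_def S_def fps_mult_nth atMost_atLeast0)
qed

section \<open>First variation of the Newton transformations along a matrix direction\<close>

primrec mpow :: "real^'n^'n \<Rightarrow> nat \<Rightarrow> real^'n^'n" where
  "mpow M 0 = mat 1"
| "mpow M (Suc i) = mpow M i ** M"

text \<open>This and the next two definitions are formal derivatives, by the product rule, of
  \<open>mpow\<close>, \<open>NT\<close> and \<open>sg\<close> at \<open>M\<close> in direction
  \<open>N\<close>.\<close>

primrec dmpow :: "real^'n^'n \<Rightarrow> real^'n^'n \<Rightarrow> nat \<Rightarrow> real^'n^'n" where
  "dmpow M N 0 = 0"
| "dmpow M N (Suc i) = dmpow M N i ** M + mpow M i ** N"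

primrec dNT :: "nat \<Rightarrow> real^'n^'n \<Rightarrow> real^'n^'n \<Rightarrow> real^'n^'n" where
  "dNT 0 M N = 0"
| "dNT (Suc l) M N = (trace (dNT l M N ** M + NT l M ** N) / real (Suc l)) *\<^sub>R mat 1
      - (dNT l M N ** M + NT l M ** N)"

definition dsg :: "nat \<Rightarrow> real^'n^'n \<Rightarrow> real^'n^'n \<Rightarrow> real" where
  "dsg l M N = (case l of 0 \<Rightarrow> 0 | Suc m \<Rightarrow> trace (dNT m M N ** M + NT m M ** N) / real l)"


lemma bilinear_mmult: "bilinear ((**) :: real^'n^'n \<Rightarrow> real^'n^'n \<Rightarrow> real^'n^'n)"
  unfolding bilinear_def
  by (auto intro!: linearI simp: vec_eq_iff matrix_matrix_mult_def algebra_simps sum.distrib sum_distrib_left)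

lemmas bounded_bilinear_mmult = bilinear_mmult[unfolded bilinear_conv_bounded_bilinear]

lemmas mmult_simps = bounded_bilinear.add_left[OF bounded_bilinear_mmult]
  bounded_bilinear.add_right[OF bounded_bilinear_mmult]
  bounded_bilinear.diff_left[OF bounded_bilinear_mmult]
  bounded_bilinear.diff_right[OF bounded_bilinear_mmult]
  bounded_bilinear.scaleR_left[OF bounded_bilinear_mmult]
  bounded_bilinear.scaleR_right[OF bounded_bilinear_mmult]
  bounded_bilinear.sum_left[OF bounded_bilinear_mmult]
  bounded_bilinear.zero_left[OF bounded_bilinear_mmult]

lemma linear_trace: "linear (trace :: real^'n^'n \<Rightarrow> real)"
  by (rule linearI) (simp_all add: trace_def sum.distrib sum_distrib_left)

lemmas bounded_linear_trace = linear_trace[unfolded linear_conv_bounded_linear]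

lemma mpow_add: "mpow M (i + j) = mpow M i ** mpow M j"
  by (induction j) (simp_all add: matrix_mul_assoc)

lemma NT_expand: "NT l M = (\<Sum>i\<le>l. ((-1) ^ i * sg (l - i) M) *\<^sub>R mpow M i)"
proof (induction l)
  case (Suc l)
  have "(\<Sum>i\<le>Suc l. ((-1) ^ i * sg (Suc l - i) M) *\<^sub>R mpow M i)
     = sg (Suc l) M *\<^sub>R mat 1 + (\<Sum>i\<le>l. ((-1) ^ Suc i * sg (l - i) M) *\<^sub>R mpow M (Suc i))"
    by (subst sum.atMost_Suc_shift) simp
  also have "(\<Sum>i\<le>l. ((-1) ^ Suc i * sg (l - i) M) *\<^sub>R mpow M (Suc i)) = - (NT l M ** M)"
    unfolding Suc by (simp add: mmult_simps sum_negf)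
  finally show ?case by (simp only: NT_Suc diff_conv_add_uminus)
qed simp

lemma dNT_Suc: "dNT (Suc l) M N = dsg (Suc l) M N *\<^sub>R mat 1 - (dNT l M N ** M + NT l M ** N)"
  by (simp add: dsg_def)

lemma dNT_expand:
  "dNT l M N = (\<Sum>i\<le>l. (-1) ^ i *\<^sub>R (dsg (l - i) M N *\<^sub>R mpow M i + sg (l - i) M *\<^sub>R dmpow M N i))"
proof (induction l)
  case 0
  then show ?case by (simp add: dsg_def)
next
  case (Suc l)
  have "(\<Sum>i\<le>Suc l. (-1) ^ i *\<^sub>R (dsg (Suc l - i) M N *\<^sub>R mpow M i + sg (Suc l - i) M *\<^sub>R dmpow M N i))
     = dsg (Suc l) M N *\<^sub>R mat 1
     + (\<Sum>i\<le>l. (-1) ^ Suc i *\<^sub>R (dsg (l - i) M N *\<^sub>R mpow M (Suc i) + sg (l - i) M *\<^sub>R dmpow M N (Suc i)))"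
    by (subst sum.atMost_Suc_shift) simp
  also have "(\<Sum>i\<le>l. (-1) ^ Suc i *\<^sub>R (dsg (l - i) M N *\<^sub>R mpow M (Suc i) + sg (l - i) M *\<^sub>R dmpow M N (Suc i)))
     = - (dNT l M N ** M + NT l M ** N)"
    unfolding Suc NT_expand
    by (simp add: mmult_simps sum_negf scaleR_add_right sum.distrib sum_subtractf algebra_simps)
  finally show ?case by (simp only: dNT_Suc diff_conv_add_uminus)
qed

text \<open>By cyclicity of the trace the \<open>i\<close> terms of the product rule coincide. The
  additional power on the right strengthens the induction; the application takes
  \<open>j = 0\<close>.\<close>

lemma trace_dmpow: "trace (dmpow M N i ** mpow M (Suc j)) = real i * trace (mpow M (i + j) ** N)"
proof (induction i arbitrary: j)
  case 0
  then show ?case by (simp add: mmult_simps trace_def)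
next
  case (Suc i)
  have m: "M ** mpow M (Suc j) = mpow M (Suc (Suc j))"
    using mpow_add[of M 1 "Suc j"] by simp
  have "dmpow M N (Suc i) ** mpow M (Suc j) = dmpow M N i ** mpow M (Suc (Suc j)) + mpow M i ** N ** mpow M (Suc j)"
    unfolding m[symmetric] by (simp only: dmpow.simps mmult_simps matrix_mul_assoc)
  moreover have "trace (mpow M i ** N ** mpow M (Suc j)) = trace (mpow M (Suc i + j) ** N)"
  proof -
    have "trace ((mpow M i ** N) ** mpow M (Suc j)) = trace (mpow M (Suc j) ** (mpow M i ** N))"
      by (rule trace_mul_sym)
    also have "mpow M (Suc j) ** (mpow M i ** N) = mpow M (Suc i + j) ** N"
      using mpow_add[of M "Suc j" i] by (simp only: matrix_mul_assoc) (simp add: add_ac)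
    finally show ?thesis .
  qed
  ultimately show ?case
    using Suc[of "Suc j"] by (simp add: linear_add[OF linear_trace] algebra_simps del: mpow.simps)
qed

text \<open>By definition \<open>dsg (Suc l)\<close> still contains \<open>dNT l\<close>. Expanding
  in powers of \<open>M\<close> turns the recursions for \<open>sg\<close> and \<open>dsg\<close>
  into Newton's identities with signed power sums \<open>P\<close> and their variations
  \<open>(i + 1) * Q i\<close>, which \<open>fps_newton_variation\<close> solves. No symmetry of
  \<open>M\<close> or \<open>N\<close> is required.\<close>

lemma dsg_trace: "dsg (Suc l) M N = trace (NT l M ** N)"
proof -
  define P Q where "P = (\<lambda>i. (-1) ^ i * trace (mpow M (Suc i)))" and "Q = (\<lambda>i. (-1) ^ i * trace (mpow M i ** N))"
  have tr: "trace (NT l M ** A) = (\<Sum>i\<le>l. (-1) ^ i * trace (mpow M i ** A) * sg (l - i) M)" for l A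
    unfolding NT_expand by (simp add: mmult_simps linear_sum[OF linear_trace] linear_scale[OF linear_trace] mult_ac)
  have trd: "trace (dNT l M N ** M)
     = (\<Sum>i\<le>l. P i * dsg (l - i) M N + real i * Q i * sg (l - i) M)" for l
  proof -
    have "trace (dmpow M N i ** M) = real i * trace (mpow M i ** N)" for i
      using trace_dmpow[of M N i 0] by simp
    then show ?thesis unfolding dNT_expand P_def Q_def
      by (simp add: mmult_simps linear_sum[OF linear_trace] linear_scale[OF linear_trace] linear_add[OF linear_trace] algebra_simps)
  qed
  have s: "real (Suc l) * sg (Suc l) M = (\<Sum>i\<le>l. P i * sg (l - i) M)" for l
    using tr[of l M] by (simp add: sg_def P_def del: of_nat_Suc)
  have "real (Suc l) * dsg (Suc l) M N
      = (\<Sum>i\<le>l. P i * dsg (l - i) M N + real (Suc i) * Q i * sg (l - i) M)" for l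
  proof -
    have "real (Suc l) * dsg (Suc l) M N = trace (dNT l M N ** M) + trace (NT l M ** N)"
      by (simp add: dsg_def linear_add[OF linear_trace] del: of_nat_Suc)
    then show ?thesis unfolding trd tr
      by (simp add: Q_def sum.distrib[symmetric] algebra_simps)
  qed
  from fps_newton_variation[of "\<lambda>l. sg l M" P "\<lambda>l. dsg l M N" Q l, OF s this]
  show ?thesis by (simp add: dsg_def tr Q_def)
qed

text \<open>Think of \<open>N j\<close> as the j-th partial derivative of \<open>M\<close>. The
  hypothesis says that each row of \<open>M\<close> is a gradient, that is, \<open>M\<close> is a
  Jacobian; \<open>M\<close> itself may fail to be symmetric. In the induction the variation of
  S_(l+1) cancels against the term with \<open>NT l M\<close> by \<open>dsg_trace\<close>.\<close>

lemma NT_divergence_free: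
  fixes N :: "'n \<Rightarrow> real^'n^'n"
  assumes sym: "\<And>i j k. N j $ k $ i = N i $ k $ j"
  shows "(\<Sum>j\<in>UNIV. dNT l M (N j) $ j $ i) = 0"
proof (induction l arbitrary: i)
  case 0
  then show ?case by simp
next
  case (Suc l)
  have "dNT (Suc l) M (N j) $ j $ i = (if j = i then trace (NT l M ** N i) else 0)
      - (\<Sum>k\<in>UNIV. dNT l M (N j) $ j $ k * M $ k $ i) - (\<Sum>k\<in>UNIV. NT l M $ j $ k * N i $ k $ j)" for j
    unfolding dNT_Suc dsg_trace using sym[of j _ i]
    by (auto simp: mat_def matrix_matrix_mult_def)
  then have "(\<Sum>j\<in>UNIV. dNT (Suc l) M (N j) $ j $ i) = trace (NT l M ** N i)
      - (\<Sum>j\<in>UNIV. \<Sum>k\<in>UNIV. dNT l M (N j) $ j $ k * M $ k $ i)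
      - (\<Sum>j\<in>UNIV. \<Sum>k\<in>UNIV. NT l M $ j $ k * N i $ k $ j)"
    by (simp add: sum_subtractf)
  also have "(\<Sum>j\<in>UNIV. \<Sum>k\<in>UNIV. dNT l M (N j) $ j $ k * M $ k $ i) = 0"
    by (subst sum.swap) (simp add: Suc flip: sum_distrib_right)
  also have "(\<Sum>j\<in>UNIV. \<Sum>k\<in>UNIV. NT l M $ j $ k * N i $ k $ j) = trace (NT l M ** N i)"
    by (simp add: trace_def matrix_matrix_mult_def)
  finally show ?case by simp
qed

lemma has_vector_derivative_NT:
  assumes "(M has_vector_derivative N) (at t)"
  shows "((\<lambda>t. NT l (M t)) has_vector_derivative dNT l (M t) N) (at t)"
proof (induction l)
  case 0
  then show ?case by simp
next
  case (Suc l)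
  have p: "((\<lambda>t. NT l (M t) ** M t) has_vector_derivative dNT l (M t) N ** M t + NT l (M t) ** N) (at t)"
    using bounded_bilinear.has_vector_derivative[OF bounded_bilinear_mmult Suc assms] by (simp add: add.commute)
  have tr: "((\<lambda>t. trace (NT l (M t) ** M t)) has_vector_derivative trace (dNT l (M t) N ** M t + NT l (M t) ** N)) (at t)"
    by (rule bounded_linear.has_vector_derivative[OF bounded_linear_trace p])
  have lin: "bounded_linear (\<lambda>r. (r / real (Suc l)) *\<^sub>R (mat 1 :: real^'a^'a))"
    by (rule bounded_linear_scaleR_left[THEN bounded_linear_compose, OF bounded_linear_divide])
  show ?case unfolding NT.simps dNT.simps
    by (rule has_vector_derivative_diff[OF bounded_linear.has_vector_derivative[OF lin tr] p])
qed

lemma continuous_on_NT: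
  assumes "continuous_on S M"
  shows "continuous_on S (\<lambda>x. NT l (M x))"
proof (induction l)
  case (Suc l)
  have "continuous_on S (\<lambda>x. NT l (M x) ** M x)"
    by (rule bounded_bilinear.continuous_on[OF bounded_bilinear_mmult Suc assms])
  then show ?case unfolding NT.simps
    by (intro continuous_intros bounded_linear.continuous_on[OF bounded_linear_trace]) auto
qed simp

lemma continuous_on_dNT:
  assumes "continuous_on S M" "continuous_on S N"
  shows "continuous_on S (\<lambda>x. dNT l (M x) (N x))"
proof (induction l)
  case (Suc l)
  have "continuous_on S (\<lambda>x. dNT l (M x) (N x) ** M x + NT l (M x) ** N x)"
    by (intro continuous_intros bounded_bilinear.continuous_on[OF bounded_bilinear_mmult] Suc assms continuous_on_NT)
  note p = this
  show ?case unfolding dNT.simps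
    by (intro continuous_on_diff continuous_on_scaleR continuous_on_divide continuous_on_const
        bounded_linear.continuous_on[OF bounded_linear_trace] p) auto
qed simp

lemma continuous_on_sg:
  assumes "continuous_on S M"
  shows "continuous_on S (\<lambda>x. sg l (M x))"
proof (cases l)
  case (Suc m)
  have "continuous_on S (\<lambda>x. trace (NT m (M x) ** M x))"
    by (intro bounded_linear.continuous_on[OF bounded_linear_trace]
        bounded_bilinear.continuous_on[OF bounded_bilinear_mmult] assms continuous_on_NT)
  then show ?thesis by (simp add: sg_def Suc continuous_on_divide del: of_nat_Suc)
qed simp

section \<open>Continuous functions with compact support\<close>

text \<open>Integrability over the whole space is automatic in this class, so the estimates reduce
  to pointwise inequalities and no measurability arguments are needed.\<close>

definition ccont :: "('a::euclidean_space \<Rightarrow> real) \<Rightarrow> bool" where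
  "ccont g \<longleftrightarrow> continuous_on UNIV g \<and> (\<exists>K. compact K \<and> (\<forall>x. x \<notin> K \<longrightarrow> g x = 0))"

lemma ccont_continuous: "ccont g \<Longrightarrow> continuous_on UNIV g"
  by (simp add: ccont_def)

lemma ccontI: "continuous_on UNIV g \<Longrightarrow> compact K \<Longrightarrow> (\<And>x. x \<notin> K \<Longrightarrow> g x = 0) \<Longrightarrow> ccont g"
  by (auto simp: ccont_def)

lemma ccont_cbox:
  assumes "ccont (g :: 'a::euclidean_space \<Rightarrow> real)"
  obtains a where "\<And>x. x \<notin> cbox (-a) a \<Longrightarrow> g x = 0"
proof -
  from assms obtain K where K: "compact K" "\<And>x. x \<notin> K \<Longrightarrow> g x = 0" by (auto simp: ccont_def)
  then obtain a where "K \<subseteq> cbox (-a) a" using bounded_subset_cbox_symmetric compact_imp_bounded by metis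
  then show ?thesis using K that by blast
qed

lemma ccont_has_integral:
  assumes "continuous_on UNIV (g :: 'a::euclidean_space \<Rightarrow> real)" "\<And>x. x \<notin> cbox a b \<Longrightarrow> g x = 0"
  shows "(g has_integral integral (cbox a b) g) UNIV"
  using assms has_integral_on_superset[of g _ "cbox a b" UNIV]
  by (meson continuous_on_subset integrable_continuous integrable_integral subset_UNIV)

lemma ccont_integral_cbox:
  assumes "continuous_on UNIV (g :: 'a::euclidean_space \<Rightarrow> real)" "\<And>x. x \<notin> cbox a b \<Longrightarrow> g x = 0"
  shows "integral UNIV g = integral (cbox a b) g"
  using ccont_has_integral[OF assms] by (rule integral_unique)

lemma ccont_integrable: "ccont g \<Longrightarrow> g integrable_on UNIV"
  by (metis ccont_cbox ccont_continuous ccont_has_integral has_integral_integrable)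

lemma ccont_integral_le:
  "ccont f \<Longrightarrow> ccont g \<Longrightarrow> (\<And>x. f x \<le> g x) \<Longrightarrow> integral UNIV f \<le> integral UNIV g"
  by (intro integral_le ccont_integrable) auto

lemma ccont_integral_nonneg: "ccont f \<Longrightarrow> (\<And>x. 0 \<le> f x) \<Longrightarrow> 0 \<le> integral UNIV f"
  by (intro integral_nonneg ccont_integrable) auto

lemma ccont_add: "ccont f \<Longrightarrow> ccont g \<Longrightarrow> ccont (\<lambda>x. f x + g x)"
proof -
  assume "ccont f" "ccont g"
  then obtain K L where "compact K" "compact L" "\<And>x. x \<notin> K \<Longrightarrow> f x = 0" "\<And>x. x \<notin> L \<Longrightarrow> g x = 0"
    "continuous_on UNIV f" "continuous_on UNIV g" by (auto simp: ccont_def)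
  then show ?thesis by (intro ccontI[of _ "K \<union> L"] continuous_intros) auto
qed

lemma ccont_mult: "ccont f \<Longrightarrow> continuous_on UNIV g \<Longrightarrow> ccont (\<lambda>x. f x * g x)"
  unfolding ccont_def by (auto intro!: continuous_intros)

lemma ccont_cmult: "ccont f \<Longrightarrow> ccont (\<lambda>x. c * f x)"
  unfolding ccont_def by (auto intro!: continuous_intros)

lemma ccont_minus: "ccont f \<Longrightarrow> ccont (\<lambda>x. - f x)"
  unfolding ccont_def by (auto intro!: continuous_intros)

lemma ccont_diff: "ccont f \<Longrightarrow> ccont g \<Longrightarrow> ccont (\<lambda>x. f x - g x)"
  using ccont_add[OF _ ccont_minus] by fastforce

lemma ccont_0: "ccont (\<lambda>x. 0)"
  by (rule ccontI[of _ "{}"]) auto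

lemma ccont_sum: "(\<And>i. i \<in> A \<Longrightarrow> ccont (f i)) \<Longrightarrow> ccont (\<lambda>x. \<Sum>i\<in>A. f i x)"
  by (induction A rule: infinite_finite_induct) (auto intro: ccont_add ccont_0)

lemma ccont_compose_zero:
  "ccont f \<Longrightarrow> continuous_on UNIV h \<Longrightarrow> h 0 = 0 \<Longrightarrow> ccont (\<lambda>x. h (f x))"
  unfolding ccont_def by (auto intro: continuous_on_compose2)

lemma ccont_abs: "ccont f \<Longrightarrow> ccont (\<lambda>x. \<bar>f x\<bar>)"
  by (rule ccont_compose_zero[where h = abs]) (auto intro: continuous_intros)

lemma ccont_bounded:
  assumes "ccont f"
  obtains B where "0 \<le> B" "\<And>x. \<bar>f x\<bar> \<le> B"
proof -
  from assms obtain K where K: "compact K" "\<And>x. x \<notin> K \<Longrightarrow> f x = 0" "continuous_on K f"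
    by (auto simp: ccont_def intro: continuous_on_subset)
  obtain B where "B \<ge> 0" "\<And>x. x \<in> K \<Longrightarrow> norm (f x) \<le> B"
    using continuous_on_compact_bound[OF K(1,3)] by metis
  then show ?thesis using K(2) that[of B] by (metis abs_zero real_norm_def)
qed

lemma ccont_affine:
  fixes g :: "'a::euclidean_space \<Rightarrow> real"
  assumes g: "ccont g" and m: "m \<noteq> 0"
  shows "ccont (\<lambda>x. g (m *\<^sub>R x + c))"
    and "integral UNIV (\<lambda>x. g (m *\<^sub>R x + c)) = integral UNIV g / \<bar>m\<bar> ^ DIM('a)"
proof -
  obtain a where a: "\<And>x. x \<notin> cbox (-a) a \<Longrightarrow> g x = 0" using ccont_cbox[OF g] by blast
  let ?h = "\<lambda>x. (1 / m) *\<^sub>R x + -((1 / m) *\<^sub>R c)"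
  have out: "g (m *\<^sub>R x + c) = 0" if "x \<notin> ?h ` cbox (-a) a" for x
  proof (rule a, rule notI)
    assume "m *\<^sub>R x + c \<in> cbox (-a) a"
    moreover have "?h (m *\<^sub>R x + c) = x" using m by (simp add: scaleR_add_right)
    ultimately show False using that by (metis image_eqI)
  qed
  have "compact (?h ` cbox (-a) a)"
    by (intro compact_continuous_image continuous_intros) auto
  moreover have "continuous_on UNIV (\<lambda>x. g (m *\<^sub>R x + c))"
    by (rule continuous_on_compose2[OF ccont_continuous[OF g]]) (auto intro!: continuous_intros)
  ultimately show "ccont (\<lambda>x. g (m *\<^sub>R x + c))" using out by (intro ccontI) blast+
  have eq: "integral UNIV g = integral (cbox (-a) a) g"
    by (rule ccont_integral_cbox[OF ccont_continuous[OF g] a])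
  have "(g has_integral integral UNIV g) (cbox (-a) a)"
    unfolding eq by (intro integrable_integral integrable_continuous continuous_on_subset[OF ccont_continuous[OF g]]) auto
  from has_integral_affinity[OF this m, of c]
  have "((\<lambda>x. g (m *\<^sub>R x + c)) has_integral (1 / \<bar>m\<bar> ^ DIM('a)) *\<^sub>R integral UNIV g) UNIV"
    by (rule has_integral_on_superset) (use out in auto)
  then show "integral UNIV (\<lambda>x. g (m *\<^sub>R x + c)) = integral UNIV g / \<bar>m\<bar> ^ DIM('a)"
    by (simp add: integral_unique)
qed

lemma ccont_translate:
  fixes g :: "'a::euclidean_space \<Rightarrow> real"
  assumes g: "ccont g"
  shows "ccont (\<lambda>x. g (x + c))" and "integral UNIV (\<lambda>x. g (x + c)) = integral UNIV g"
  using ccont_affine[OF g, of 1 c] by simp_all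

text \<open>The integral of a translate \<open>g (x + t e)\<close> does not depend on t;
  differentiation under the integral sign at t = 0 gives the claim.\<close>

lemma ccont_derivative:
  fixes g :: "'a::euclidean_space \<Rightarrow> real"
  assumes g: "ccont g" and g': "continuous_on UNIV g'"
    and d: "\<And>x. ((\<lambda>t. g (x + t *\<^sub>R e)) has_real_derivative g' x) (at 0)"
  shows "ccont g'" and "integral UNIV g' = 0"
proof -
  have d': "((\<lambda>t. g (x + t *\<^sub>R e)) has_real_derivative g' (x + s *\<^sub>R e)) (at s)" for x s
  proof -
    have "((\<lambda>t. g ((x + s *\<^sub>R e) + (t - s) *\<^sub>R e)) has_real_derivative g' (x + s *\<^sub>R e) * (1 - 0)) (at s)"
      by (rule DERIV_chain2[where g = "\<lambda>t. t - s"]) (use d[of "x + s *\<^sub>R e"] in \<open>auto intro!: derivative_eq_intros\<close>)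
    then show ?thesis by (simp add: algebra_simps)
  qed
  obtain a where a: "\<And>x. x \<notin> cbox (-a) a \<Longrightarrow> g x = 0" using ccont_cbox[OF g] by blast
  have zero: "g' x = 0" if "x \<notin> cbox (-a) a" for x
  proof -
    have "open (- cbox (-a) a)" by auto
    moreover have "continuous_on UNIV (\<lambda>t. x + t *\<^sub>R e)" by (intro continuous_intros)
    ultimately have "open ((\<lambda>t. x + t *\<^sub>R e) -` (- cbox (-a) a))" by (simp add: open_vimage)
    then have "((\<lambda>t. 0) has_real_derivative g' x) (at 0)"
      by (rule has_field_derivative_transform_within_open[OF d]) (use that a in auto)
    from DERIV_unique[OF this DERIV_const] show ?thesis .
  qed
  show "ccont g'" by (rule ccontI[OF g' compact_cbox zero])
  \<comment> \<open>One fixed box has to contain the supports of all translates with |t| <= 1, since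
    the Leibniz rule needs a domain independent of t.\<close>
  have bd: "bounded ((\<lambda>(x, t). x + t *\<^sub>R e) ` (cbox (-a) a \<times> {-1..1}))"
    unfolding case_prod_unfold
    by (intro compact_imp_bounded compact_continuous_image compact_Times continuous_intros
        compact_cbox compact_Icc)
  then obtain b where b: "(\<lambda>(x, t). x + t *\<^sub>R e) ` (cbox (-a) a \<times> {-1..1}) \<subseteq> cbox (-b) b"
    using bounded_subset_cbox_symmetric[OF bd] by auto
  have out: "g (x + t *\<^sub>R e) = 0" if "x \<notin> cbox (-b) b" "t \<in> {-1..1}" for x t
  proof (rule a, rule notI)
    assume "x + t *\<^sub>R e \<in> cbox (-a) a"
    then have "(x + t *\<^sub>R e, -t) \<in> cbox (-a) a \<times> {-1..1}" using that(2) by auto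
    then have "(\<lambda>(x, t). x + t *\<^sub>R e) (x + t *\<^sub>R e, -t) \<in> cbox (-b) b"
      using b unfolding image_subset_iff by blast
    then show False using that by simp
  qed
  have const: "integral (cbox (-b) b) (\<lambda>x. g (x + t *\<^sub>R e)) = integral UNIV g" if "t \<in> {-1..1}" for t
    using ccont_integral_cbox[OF ccont_continuous[OF ccont_translate(1)[OF g, of "t *\<^sub>R e"]] out[OF _ that]]
      ccont_translate(2)[OF g, of "t *\<^sub>R e"] by simp
  have "((\<lambda>t. integral (cbox (-b) b) (\<lambda>x. g (x + t *\<^sub>R e))) has_real_derivative
      integral (cbox (-b) b) (\<lambda>x. g' (x + 0 *\<^sub>R e))) (at 0 within {-1..1})"
  proof (rule leibniz_rule_field_derivative)
    show "((\<lambda>t. g (x + t *\<^sub>R e)) has_real_derivative g' (x + t *\<^sub>R e)) (at t within {-1..1})" for x t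
      using d' by (rule has_field_derivative_at_within)
    show "(\<lambda>x. g (x + t *\<^sub>R e)) integrable_on cbox (-b) b" for t
      by (intro integrable_continuous continuous_on_compose2[OF ccont_continuous[OF g]] continuous_intros) auto
    show "continuous_on ({-1..1} \<times> cbox (-b) b) (\<lambda>(t, x). g' (x + t *\<^sub>R e))"
      unfolding split_beta by (intro continuous_on_compose2[OF g'] continuous_intros) auto
  qed auto
  moreover have "((\<lambda>t. integral (cbox (-b) b) (\<lambda>x. g (x + t *\<^sub>R e))) has_real_derivative 0) (at 0 within {-1..1})"
    by (rule has_field_derivative_transform_within[where f = "\<lambda>t. integral UNIV g" and d = 1]) (use const in auto)
  ultimately have "integral (cbox (-b) b) g' = 0"
    by (simp add: at_within_Icc_at DERIV_unique)
  moreover have "integral UNIV g' = integral (cbox (-b) b) g'"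
  proof (rule ccont_integral_cbox[OF g' zero])
    fix x assume x: "x \<notin> cbox (-b) b"
    show "x \<notin> cbox (-a) a"
    proof
      assume "x \<in> cbox (-a) a"
      then have "(x, 0) \<in> cbox (-a) a \<times> {-1..1::real}" by simp
      then have "(\<lambda>(x, t). x + t *\<^sub>R e) (x, 0) \<in> cbox (-b) b"
        using b unfolding image_subset_iff by blast
      then show False using x by simp
    qed
  qed
  ultimately show "integral UNIV g' = 0" by simp
qed

section \<open>Cutoff functions\<close>

text \<open>A C^1 substitute for the positive part. Cutoffs need one continuous derivative only, so
  smooth bump functions can be avoided.\<close>

definition pos2 :: "real \<Rightarrow> real" where
  "pos2 s = (max 0 s)\<^sup>2"

lemma pos2_derivative: "(pos2 has_real_derivative 2 * max 0 s) (at s)"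
proof -
  have eq: "pos2 = (\<lambda>s. (s\<^sup>2 + s * \<bar>s\<bar>) / 2)"
    by (rule ext) (simp add: pos2_def max_def power2_eq_square)
  have "((\<lambda>s. s * \<bar>s\<bar>) has_real_derivative 2 * \<bar>s\<bar>) (at s)"
  proof (cases "s = 0")
    case True
    have "((\<lambda>h. h * \<bar>h\<bar> / h) \<longlongrightarrow> 0) (at (0::real))"
      by (rule Lim_transform_eventually[of abs])
         (auto intro!: tendsto_eq_intros simp: eventually_at_filter)
    then show ?thesis using True by (simp add: has_field_derivative_iff)
  next
    case False
    show ?thesis
    proof (cases "s > 0")
      case True
      have "((\<lambda>s. s * s) has_real_derivative 2 * \<bar>s\<bar>) (at s)"
        using True by (auto intro!: derivative_eq_intros)
      then show ?thesis
        by (rule has_field_derivative_transform_within_open[where S = "{0<..}"]) (use True in auto)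
    next
      case neg: False
      have "((\<lambda>s. - (s * s)) has_real_derivative 2 * \<bar>s\<bar>) (at s)"
        using False neg by (auto intro!: derivative_eq_intros)
      then show ?thesis
        by (rule has_field_derivative_transform_within_open[where S = "{..<0}"]) (use False neg in auto)
    qed
  qed
  then have "((\<lambda>s. (s\<^sup>2 + s * \<bar>s\<bar>) / 2) has_real_derivative (2 * s + 2 * \<bar>s\<bar>) / 2) (at s)"
    by (intro DERIV_cdivide DERIV_add) (auto intro!: derivative_eq_intros)
  moreover have "(2 * s + 2 * \<bar>s\<bar>) / 2 = 2 * max 0 s" by (simp add: max_def)
  ultimately show ?thesis unfolding eq by simp
qed

text \<open>Neither an upper bound nor a plateau is demanded, so cutoffs are closed under sums,
  nonnegative multiples and squares, and constants can be absorbed into a larger cutoff.\<close>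

definition cutoff :: "'a::euclidean_space set \<Rightarrow> ('a \<Rightarrow> real) \<Rightarrow> ('a \<Rightarrow> 'a) \<Rightarrow> bool" where
  "cutoff \<Omega> \<eta> D\<eta> \<longleftrightarrow> (\<forall>x. (\<eta> has_derivative (\<lambda>h. D\<eta> x \<bullet> h)) (at x)) \<and> continuous_on UNIV D\<eta>
     \<and> (\<forall>x. 0 \<le> \<eta> x) \<and> (\<exists>K. compact K \<and> K \<subseteq> \<Omega> \<and> (\<forall>x. x \<notin> K \<longrightarrow> \<eta> x = 0 \<and> D\<eta> x = 0))"

lemma cutoff_continuous: "cutoff \<Omega> \<eta> D\<eta> \<Longrightarrow> continuous_on S \<eta>"
  unfolding cutoff_def by (meson continuous_at_imp_continuous_on has_derivative_continuous)

lemma cutoff_bump: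
  fixes c :: "'a::euclidean_space"
  assumes "cball c r \<subseteq> \<Omega>" "0 \<le> r"
  shows "cutoff \<Omega> (\<lambda>y. pos2 (r\<^sup>2 - (y - c) \<bullet> (y - c)))
     (\<lambda>y. (- 4 * max 0 (r\<^sup>2 - (y - c) \<bullet> (y - c))) *\<^sub>R (y - c))"
  unfolding cutoff_def
proof (intro conjI allI exI[of _ "cball c r"] impI)
  fix x
  have "((\<lambda>y. r\<^sup>2 - (y - c) \<bullet> (y - c)) has_derivative (\<lambda>h. - 2 * ((x - c) \<bullet> h))) (at x)"
    by (auto intro!: derivative_eq_intros simp: inner_commute)
  then have "((\<lambda>y. pos2 (r\<^sup>2 - (y - c) \<bullet> (y - c))) has_derivative
     (\<lambda>h. - 2 * ((x - c) \<bullet> h) * (2 * max 0 (r\<^sup>2 - (x - c) \<bullet> (x - c))))) (at x)"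
    by (rule DERIV_compose_FDERIV[OF pos2_derivative])
  then show "((\<lambda>y. pos2 (r\<^sup>2 - (y - c) \<bullet> (y - c))) has_derivative
     (\<lambda>h. ((- 4 * max 0 (r\<^sup>2 - (x - c) \<bullet> (x - c))) *\<^sub>R (x - c)) \<bullet> h)) (at x)"
    by (simp add: mult_ac)
  have z: "max 0 (r\<^sup>2 - (x - c) \<bullet> (x - c)) = 0" if "x \<notin> cball c r"
  proof -
    have "r \<le> norm (x - c)" using that by (simp add: dist_norm norm_minus_commute)
    then have "r\<^sup>2 \<le> (norm (x - c))\<^sup>2" using \<open>0 \<le> r\<close> by (intro power_mono) auto
    then show ?thesis by (simp add: power2_norm_eq_inner)
  qed
  show "pos2 (r\<^sup>2 - (x - c) \<bullet> (x - c)) = 0" if "x \<notin> cball c r"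
    using z[OF that] by (simp add: pos2_def)
  show "(- 4 * max 0 (r\<^sup>2 - (x - c) \<bullet> (x - c))) *\<^sub>R (x - c) = 0" if "x \<notin> cball c r"
    using z[OF that] by simp
  show "0 \<le> pos2 (r\<^sup>2 - (x - c) \<bullet> (x - c))" by (simp add: pos2_def)
qed (use assms in \<open>auto intro!: continuous_intros\<close>)

lemma cutoff_add:
  assumes "cutoff \<Omega> f Df" "cutoff \<Omega> g Dg"
  shows "cutoff \<Omega> (\<lambda>x. f x + g x) (\<lambda>x. Df x + Dg x)"
proof -
  obtain K L where "compact K" "K \<subseteq> \<Omega>" "\<And>x. x \<notin> K \<Longrightarrow> f x = 0 \<and> Df x = 0"
    "compact L" "L \<subseteq> \<Omega>" "\<And>x. x \<notin> L \<Longrightarrow> g x = 0 \<and> Dg x = 0"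
    using assms unfolding cutoff_def by metis
  then have "\<exists>K. compact K \<and> K \<subseteq> \<Omega> \<and> (\<forall>x. x \<notin> K \<longrightarrow> f x + g x = 0 \<and> Df x + Dg x = 0)"
    by (intro exI[of _ "K \<union> L"]) (auto simp: compact_Un)
  then show ?thesis using assms unfolding cutoff_def
    by (auto intro!: derivative_eq_intros continuous_intros simp: inner_add_left)
qed

lemma cutoff_cmult:
  assumes "cutoff \<Omega> f Df" "0 \<le> c"
  shows "cutoff \<Omega> (\<lambda>x. c * f x) (\<lambda>x. c *\<^sub>R Df x)"
proof -
  obtain K where "compact K" "K \<subseteq> \<Omega>" "\<And>x. x \<notin> K \<Longrightarrow> f x = 0 \<and> Df x = 0"
    using assms unfolding cutoff_def by metis
  then have "\<exists>K. compact K \<and> K \<subseteq> \<Omega> \<and> (\<forall>x. x \<notin> K \<longrightarrow> c * f x = 0 \<and> c *\<^sub>R Df x = 0)"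
    by (intro exI[of _ K]) auto
  then show ?thesis using assms unfolding cutoff_def
    by (auto intro!: derivative_eq_intros continuous_intros)
qed

lemma cutoff_0: "cutoff \<Omega> (\<lambda>x. 0) (\<lambda>x. 0)"
  unfolding cutoff_def by (auto intro!: derivative_eq_intros exI[of _ "{}"])

lemma cutoff_square:
  assumes "cutoff \<Omega> f Df"
  shows "cutoff \<Omega> (\<lambda>x. (f x)\<^sup>2) (\<lambda>x. (2 * f x) *\<^sub>R Df x)"
proof -
  obtain K where "compact K" "K \<subseteq> \<Omega>" "\<And>x. x \<notin> K \<Longrightarrow> f x = 0 \<and> Df x = 0"
    using assms unfolding cutoff_def by metis
  then have "\<exists>K. compact K \<and> K \<subseteq> \<Omega> \<and> (\<forall>x. x \<notin> K \<longrightarrow> (f x)\<^sup>2 = 0 \<and> (2 * f x) *\<^sub>R Df x = 0)"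
    by (intro exI[of _ K]) auto
  then show ?thesis using assms cutoff_continuous[OF assms, of UNIV] unfolding cutoff_def
    by (auto intro!: derivative_eq_intros continuous_intros simp: power2_eq_square)
qed

text \<open>Finitely many bumps whose open balls cover \<open>K\<close> have a sum with positive
  minimum on \<open>K\<close>; scaling lifts it above any prescribed \<open>M\<close>.\<close>

lemma cutoff_exists:
  fixes K :: "'a::euclidean_space set"
  assumes "open \<Omega>" "compact K" "K \<subseteq> \<Omega>"
  obtains \<eta> D\<eta> where "cutoff \<Omega> \<eta> D\<eta>" "\<And>x. x \<in> K \<Longrightarrow> M \<le> \<eta> x"
proof -
  have "\<exists>r>0. cball x r \<subseteq> \<Omega>" if "x \<in> K" for x
    using assms(1,3) that unfolding open_contains_cball by blast
  then have "\<exists>r. \<forall>x\<in>K. r x > 0 \<and> cball x (r x) \<subseteq> \<Omega>" by (intro bchoice) auto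
  then obtain r where r: "\<And>x. x \<in> K \<Longrightarrow> r x > 0" "\<And>x. x \<in> K \<Longrightarrow> cball x (r x) \<subseteq> \<Omega>" by blast
  obtain F where F: "finite F" "F \<subseteq> K" "K \<subseteq> (\<Union>x\<in>F. ball x (r x))"
  proof (rule compactE_image[OF assms(2), of K "\<lambda>x. ball x (r x)"])
    show "K \<subseteq> (\<Union>x\<in>K. ball x (r x))" using r(1) by force
  qed auto
  define b where "b = (\<lambda>c y. pos2 ((r c)\<^sup>2 - (y - c) \<bullet> (y - c)))"
  define Db where "Db = (\<lambda>c y. (- 4 * max 0 ((r c)\<^sup>2 - (y - c) \<bullet> (y - c))) *\<^sub>R (y - c))"
  have b: "cutoff \<Omega> (b c) (Db c)" if "c \<in> K" for c
    unfolding b_def Db_def using r[OF that] by (intro cutoff_bump) auto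
  have sum: "cutoff \<Omega> (\<lambda>y. \<Sum>c\<in>F. b c y) (\<lambda>y. \<Sum>c\<in>F. Db c y)"
    using F(1,2)
  proof (induction F rule: finite_induct)
    case empty
    then show ?case by (simp add: cutoff_0)
  next
    case (insert c F)
    then show ?case using cutoff_add[OF b[of c]] by simp
  qed
  have bpos: "0 \<le> b c y" for c y by (simp add: b_def pos2_def)
  have pos: "0 < (\<Sum>c\<in>F. b c y)" if y: "y \<in> K" for y
  proof -
    obtain c where c: "c \<in> F" "y \<in> ball c (r c)" using F y by blast
    then have "(norm (y - c))\<^sup>2 < (r c)\<^sup>2"
      by (intro power_strict_mono) (auto simp: dist_norm norm_minus_commute)
    then have "0 < b c y" by (simp add: b_def pos2_def power2_norm_eq_inner)
    then show ?thesis using F(1) c(1) bpos by (intro sum_pos2) auto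
  qed
  show ?thesis
  proof (cases "K = {}")
    case True
    then show ?thesis using that[OF cutoff_0] by blast
  next
    case False
    then obtain y0 where y0: "y0 \<in> K" "\<And>y. y \<in> K \<Longrightarrow> (\<Sum>c\<in>F. b c y0) \<le> (\<Sum>c\<in>F. b c y)"
      using continuous_attains_inf[OF assms(2) _ cutoff_continuous[OF sum]] by blast
    define m where "m = (\<Sum>c\<in>F. b c y0)"
    have m: "m > 0" using pos y0(1) by (simp add: m_def)
    have "M \<le> max 0 M / m * (\<Sum>c\<in>F. b c y)" if "y \<in> K" for y
    proof -
      have "max 0 M / m * m \<le> max 0 M / m * (\<Sum>c\<in>F. b c y)"
        using m y0(2)[OF that] by (intro mult_left_mono) (auto simp: m_def)
      then show ?thesis using m by simp
    qed
    then show ?thesis using that[OF cutoff_cmult[OF sum, of "max 0 M / m"]] m by simp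
  qed
qed

text \<open>With \<eta> >= 2 on \<open>K\<close>, the function 1 - (1 - \<eta>)_+^2 equals 1 on the
  open set where \<eta> > 1. Such a plateau is what allows a function given on \<Omega> to be
  extended globally without changing it near \<open>K\<close>.\<close>

lemma cutoff_plateau:
  fixes K :: "'a::euclidean_space set"
  assumes "open \<Omega>" "compact K" "K \<subseteq> \<Omega>"
  obtains \<theta> D\<theta> U where "cutoff \<Omega> \<theta> D\<theta>" "open U" "K \<subseteq> U" "\<And>x. x \<in> U \<Longrightarrow> \<theta> x = 1 \<and> D\<theta> x = 0"
proof -
  obtain \<eta> D\<eta> where \<eta>: "cutoff \<Omega> \<eta> D\<eta>" "\<And>x. x \<in> K \<Longrightarrow> 2 \<le> \<eta> x"
    using cutoff_exists[OF assms] by metis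
  define \<theta> where "\<theta> = (\<lambda>x. 1 - pos2 (1 - \<eta> x))"
  define D\<theta> where "D\<theta> = (\<lambda>x. (2 * max 0 (1 - \<eta> x)) *\<^sub>R D\<eta> x)"
  have der: "(\<theta> has_derivative (\<lambda>h. D\<theta> x \<bullet> h)) (at x)" for x
  proof -
    have "((\<lambda>x. 1 - \<eta> x) has_derivative (\<lambda>h. - (D\<eta> x \<bullet> h))) (at x)"
      using \<eta>(1) unfolding cutoff_def by (auto intro!: derivative_eq_intros)
    from DERIV_compose_FDERIV[OF pos2_derivative this]
    show ?thesis unfolding \<theta>_def D\<theta>_def
      by (auto intro!: derivative_eq_intros simp: mult_ac)
  qed
  have "cutoff \<Omega> \<theta> D\<theta>"
    unfolding cutoff_def
  proof (intro conjI allI der)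
    show "continuous_on UNIV D\<theta>" unfolding D\<theta>_def
      using \<eta>(1) cutoff_continuous[OF \<eta>(1), of UNIV] by (auto simp: cutoff_def intro!: continuous_intros)
    show "0 \<le> \<theta> x" for x
    proof -
      have "0 \<le> \<eta> x" using \<eta>(1) by (simp add: cutoff_def)
      then have "(max 0 (1 - \<eta> x))\<^sup>2 \<le> 1\<^sup>2" by (intro power_mono) auto
      then show ?thesis by (simp add: \<theta>_def pos2_def)
    qed
    obtain K' where K': "compact K'" "K' \<subseteq> \<Omega>" "\<And>x. x \<notin> K' \<Longrightarrow> \<eta> x = 0 \<and> D\<eta> x = 0"
      using \<eta>(1) unfolding cutoff_def by metis
    show "\<exists>K. compact K \<and> K \<subseteq> \<Omega> \<and> (\<forall>x. x \<notin> K \<longrightarrow> \<theta> x = 0 \<and> D\<theta> x = 0)"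
      using K' by (intro exI[of _ K']) (auto simp: \<theta>_def D\<theta>_def pos2_def)
  qed
  moreover have "open (\<eta> -` {1<..})"
    by (intro open_vimage cutoff_continuous[OF \<eta>(1)]) auto
  moreover have "K \<subseteq> \<eta> -` {1<..}" using \<eta>(2) by force
  moreover have "\<theta> x = 1 \<and> D\<theta> x = 0" if "x \<in> \<eta> -` {1<..}" for x
    using that by (auto simp: \<theta>_def D\<theta>_def pos2_def)
  ultimately show ?thesis using that by blast
qed

lemma continuous_on_UNIV_supported:
  fixes f :: "'a::euclidean_space \<Rightarrow> 'b::real_normed_vector"
  assumes "open \<Omega>" "continuous_on \<Omega> f" "compact K" "K \<subseteq> \<Omega>" "\<And>x. x \<notin> K \<Longrightarrow> f x = 0"
  shows "continuous_on UNIV f"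
proof -
  have "continuous_on (- K) f"
    using assms(5) by (subst continuous_on_cong[OF refl, where g = "\<lambda>x. 0"]) auto
  moreover have "open (- K)" using assms(3) by (simp add: compact_imp_closed open_Compl)
  ultimately have "continuous_on (\<Omega> \<union> - K) f"
    using assms(1,2) by (intro continuous_on_open_Un)
  moreover have "\<Omega> \<union> - K = UNIV" using assms(4) by blast
  ultimately show ?thesis by simp
qed

lemma ccont_cutoff:
  assumes "open \<Omega>" "cutoff \<Omega> \<eta> D\<eta>" "continuous_on \<Omega> f"
  shows "ccont (\<lambda>x. \<eta> x * f x)"
proof -
  obtain K where K: "compact K" "K \<subseteq> \<Omega>" "\<And>x. x \<notin> K \<Longrightarrow> \<eta> x = 0 \<and> D\<eta> x = 0"
    using assms unfolding cutoff_def by metis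
  have "continuous_on \<Omega> (\<lambda>x. \<eta> x * f x)"
    by (intro continuous_intros assms(3) cutoff_continuous[OF assms(2)])
  then have "continuous_on UNIV (\<lambda>x. \<eta> x * f x)"
    by (rule continuous_on_UNIV_supported[OF assms(1) _ K(1,2)]) (use K(3) in simp)
  then show ?thesis by (rule ccontI[OF _ K(1)]) (use K(3) in simp)
qed

text \<open>Terms in which a derivative falls on the cutoff are hereby bounded by an integral
  against another cutoff, which is again covered by \<open>locbd\<close>.\<close>

lemma cutoff_dominate:
  assumes "open \<Omega>" "cutoff \<Omega> \<eta> D\<eta>"
  obtains \<zeta> D\<zeta> where "cutoff \<Omega> \<zeta> D\<zeta>"
    "\<And>x. \<eta> x \<le> \<zeta> x" "\<And>x. norm (D\<eta> x) \<le> \<zeta> x" "\<And>x. (norm (D\<eta> x))\<^sup>2 \<le> \<zeta> x"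
proof -
  obtain K where K: "compact K" "K \<subseteq> \<Omega>" "\<And>x. x \<notin> K \<Longrightarrow> \<eta> x = 0 \<and> D\<eta> x = 0"
    using assms unfolding cutoff_def by metis
  have "continuous_on K D\<eta>" using assms(2) continuous_on_subset unfolding cutoff_def by blast
  then have cont: "continuous_on K (\<lambda>x. \<eta> x + norm (D\<eta> x) + (norm (D\<eta> x))\<^sup>2)"
    by (intro continuous_intros cutoff_continuous[OF assms(2)])
  obtain B where B: "B \<ge> 0" "\<And>x. x \<in> K \<Longrightarrow> norm (\<eta> x + norm (D\<eta> x) + (norm (D\<eta> x))\<^sup>2) \<le> B"
    using continuous_on_compact_bound[OF K(1) cont] by blast
  obtain \<zeta> D\<zeta> where \<zeta>: "cutoff \<Omega> \<zeta> D\<zeta>" "\<And>x. x \<in> K \<Longrightarrow> B \<le> \<zeta> x"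
    using cutoff_exists[OF assms(1) K(1,2)] by metis
  have *: "\<eta> x + norm (D\<eta> x) + (norm (D\<eta> x))\<^sup>2 \<le> \<zeta> x" for x
  proof (cases "x \<in> K")
    case True
    then show ?thesis using B(2)[OF True] \<zeta>(2)[OF True] by (simp add: abs_le_iff)
  next
    case False
    then show ?thesis using K(3)[OF False] \<zeta>(1) by (simp add: cutoff_def)
  qed
  have p: "0 \<le> \<eta> x" "0 \<le> norm (D\<eta> x)" "0 \<le> (norm (D\<eta> x))\<^sup>2" for x
    using assms(2) by (auto simp: cutoff_def)
  show ?thesis
  proof (rule that[OF \<zeta>(1)])
    fix x
    show "\<eta> x \<le> \<zeta> x" "norm (D\<eta> x) \<le> \<zeta> x" "(norm (D\<eta> x))\<^sup>2 \<le> \<zeta> x"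
      using *[of x] p[of x] by linarith+
  qed
qed

section \<open>Symmetry of second derivatives\<close>

text \<open>The mean value theorem twice: in direction \<open>u\<close> for the difference of two
  parallel lines, then in direction \<open>v\<close> for the derivative obtained.\<close>

lemma second_difference_mean_value:
  fixes f :: "'a::euclidean_space \<Rightarrow> real"
  assumes t: "0 < t"
    and S: "\<And>\<sigma> \<tau>. 0 \<le> \<sigma> \<Longrightarrow> \<sigma> \<le> t \<Longrightarrow> 0 \<le> \<tau> \<Longrightarrow> \<tau> \<le> t \<Longrightarrow> x + \<sigma> *\<^sub>R u + \<tau> *\<^sub>R v \<in> S"
    and f: "\<And>y. y \<in> S \<Longrightarrow> (f has_derivative (\<lambda>h. G y \<bullet> h)) (at y)"
    and G: "\<And>y. y \<in> S \<Longrightarrow> (G has_derivative H y) (at y)"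
  shows "\<exists>\<sigma> \<tau>. 0 \<le> \<sigma> \<and> \<sigma> \<le> t \<and> 0 \<le> \<tau> \<and> \<tau> \<le> t \<and>
    f (x + t *\<^sub>R u + t *\<^sub>R v) - f (x + t *\<^sub>R u) - (f (x + t *\<^sub>R v) - f x)
      = t * (t * (H (x + \<sigma> *\<^sub>R u + \<tau> *\<^sub>R v) v \<bullet> u))"
proof -
  define \<phi> where "\<phi> = (\<lambda>s. f (x + s *\<^sub>R u + t *\<^sub>R v) - f (x + s *\<^sub>R u + 0 *\<^sub>R v))"
  have line: "((\<lambda>s. f (x + s *\<^sub>R u + \<tau> *\<^sub>R v)) has_real_derivative G (x + s *\<^sub>R u + \<tau> *\<^sub>R v) \<bullet> u) (at s)"
    if "0 \<le> s" "s \<le> t" "0 \<le> \<tau>" "\<tau> \<le> t" for s \<tau>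
  proof -
    have "((\<lambda>s. x + s *\<^sub>R u + \<tau> *\<^sub>R v) has_derivative (\<lambda>h. h *\<^sub>R u)) (at s)"
      by (auto intro!: derivative_eq_intros)
    from has_derivative_compose[OF this f[OF S[OF that]]]
    show ?thesis by (simp add: has_field_derivative_def mult_commute_abs)
  qed
  have "\<exists>\<sigma>>0. \<sigma> < t \<and> \<phi> t - \<phi> 0
     = (t - 0) * (G (x + \<sigma> *\<^sub>R u + t *\<^sub>R v) \<bullet> u - G (x + \<sigma> *\<^sub>R u + 0 *\<^sub>R v) \<bullet> u)"
    unfolding \<phi>_def using t by (intro MVT2 DERIV_diff line) auto
  then obtain \<sigma> where \<sigma>: "0 < \<sigma>" "\<sigma> < t" and eq1: "\<phi> t - \<phi> 0
     = t * (G (x + \<sigma> *\<^sub>R u + t *\<^sub>R v) \<bullet> u - G (x + \<sigma> *\<^sub>R u + 0 *\<^sub>R v) \<bullet> u)" by auto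
  have line2: "((\<lambda>r. G (x + \<sigma> *\<^sub>R u + r *\<^sub>R v) \<bullet> u) has_real_derivative H (x + \<sigma> *\<^sub>R u + r *\<^sub>R v) v \<bullet> u) (at r)"
    if "0 \<le> r" "r \<le> t" for r
  proof -
    have "x + \<sigma> *\<^sub>R u + r *\<^sub>R v \<in> S" using \<sigma> that by (intro S) auto
    note G' = G[OF this]
    have "((\<lambda>r. x + \<sigma> *\<^sub>R u + r *\<^sub>R v) has_derivative (\<lambda>h. h *\<^sub>R v)) (at r)"
      by (auto intro!: derivative_eq_intros)
    from has_derivative_inner_left[OF has_derivative_compose[OF this G'], of u]
    have "((\<lambda>r. G (x + \<sigma> *\<^sub>R u + r *\<^sub>R v) \<bullet> u) has_derivative (\<lambda>h. H (x + \<sigma> *\<^sub>R u + r *\<^sub>R v) (h *\<^sub>R v) \<bullet> u)) (at r)" .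
    moreover have "H (x + \<sigma> *\<^sub>R u + r *\<^sub>R v) (h *\<^sub>R v) = h *\<^sub>R H (x + \<sigma> *\<^sub>R u + r *\<^sub>R v) v" for h
      using has_derivative_linear[OF G'] by (rule linear_scale)
    ultimately show ?thesis by (simp add: has_field_derivative_def mult_commute_abs)
  qed
  have "\<exists>\<tau>>0. \<tau> < t \<and> G (x + \<sigma> *\<^sub>R u + t *\<^sub>R v) \<bullet> u - G (x + \<sigma> *\<^sub>R u + 0 *\<^sub>R v) \<bullet> u
     = (t - 0) * (H (x + \<sigma> *\<^sub>R u + \<tau> *\<^sub>R v) v \<bullet> u)"
    using t by (intro MVT2 line2) auto
  then obtain \<tau> where \<tau>: "0 < \<tau>" "\<tau> < t" and eq2: "G (x + \<sigma> *\<^sub>R u + t *\<^sub>R v) \<bullet> u - G (x + \<sigma> *\<^sub>R u + 0 *\<^sub>R v) \<bullet> u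
     = t * (H (x + \<sigma> *\<^sub>R u + \<tau> *\<^sub>R v) v \<bullet> u)" by auto
  show ?thesis
    using eq1 \<sigma> \<tau> unfolding eq2 \<phi>_def by (intro exI[of _ \<sigma>] exI[of _ \<tau>]) (simp add: algebra_simps)
qed

text \<open>The second difference over a small parallelogram is symmetric in \<open>u\<close> and
  \<open>v\<close>; evaluated in both orders it is t^2 times a second derivative at a nearby point,
  and continuity identifies the limits.\<close>

theorem second_derivative_symmetric:
  fixes f :: "'a::euclidean_space \<Rightarrow> real"
  assumes S: "open S" "x \<in> S"
    and f: "\<And>y. y \<in> S \<Longrightarrow> (f has_derivative (\<lambda>h. G y \<bullet> h)) (at y)"
    and G: "\<And>y. y \<in> S \<Longrightarrow> (G has_derivative H y) (at y)"
    and H: "\<And>w. continuous_on S (\<lambda>y. H y w)"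
  shows "H x v \<bullet> u = H x u \<bullet> v"
proof (rule ccontr)
  assume ne: "H x v \<bullet> u \<noteq> H x u \<bullet> v"
  define e where "e = \<bar>H x v \<bullet> u - H x u \<bullet> v\<bar> / 2"
  have e: "e > 0" using ne by (simp add: e_def)
  have near: "\<exists>d>0. \<forall>y. dist y x < d \<longrightarrow> y \<in> S \<and> \<bar>H y a \<bullet> b - H x a \<bullet> b\<bar> < e" for a b
  proof -
    have "continuous_on S (\<lambda>y. H y a \<bullet> b)" by (intro continuous_intros H)
    then obtain d1 where d1: "d1 > 0" "\<And>y. y \<in> S \<Longrightarrow> dist y x < d1 \<Longrightarrow> dist (H y a \<bullet> b) (H x a \<bullet> b) < e"
      using S(2) e unfolding continuous_on_iff by blast
    obtain d2 where d2: "d2 > 0" "\<And>y. dist y x < d2 \<Longrightarrow> y \<in> S"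
      using S unfolding open_dist by blast
    show ?thesis using d1 d2 by (intro exI[of _ "min d1 d2"]) (auto simp: dist_real_def)
  qed
  obtain d1 where d1: "d1 > 0" "\<And>y. dist y x < d1 \<Longrightarrow> y \<in> S \<and> \<bar>H y v \<bullet> u - H x v \<bullet> u\<bar> < e"
    using near[of v u] by blast
  obtain d2 where d2: "d2 > 0" "\<And>y. dist y x < d2 \<Longrightarrow> y \<in> S \<and> \<bar>H y u \<bullet> v - H x u \<bullet> v\<bar> < e"
    using near[of u v] by blast
  define t where "t = min d1 d2 / (2 * (norm u + norm v + 1))"
  have nuv: "norm u + norm v + 1 > 0" by (simp add: add_nonneg_pos)
  have t: "t > 0" using d1(1) d2(1) nuv by (simp add: t_def)
  have small: "dist (x + \<sigma> *\<^sub>R a + \<tau> *\<^sub>R b) x < min d1 d2"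
    if "0 \<le> \<sigma>" "\<sigma> \<le> t" "0 \<le> \<tau>" "\<tau> \<le> t" "norm a + norm b = norm u + norm v" for \<sigma> \<tau> a b
  proof -
    have "dist (x + \<sigma> *\<^sub>R a + \<tau> *\<^sub>R b) x = norm (\<sigma> *\<^sub>R a + \<tau> *\<^sub>R b)" by (simp add: dist_norm add.assoc)
    also have "\<dots> \<le> \<sigma> * norm a + \<tau> * norm b"
      by (rule norm_triangle_le) (use that in simp)
    also have "\<dots> \<le> t * norm a + t * norm b"
      using that by (intro add_mono mult_right_mono) auto
    also have "\<dots> = t * (norm u + norm v)" using that(5) by (simp flip: distrib_left)
    also have "\<dots> < t * (2 * (norm u + norm v + 1))"
    proof (rule mult_strict_left_mono[OF _ t])
      have "0 < norm v + (norm u + 2)" by (intro add_nonneg_pos norm_ge_zero) auto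
      then show "norm u + norm v < 2 * (norm u + norm v + 1)" by simp
    qed
    also have "\<dots> = min d1 d2" using nuv by (simp add: t_def)
    finally show ?thesis .
  qed
  have inS: "x + \<sigma> *\<^sub>R a + \<tau> *\<^sub>R b \<in> S"
    if "0 \<le> \<sigma>" "\<sigma> \<le> t" "0 \<le> \<tau>" "\<tau> \<le> t" "norm a + norm b = norm u + norm v" for \<sigma> \<tau> a b
    using small[OF that] d1(2) by simp
  have norms: "norm v + norm u = norm u + norm v" by simp
  have "\<exists>\<sigma> \<tau>. 0 \<le> \<sigma> \<and> \<sigma> \<le> t \<and> 0 \<le> \<tau> \<and> \<tau> \<le> t \<and>
    f (x + t *\<^sub>R u + t *\<^sub>R v) - f (x + t *\<^sub>R u) - (f (x + t *\<^sub>R v) - f x)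
      = t * (t * (H (x + \<sigma> *\<^sub>R u + \<tau> *\<^sub>R v) v \<bullet> u))"
  proof (rule second_difference_mean_value[where S = S and G = G and H = H, OF t])
    show "x + \<sigma> *\<^sub>R u + \<tau> *\<^sub>R v \<in> S" if "0 \<le> \<sigma>" "\<sigma> \<le> t" "0 \<le> \<tau>" "\<tau> \<le> t" for \<sigma> \<tau>
      by (rule inS[OF that refl])
  qed (rule f G; assumption)+
  then obtain \<sigma> \<tau> where 1: "0 \<le> \<sigma>" "\<sigma> \<le> t" "0 \<le> \<tau>" "\<tau> \<le> t" and
    eq1: "f (x + t *\<^sub>R u + t *\<^sub>R v) - f (x + t *\<^sub>R u) - (f (x + t *\<^sub>R v) - f x)
      = t * (t * (H (x + \<sigma> *\<^sub>R u + \<tau> *\<^sub>R v) v \<bullet> u))"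
    by (elim exE conjE) rule
  have "\<exists>\<sigma>' \<tau>'. 0 \<le> \<sigma>' \<and> \<sigma>' \<le> t \<and> 0 \<le> \<tau>' \<and> \<tau>' \<le> t \<and>
    f (x + t *\<^sub>R v + t *\<^sub>R u) - f (x + t *\<^sub>R v) - (f (x + t *\<^sub>R u) - f x)
      = t * (t * (H (x + \<sigma>' *\<^sub>R v + \<tau>' *\<^sub>R u) u \<bullet> v))"
  proof (rule second_difference_mean_value[where S = S and G = G and H = H, OF t])
    show "x + \<sigma> *\<^sub>R v + \<tau> *\<^sub>R u \<in> S" if "0 \<le> \<sigma>" "\<sigma> \<le> t" "0 \<le> \<tau>" "\<tau> \<le> t" for \<sigma> \<tau>
      by (rule inS[OF that norms])
  qed (rule f G; assumption)+
  then obtain \<sigma>' \<tau>' where 2: "0 \<le> \<sigma>'" "\<sigma>' \<le> t" "0 \<le> \<tau>'" "\<tau>' \<le> t" and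
    eq2: "f (x + t *\<^sub>R v + t *\<^sub>R u) - f (x + t *\<^sub>R v) - (f (x + t *\<^sub>R u) - f x)
      = t * (t * (H (x + \<sigma>' *\<^sub>R v + \<tau>' *\<^sub>R u) u \<bullet> v))"
    by (elim exE conjE) rule
  have comm: "x + t *\<^sub>R v + t *\<^sub>R u = x + t *\<^sub>R u + t *\<^sub>R v" by simp
  have "t * (t * (H (x + \<sigma> *\<^sub>R u + \<tau> *\<^sub>R v) v \<bullet> u)) = t * (t * (H (x + \<sigma>' *\<^sub>R v + \<tau>' *\<^sub>R u) u \<bullet> v))"
    unfolding eq1[symmetric] eq2[symmetric] comm by simp
  then have "H (x + \<sigma> *\<^sub>R u + \<tau> *\<^sub>R v) v \<bullet> u = H (x + \<sigma>' *\<^sub>R v + \<tau>' *\<^sub>R u) u \<bullet> v" using t by simp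
  moreover have "\<bar>H (x + \<sigma> *\<^sub>R u + \<tau> *\<^sub>R v) v \<bullet> u - H x v \<bullet> u\<bar> < e"
    using d1(2)[of "x + \<sigma> *\<^sub>R u + \<tau> *\<^sub>R v"] small[OF 1 refl] by simp
  moreover have "\<bar>H (x + \<sigma>' *\<^sub>R v + \<tau>' *\<^sub>R u) u \<bullet> v - H x u \<bullet> v\<bar> < e"
    using d2(2)[of "x + \<sigma>' *\<^sub>R v + \<tau>' *\<^sub>R u"] small[OF 2 norms] by simp
  ultimately have "\<bar>H x v \<bullet> u - H x u \<bullet> v\<bar> < 2 * e" by linarith
  then show False by (simp add: e_def)
qed

lemma second_derivative_matrix_symmetric:
  fixes f :: "real^'n \<Rightarrow> real"
  assumes S: "open S" "x \<in> S"
    and f: "\<And>y. y \<in> S \<Longrightarrow> (f has_derivative (\<lambda>h. G y \<bullet> h)) (at y)"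
    and G: "\<And>y. y \<in> S \<Longrightarrow> (G has_derivative (\<lambda>h. H y *v h)) (at y)"
    and H: "continuous_on S H"
  shows "transpose (H x) = H x"
proof -
  have ent: "(H x *v axis j 1) \<bullet> axis i 1 = H x $ i $ j" for i j
    by (simp add: inner_axis matrix_vector_mult_basis column_def)
  have "continuous_on S (\<lambda>y. H y *v w)" for w
    unfolding matrix_vector_mult_def
    by (intro continuous_on_vec_lambda continuous_intros continuous_on_component H)
  from second_derivative_symmetric[OF S f G this]
  have "(H x *v axis j 1) \<bullet> axis i 1 = (H x *v axis i 1) \<bullet> axis j 1" for i j .
  then show ?thesis unfolding ent by (simp add: vec_eq_iff transpose_def)
qed

section \<open>A Sobolev inequality\<close>

text \<open>Instead of potentials, the proof follows \<open>\<integral> (1 + A\<^sub>t g)\<^sup>r\<close> from \<open>t = 1\<close> to \<open>t = 0\<close>, where \<open>A\<^sub>t g\<close>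
  averages \<open>g\<close> over a cube of side \<open>t\<close>: its derivative is at most a multiple of \<open>t\<^bsup>-(p-1)(r-1)\<^esup>\<close>,
  which is integrable. Taking \<open>p\<close> larger than the dimension is only needed in dimension one.\<close>

lemma sobolev_bound:
  fixes a :: "'a::euclidean_space" and p r B :: real
  assumes p: "real DIM('a) \<le> p" "1 < p" and r: "1 < r" "(p - 1) * (r - 1) < 1"
  shows "\<exists>C. \<forall>g Dg. (\<forall>x. (g has_derivative (\<lambda>h. Dg x \<bullet> h)) (at x)) \<longrightarrow> continuous_on UNIV Dg \<longrightarrow>
     (\<forall>x. 0 \<le> g x) \<longrightarrow> (\<forall>x. x \<notin> cbox (-a) a \<longrightarrow> g x = 0 \<and> Dg x = 0) \<longrightarrow>
     integral UNIV g \<le> B \<longrightarrow> integral UNIV (\<lambda>x. norm (Dg x)) \<le> B \<longrightarrow>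
     integral UNIV (\<lambda>x. g x powr r) \<le> C"
proof -
  \<comment> \<open>The largest norm of a point of the unit cube; it bounds the factor
    \<open>y\<close> produced by differentiating \<open>g (x + t y)\<close> in
    \<open>t\<close>.\<close>
  define \<nu> where "\<nu> = norm (One :: 'a)"
  define \<gamma> where "\<gamma> = (p - 1) * (r - 1)"
  define X where "X = cbox (-a) a"
  define C1 where "C1 = 1 + B + \<nu> * B / (p - 1)"
  define C2 where "C2 = r * C1 powr (r - 1) * (\<nu> * B) + 1"
  define C where "C = measure lborel X * (1 + B) powr r + C2 / (1 - \<gamma>)"
  have \<nu>: "\<nu> \<ge> 0" by (simp add: \<nu>_def)
  have \<gamma>: "\<gamma> < 1" using r by (simp add: \<gamma>_def)
  have "integral UNIV (\<lambda>x. g x powr r) \<le> C"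
    if dg: "\<And>x. (g has_derivative (\<lambda>h. Dg x \<bullet> h)) (at x)" and cDg: "continuous_on UNIV Dg"
      and g0: "\<And>x. 0 \<le> g x" and supp: "\<And>x. x \<notin> cbox (-a) a \<Longrightarrow> g x = 0 \<and> Dg x = 0"
      and ig: "integral UNIV g \<le> B" and iDg: "integral UNIV (\<lambda>x. norm (Dg x)) \<le> B" for g :: "'a \<Rightarrow> real" and Dg
  proof -
    have cg: "continuous_on UNIV g"
      using dg by (meson continuous_at_imp_continuous_on has_derivative_continuous)
    have ccg: "ccont g" by (rule ccontI[OF cg compact_cbox]) (use supp in blast)
    have ccD: "ccont (\<lambda>x. norm (Dg x))"
      by (rule ccontI[OF _ compact_cbox]) (use supp cDg in \<open>auto intro!: continuous_intros\<close>)
    define J where "J = integral UNIV (\<lambda>x. norm (Dg x))"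
    have J: "0 \<le> J" "J \<le> B" using iDg ccont_integral_nonneg[OF ccD] by (auto simp: J_def)
    then have B0: "0 \<le> B" by simp
    \<comment> \<open>\<open>A t\<close> averages \<open>g\<close> over a cube of side
      \<open>t\<close> with corner at the point, so \<open>A 0 = g\<close>, while \<open>A 1\<close>
      is bounded by the integral of \<open>g\<close>. \<open>m\<close> averages the norm of the
      gradient in the same way.\<close>
    define A where "A = (\<lambda>t x. integral (cbox 0 One) (\<lambda>y. g (x + t *\<^sub>R y)))"
    define A' where "A' = (\<lambda>t x. integral (cbox 0 One) (\<lambda>y. Dg (x + t *\<^sub>R y) \<bullet> y))"
    define m where "m = (\<lambda>t x. integral (cbox 0 One) (\<lambda>y. norm (Dg (x + t *\<^sub>R y))))"
    have cA: "continuous_on UNIV (\<lambda>(t, x). A t x)"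
      unfolding A_def case_prod_unfold
      by (rule integral_continuous_on_param) (auto simp: case_prod_unfold intro!: continuous_intros continuous_on_compose2[OF cg])
    have cA': "continuous_on UNIV (\<lambda>(t, x). A' t x)"
      unfolding A'_def case_prod_unfold
      by (rule integral_continuous_on_param) (auto simp: case_prod_unfold intro!: continuous_intros continuous_on_compose2[OF cDg])
    have iA: "(\<lambda>y. g (x + t *\<^sub>R y)) integrable_on cbox 0 One"
      and iA': "(\<lambda>y. Dg (x + t *\<^sub>R y) \<bullet> y) integrable_on cbox 0 One"
      and im: "(\<lambda>y. norm (Dg (x + t *\<^sub>R y))) integrable_on cbox 0 One" for t x
      by (auto intro!: integrable_continuous continuous_intros continuous_on_compose2[OF cg] continuous_on_compose2[OF cDg])
    have A0: "0 \<le> A t x" for t x unfolding A_def by (rule integral_nonneg[OF iA]) (use g0 in auto)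
    have dA: "((\<lambda>t. A t x) has_real_derivative A' t x) (at t)" for t x
      unfolding A_def A'_def
    proof (rule leibniz_rule_field_derivative[where U = UNIV, simplified])
      show "((\<lambda>t. g (x + t *\<^sub>R y)) has_real_derivative Dg (x + t *\<^sub>R y) \<bullet> y) (at t)" for t y
      proof -
        have "((\<lambda>t. x + t *\<^sub>R y) has_derivative (\<lambda>h. h *\<^sub>R y)) (at t)"
          by (auto intro!: derivative_eq_intros)
        from has_derivative_compose[OF this dg]
        show ?thesis by (simp add: has_field_derivative_def mult_commute_abs)
      qed
      show "(\<lambda>y. g (x + t *\<^sub>R y)) integrable_on cbox 0 One" for t by (rule iA)
      show "continuous_on (UNIV \<times> cbox 0 One) (\<lambda>(t, y). Dg (x + t *\<^sub>R y) \<bullet> y)"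
        unfolding case_prod_unfold by (intro continuous_intros continuous_on_compose2[OF cDg]) auto
    qed
    have A'm: "\<bar>A' t x\<bar> \<le> \<nu> * m t x" for t x
    proof -
      have "norm (A' t x) \<le> integral (cbox 0 One) (\<lambda>y. \<nu> * norm (Dg (x + t *\<^sub>R y)))"
        unfolding A'_def
      proof (rule integral_norm_bound_integral[OF iA'])
        show "(\<lambda>y. \<nu> * norm (Dg (x + t *\<^sub>R y))) integrable_on cbox 0 One"
          by (intro integrable_continuous continuous_intros continuous_on_compose2[OF cDg]) auto
        fix y :: 'a assume y: "y \<in> cbox 0 One"
        have "norm y \<le> \<nu>" unfolding \<nu>_def using y by (intro norm_le_componentwise) (auto simp: mem_box)
        have "norm (Dg (x + t *\<^sub>R y) \<bullet> y) \<le> norm (Dg (x + t *\<^sub>R y)) * norm y"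
          by (simp add: Cauchy_Schwarz_ineq2)
        also have "\<dots> \<le> norm (Dg (x + t *\<^sub>R y)) * \<nu>" using \<open>norm y \<le> \<nu>\<close> by (intro mult_left_mono) auto
        finally show "norm (Dg (x + t *\<^sub>R y) \<bullet> y) \<le> \<nu> * norm (Dg (x + t *\<^sub>R y))" by (simp add: mult.commute)
      qed
      then show ?thesis unfolding m_def by simp
    qed
    \<comment> \<open>The substitution in \<open>m_sup\<close> produces the exponent -n; it is
      worsened to -p because a primitive of t^(-1) would be a logarithm.\<close>
    have powle: "t powr (- real DIM('a)) \<le> t powr (- p)" if "0 < t" "t \<le> 1" for t :: real
      using that p by (simp add: powr_mono')
    have m_sup: "m t x \<le> t powr (- p) * J" if t: "0 < t" "t \<le> 1" for t x
    proof -
      note aff = ccont_affine[OF ccD, of t x]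
      have "m t x \<le> integral UNIV (\<lambda>y. norm (Dg (t *\<^sub>R y + x)))"
        unfolding m_def add.commute[of x] using t
        by (intro integral_subset_le ccont_integrable aff(1)
            integrable_continuous continuous_intros continuous_on_compose2[OF cDg]) auto
      also have "\<dots> = t powr (- real DIM('a)) * J"
        using aff(2) t by (simp add: J_def powr_minus powr_realpow divide_inverse mult.commute)
      also have "\<dots> \<le> t powr (- p) * J" using J powle[OF t] by (intro mult_right_mono) auto
      finally show ?thesis .
    qed
    have A1: "A 1 x \<le> B" for x
    proof -
      have "A 1 x \<le> integral UNIV (\<lambda>y. g (y + x))"
        unfolding A_def scaleR_one add.commute[of x]
        by (intro integral_subset_le integrable_continuous continuous_on_compose2[OF cg] continuous_intros
            ccont_integrable ccont_translate(1)[OF ccg]) (auto simp: g0)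
      then show ?thesis using ig ccont_translate(2)[OF ccg, of x] by simp
    qed
    have A_sup: "1 + A t x \<le> C1 * t powr (1 - p)" if t: "0 < t" "t \<le> 1" for t x
    proof -
      \<comment> \<open>The subtracted term is built so that its derivative outweighs
        \<open>A'\<close>, which is at most \<open>\<nu> * B * s powr (- p)\<close>. Monotonicity of
        \<open>D\<close> is the integrated form of that bound from \<open>t\<close> to 1.\<close>
      define D where "D = (\<lambda>s. A s x - \<nu> * B / (p - 1) * s powr (1 - p))"
      have "D t \<le> D 1"
      proof (rule DERIV_nonneg_imp_nondecreasing[OF t(2)])
        fix s :: real assume s: "t \<le> s" "s \<le> 1"
        then have s0: "0 < s" using t by simp
        have "(D has_real_derivative A' s x - \<nu> * B / (p - 1) * ((1 - p) * s powr (1 - p - 1))) (at s)"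
          unfolding D_def by (intro DERIV_diff dA DERIV_cmult has_real_derivative_powr s0)
        moreover have "\<nu> * B / (p - 1) * ((1 - p) * s powr (1 - p - 1)) = - (\<nu> * B * s powr (- p))"
          using p by (simp add: divide_simps) (simp add: algebra_simps)
        ultimately have "(D has_real_derivative A' s x + \<nu> * B * s powr (- p)) (at s)" by simp
        moreover have "\<bar>A' s x\<bar> \<le> \<nu> * B * s powr (- p)"
        proof -
          have "\<bar>A' s x\<bar> \<le> \<nu> * (s powr (- p) * J)"
            using A'm[of s x] m_sup[OF s0 s(2), of x] \<nu> by (meson mult_left_mono order_trans)
          also have "\<dots> \<le> \<nu> * (s powr (- p) * B)" using J \<nu> by (intro mult_left_mono) auto
          finally show ?thesis by (simp add: mult_ac)
        qed
        ultimately show "\<exists>y. (D has_real_derivative y) (at s) \<and> 0 \<le> y"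
          by (intro exI[of _ "A' s x + \<nu> * B * s powr (- p)"]) (simp add: abs_le_iff)
      qed
      then have "A t x \<le> B + \<nu> * B / (p - 1) * t powr (1 - p) - \<nu> * B / (p - 1)"
        using A1[of x] by (simp add: D_def)
      also have "\<dots> \<le> B + \<nu> * B / (p - 1) * t powr (1 - p)" using \<nu> B0 p by simp
      finally have "1 + A t x \<le> (1 + B) * 1 + \<nu> * B / (p - 1) * t powr (1 - p)" by simp
      also have "\<dots> \<le> (1 + B) * t powr (1 - p) + \<nu> * B / (p - 1) * t powr (1 - p)"
        using B0 t p powr_mono'[of "1 - p" 0 t] by (intro add_right_mono mult_left_mono) auto
      finally show ?thesis by (simp add: C1_def algebra_simps)
    qed
    \<comment> \<open>The integral runs over the box \<open>X\<close> because the integrand is at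
      least 1 everywhere. The summand 1 keeps the base positive, so the power is differentiable
      where \<open>A\<close> vanishes.\<close>
    define \<Psi> where "\<Psi> = (\<lambda>t. integral X (\<lambda>x. (1 + A t x) powr r))"
    define \<Psi>' where "\<Psi>' = (\<lambda>t. integral X (\<lambda>x. r * (1 + A t x) powr (r - 1) * A' t x))"
    have pos: "1 + A t x > 0" for t x using A0[of t x] by simp
    have cP: "continuous_on S (\<lambda>x. (t :: real, x))" for t and S :: "'a set"
      by (intro continuous_intros)
    have cAx: "continuous_on S (A t)" "continuous_on S (A' t)" for t S
      using continuous_on_compose2[OF cA cP] continuous_on_compose2[OF cA' cP] by auto
    have cA2: "continuous_on S (\<lambda>z. A (fst z) (snd z))" "continuous_on S (\<lambda>z. A' (fst z) (snd z))" for S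
      using cA cA' unfolding case_prod_unfold by (auto intro: continuous_on_subset)
    have d\<Psi>: "(\<Psi> has_real_derivative \<Psi>' t) (at t)" for t
      unfolding \<Psi>_def \<Psi>'_def X_def
    proof (rule leibniz_rule_field_derivative[where U = UNIV, simplified])
      show "((\<lambda>t. (1 + A t x) powr r) has_real_derivative r * (1 + A t x) powr (r - 1) * A' t x) (at t)" for t x
        using dA[of x t] pos[of t x] by (auto intro!: derivative_eq_intros)
      show "(\<lambda>x. (1 + A t x) powr r) integrable_on cbox (-a) a" for t
        using pos by (intro integrable_continuous continuous_intros cAx) (auto simp: less_imp_neq[symmetric] less_imp_le)
      show "continuous_on (UNIV \<times> cbox (-a) a) (\<lambda>(t, x). r * (1 + A t x) powr (r - 1) * A' t x)"
        unfolding case_prod_unfold using pos by (intro continuous_intros cA2) (auto simp: less_imp_neq[symmetric])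
    qed
    have \<Psi>'_bound: "\<bar>\<Psi>' t\<bar> \<le> r * C1 powr (r - 1) * (\<nu> * B) * t powr (- \<gamma>)" if t: "0 < t" "t \<le> 1" for t
    proof -
      define c where "c = r * (C1 * t powr (1 - p)) powr (r - 1)"
      have c: "0 \<le> c" using r by (simp add: c_def)
      have cm: "continuous_on S (m t)" for S
      proof -
        have "continuous_on UNIV (m t)" unfolding m_def
          by (rule integral_continuous_on_param) (auto simp: case_prod_unfold intro!: continuous_intros continuous_on_compose2[OF cDg])
        then show ?thesis by (rule continuous_on_subset) simp
      qed
      have "norm (\<Psi>' t) \<le> integral X (\<lambda>x. c * \<nu> * m t x)"
        unfolding \<Psi>'_def X_def
      proof (rule integral_norm_bound_integral)
        show "(\<lambda>x. r * (1 + A t x) powr (r - 1) * A' t x) integrable_on cbox (-a) a"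
          using pos by (intro integrable_continuous continuous_intros cAx) (auto simp: less_imp_neq[symmetric])
        show "(\<lambda>x. c * \<nu> * m t x) integrable_on cbox (-a) a"
          by (intro integrable_continuous continuous_intros cm)
        fix x
        have "(1 + A t x) powr (r - 1) \<le> (C1 * t powr (1 - p)) powr (r - 1)"
          using A_sup[OF t, of x] pos[of t x] r by (intro powr_mono2) auto
        then have "r * (1 + A t x) powr (r - 1) \<le> c" using r by (simp add: c_def)
        then have "r * (1 + A t x) powr (r - 1) * \<bar>A' t x\<bar> \<le> c * (\<nu> * m t x)"
          using A'm[of t x] c by (intro mult_mono) auto
        then show "norm (r * (1 + A t x) powr (r - 1) * A' t x) \<le> c * \<nu> * m t x"
          using r by (simp add: abs_mult mult.assoc)
      qed
      also have "\<dots> = c * \<nu> * integral X (m t)" by simp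
      also have "\<dots> \<le> c * \<nu> * B"
      proof (rule mult_left_mono)
        \<comment> \<open>Exchanging the integrals leaves translates of the gradient norm, each of
          total integral \<open>J\<close>. So \<open>m t\<close> has large supremum but integral
          bounded independently of \<open>t\<close>.\<close>
        have "integral X (m t) = integral (cbox 0 One) (\<lambda>y. integral X (\<lambda>x. norm (Dg (x + t *\<^sub>R y))))"
          unfolding m_def X_def
          by (rule integral_swap_continuous)
             (auto simp: case_prod_unfold intro!: continuous_intros continuous_on_compose2[OF cDg])
        also have "\<dots> \<le> integral (cbox 0 (One::'a)) (\<lambda>y. J)"
        proof (rule integral_le)
          have "continuous_on (cbox 0 One) (\<lambda>y. integral (cbox (-a) a) (\<lambda>x. norm (Dg (x + t *\<^sub>R y))))"
            by (rule integral_continuous_on_param) (auto simp: case_prod_unfold intro!: continuous_intros continuous_on_compose2[OF cDg])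
          then show "(\<lambda>y. integral X (\<lambda>x. norm (Dg (x + t *\<^sub>R y)))) integrable_on cbox 0 One"
            unfolding X_def by (rule integrable_continuous)
          fix y
          note tr = ccont_translate[OF ccD, of "t *\<^sub>R y"]
          have "integral X (\<lambda>x. norm (Dg (x + t *\<^sub>R y))) \<le> integral UNIV (\<lambda>x. norm (Dg (x + t *\<^sub>R y)))"
            unfolding X_def using ccont_integrable[OF tr(1)]
            by (intro integral_subset_le integrable_continuous continuous_intros continuous_on_compose2[OF cDg]) auto
          then show "integral X (\<lambda>x. norm (Dg (x + t *\<^sub>R y))) \<le> J" using tr(2) by (simp add: J_def)
        qed (rule integrable_const)
        also have "\<dots> = J" by simp
        finally show "integral X (m t) \<le> B" using J by simp
        show "0 \<le> c * \<nu>" using c \<nu> by simp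
      qed
      also have "c = r * C1 powr (r - 1) * t powr (- \<gamma>)"
      proof -
        have "0 \<le> C1" using B0 \<nu> p by (simp add: C1_def)
        then have "(C1 * t powr (1 - p)) powr (r - 1) = C1 powr (r - 1) * t powr ((1 - p) * (r - 1))"
          by (simp add: powr_mult powr_powr)
        moreover have "(1 - p) * (r - 1) = - \<gamma>" by (simp add: \<gamma>_def algebra_simps)
        ultimately show ?thesis by (simp add: c_def)
      qed
      finally show ?thesis by (simp add: mult_ac)
    qed
    \<comment> \<open>The added term is a primitive of \<open>C2 * t powr (- \<gamma>)\<close>. The
      \<open>+ 1\<close> in \<open>C2\<close> makes the derivative of \<open>E\<close> strictly
      positive, and only the open interval is used because that derivative may be singular at
      0.\<close>
    define E where "E = (\<lambda>t. \<Psi> t + C2 / (1 - \<gamma>) * t powr (1 - \<gamma>))"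
    have "E 0 < E 1"
    proof (rule DERIV_pos_imp_increasing_open[where f = E])
      fix t :: real assume t: "0 < t" "t < 1"
      have "(E has_real_derivative \<Psi>' t + C2 / (1 - \<gamma>) * ((1 - \<gamma>) * t powr (1 - \<gamma> - 1))) (at t)"
        unfolding E_def by (intro DERIV_add d\<Psi> DERIV_cmult has_real_derivative_powr t)
      then have "(E has_real_derivative \<Psi>' t + C2 * t powr (- \<gamma>)) (at t)" using \<gamma> by simp
      moreover have "0 < \<Psi>' t + C2 * t powr (- \<gamma>)"
        using \<Psi>'_bound[of t] t by (simp add: C2_def algebra_simps abs_le_iff add_pos_nonneg)
          (smt (verit) powr_gt_zero)
      ultimately show "\<exists>y. (E has_real_derivative y) (at t) \<and> 0 < y" by blast
    next
      have "continuous_on {0..1} \<Psi>"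
        using d\<Psi> by (meson DERIV_isCont continuous_at_imp_continuous_on)
      moreover have "continuous_on {0..1} (\<lambda>t :: real. t powr (1 - \<gamma>))"
        using \<gamma> by (intro continuous_on_powr' continuous_intros) auto
      ultimately show "continuous_on {0..1} E"
        unfolding E_def by (intro continuous_on_add continuous_on_mult continuous_on_const)
    qed simp
    then have "\<Psi> 0 \<le> \<Psi> 1 + C2 / (1 - \<gamma>)" using \<gamma> by (simp add: E_def)
    also have "\<Psi> 1 \<le> measure lborel X * (1 + B) powr r"
    proof -
      have "\<Psi> 1 \<le> integral X (\<lambda>x. (1 + B) powr r)"
        unfolding \<Psi>_def X_def
      proof (rule integral_le)
        show "(\<lambda>x. (1 + A 1 x) powr r) integrable_on cbox (-a) a"
          using pos by (intro integrable_continuous continuous_intros cAx) (auto simp: less_imp_neq[symmetric] less_imp_le)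
        show "(1 + A 1 x) powr r \<le> (1 + B) powr r" for x
          using A1[of x] A0[of 1 x] r by (intro powr_mono2) auto
      qed (rule integrable_const)
      then show ?thesis by (simp add: X_def)
    qed
    finally have "\<Psi> 0 \<le> C" by (simp add: C_def)
    moreover have "integral UNIV (\<lambda>x. g x powr r) \<le> \<Psi> 0"
    proof -
      have cr: "continuous_on UNIV (\<lambda>x. g x powr r)"
        using cg g0 r by (intro continuous_on_powr') auto
      have "integral UNIV (\<lambda>x. g x powr r) = integral X (\<lambda>x. g x powr r)"
        unfolding X_def by (rule ccont_integral_cbox[OF cr]) (use supp r in auto)
      also have "\<dots> \<le> integral X (\<lambda>x. (1 + A 0 x) powr r)"
        unfolding X_def
      proof (rule integral_le)
        show "(\<lambda>x. g x powr r) integrable_on cbox (-a) a"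
          by (intro integrable_continuous continuous_on_subset[OF cr]) auto
        show "(\<lambda>x. (1 + A 0 x) powr r) integrable_on cbox (-a) a"
          using pos by (intro integrable_continuous continuous_intros cAx) (auto simp: less_imp_neq[symmetric] less_imp_le)
        show "g x powr r \<le> (1 + A 0 x) powr r" for x
          using g0[of x] r by (intro powr_mono2) (auto simp: A_def)
      qed
      finally show ?thesis by (simp add: \<Psi>_def)
    qed
    ultimately show ?thesis by simp
  qed
  then show ?thesis by blast
qed

section \<open>Mollification and the weak divergence identity\<close>

text \<open>One direction at a time suffices, since mollified matrix fields are differentiated
  coordinate by coordinate.\<close>

definition has_pd :: "('a::real_normed_vector \<Rightarrow> real) \<Rightarrow> ('a \<Rightarrow> real) \<Rightarrow> 'a \<Rightarrow> bool" where
  "has_pd f f' e \<longleftrightarrow> continuous_on UNIV f \<and> continuous_on UNIV f' \<and>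
     (\<forall>x. ((\<lambda>t. f (x + t *\<^sub>R e)) has_real_derivative f' x) (at 0))"

lemma has_pd_line:
  assumes "has_pd f f' e"
  shows "((\<lambda>t. f (x + t *\<^sub>R e)) has_real_derivative f' (x + s *\<^sub>R e)) (at s)"
proof -
  have "((\<lambda>t. f ((x + s *\<^sub>R e) + (t - s) *\<^sub>R e)) has_real_derivative f' (x + s *\<^sub>R e) * (1 - 0)) (at s)"
    by (rule DERIV_chain2[where g = "\<lambda>t. t - s"]) (use assms in \<open>auto simp: has_pd_def intro!: derivative_eq_intros\<close>)
  then show ?thesis by (simp add: algebra_simps)
qed

lemma has_pd_ccont:
  fixes g :: "'a::euclidean_space \<Rightarrow> real"
  assumes "ccont g" "has_pd g g' e"
  shows "ccont g'" "integral UNIV g' = 0"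
  using ccont_derivative[OF assms(1), of g' e] assms(2) by (auto simp: has_pd_def)

lemma has_pd_mult:
  assumes "has_pd f f' e" "has_pd g g' e"
  shows "has_pd (\<lambda>x. f x * g x) (\<lambda>x. f' x * g x + g' x * f x) e"
  using assms unfolding has_pd_def
  by (auto intro!: continuous_intros DERIV_mult'[THEN DERIV_cong])

lemma has_pd_cmult: "has_pd f f' e \<Longrightarrow> has_pd (\<lambda>x. c * f x) (\<lambda>x. c * f' x) e"
  unfolding has_pd_def by (auto intro!: continuous_intros DERIV_cmult)

lemma has_pd_gradient:
  assumes "\<And>x. (f has_derivative (\<lambda>h. Df x \<bullet> h)) (at x)" "continuous_on UNIV Df"
  shows "has_pd f (\<lambda>x. Df x \<bullet> e) e"
  unfolding has_pd_def
proof (intro conjI allI)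
  show "continuous_on UNIV f"
    using assms(1) by (meson continuous_at_imp_continuous_on has_derivative_continuous)
  show "continuous_on UNIV (\<lambda>x. Df x \<bullet> e)" by (intro continuous_intros assms)
  fix x
  have "((\<lambda>t. x + t *\<^sub>R e) has_derivative (\<lambda>h. h *\<^sub>R e)) (at 0)"
    by (auto intro!: derivative_eq_intros)
  moreover have "(f has_derivative (\<lambda>h. Df x \<bullet> h)) (at (x + 0 *\<^sub>R e))" using assms(1)[of x] by simp
  ultimately have "((\<lambda>t. f (x + t *\<^sub>R e)) has_derivative (\<lambda>h. Df x \<bullet> (h *\<^sub>R e))) (at 0)"
    by (rule has_derivative_compose)
  then show "((\<lambda>t. f (x + t *\<^sub>R e)) has_real_derivative Df x \<bullet> e) (at 0)"
    by (simp add: has_field_derivative_def mult_commute_abs)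
qed

lemma has_pd_affine:
  assumes "has_pd f f' e"
  shows "has_pd (\<lambda>y. f (x + r *\<^sub>R y)) (\<lambda>y. r * f' (x + r *\<^sub>R y)) e"
  unfolding has_pd_def
proof (intro conjI allI)
  have c: "continuous_on UNIV f" "continuous_on UNIV f'" using assms by (auto simp: has_pd_def)
  show "continuous_on UNIV (\<lambda>y. f (x + r *\<^sub>R y))" "continuous_on UNIV (\<lambda>y. r * f' (x + r *\<^sub>R y))"
    by (auto intro!: continuous_intros continuous_on_compose2[OF c(1)] continuous_on_compose2[OF c(2)])
  fix y
  have "((\<lambda>t. f ((x + r *\<^sub>R y) + (r * t) *\<^sub>R e)) has_real_derivative f' (x + r *\<^sub>R y) * r) (at 0)"
    by (rule DERIV_chain2[where g = "\<lambda>t. r * t"])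
      (use assms in \<open>auto simp: has_pd_def intro!: derivative_eq_intros\<close>)
  then show "((\<lambda>t. f (x + r *\<^sub>R (y + t *\<^sub>R e))) has_real_derivative r * f' (x + r *\<^sub>R y)) (at 0)"
    by (simp add: scaleR_add_right add.assoc mult.commute)
qed

text \<open>The derivative moves from \<open>W\<close> to the kernel; the factor 1/r is the inner
  derivative of \<open>x + r y\<close> with respect to \<open>y\<close>.\<close>

lemma convolution_by_parts:
  fixes \<psi> :: "'a::euclidean_space \<Rightarrow> real"
  assumes \<psi>: "ccont \<psi>" "has_pd \<psi> \<psi>' e" and W: "has_pd W W' e" and r: "r \<noteq> 0"
  shows "integral UNIV (\<lambda>y. \<psi> y * W' (x + r *\<^sub>R y)) = - integral UNIV (\<lambda>y. \<psi>' y * W (x + r *\<^sub>R y)) / r"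
proof -
  have c: "continuous_on UNIV (\<lambda>y. W (x + r *\<^sub>R y))" "continuous_on UNIV (\<lambda>y. W' (x + r *\<^sub>R y))"
    using W unfolding has_pd_def by (auto intro!: continuous_intros elim!: continuous_on_compose2)
  have "ccont (\<lambda>y. \<psi> y * W (x + r *\<^sub>R y))" by (rule ccont_mult[OF \<psi>(1) c(1)])
  from has_pd_ccont(2)[OF this has_pd_mult[OF \<psi>(2) has_pd_affine[OF W]]]
  have "integral UNIV (\<lambda>y. \<psi>' y * W (x + r *\<^sub>R y) + r * (\<psi> y * W' (x + r *\<^sub>R y))) = 0"
    by (simp add: mult_ac)
  then have "integral UNIV (\<lambda>y. \<psi>' y * W (x + r *\<^sub>R y)) + r * integral UNIV (\<lambda>y. \<psi> y * W' (x + r *\<^sub>R y)) = 0"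
    using ccont_integrable[OF ccont_mult[OF has_pd_ccont(1)[OF \<psi>] c(1)]]
      ccont_integrable[OF ccont_cmult[OF ccont_mult[OF \<psi>(1) c(2)], of r]]
    by (subst (asm) integral_add) auto
  then show ?thesis using r by (simp add: field_simps eq_neg_iff_add_eq_0)
qed

text \<open>Joint continuity in \<open>(r, x)\<close> includes r = 0, where the mollification is
  \<open>W\<close> up to the mass of the kernel. This replaces a convergence argument for
  mollifiers.\<close>

lemma convolution_continuous:
  fixes \<psi> :: "'a::euclidean_space \<Rightarrow> real" and W :: "'a \<Rightarrow> real"
  assumes \<psi>: "ccont \<psi>" and W: "continuous_on UNIV W"
  shows "continuous_on UNIV (\<lambda>(r, x). integral UNIV (\<lambda>y. \<psi> y * W (x + r *\<^sub>R y)))"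
proof -
  obtain a where a: "\<And>x. x \<notin> cbox (-a) a \<Longrightarrow> \<psi> x = 0" using ccont_cbox[OF \<psi>] by blast
  have \<psi>c: "continuous_on UNIV \<psi>" by (rule ccont_continuous[OF \<psi>])
  have "integral UNIV (\<lambda>y. \<psi> y * W (x + r *\<^sub>R y)) = integral (cbox (-a) a) (\<lambda>y. \<psi> y * W (x + r *\<^sub>R y))" for x r
    by (rule ccont_integral_cbox)
      (auto simp: a intro!: continuous_intros \<psi>c continuous_on_compose2[OF W])
  moreover have "continuous_on UNIV (\<lambda>z. integral (cbox (-a) a) (\<lambda>y. \<psi> y * W (snd z + fst z *\<^sub>R y)))"
    by (rule integral_continuous_on_param)
      (auto simp: case_prod_unfold intro!: continuous_intros continuous_on_compose2[OF W] continuous_on_compose2[OF \<psi>c])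
  ultimately show ?thesis by (simp add: case_prod_unfold)
qed

lemma convolution_has_pd:
  fixes \<psi> :: "'a::euclidean_space \<Rightarrow> real"
  assumes \<psi>: "ccont \<psi>" and W: "has_pd W W' e"
  shows "has_pd (\<lambda>x. integral UNIV (\<lambda>y. \<psi> y * W (x + r *\<^sub>R y))) (\<lambda>x. integral UNIV (\<lambda>y. \<psi> y * W' (x + r *\<^sub>R y))) e"
  unfolding has_pd_def
proof (intro conjI allI)
  have c: "continuous_on UNIV W" "continuous_on UNIV W'" using W by (auto simp: has_pd_def)
  have cP: "continuous_on UNIV (\<lambda>x. (r, x))" by (intro continuous_intros)
  show "continuous_on UNIV (\<lambda>x. integral UNIV (\<lambda>y. \<psi> y * W (x + r *\<^sub>R y)))"
    using continuous_on_compose2[OF convolution_continuous[OF \<psi> c(1)] cP] by simp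
  show "continuous_on UNIV (\<lambda>x. integral UNIV (\<lambda>y. \<psi> y * W' (x + r *\<^sub>R y)))"
    using continuous_on_compose2[OF convolution_continuous[OF \<psi> c(2)] cP] by simp
  fix x
  obtain a where a: "\<And>x. x \<notin> cbox (-a) a \<Longrightarrow> \<psi> x = 0" using ccont_cbox[OF \<psi>] by blast
  have \<psi>c: "continuous_on UNIV \<psi>" by (rule ccont_continuous[OF \<psi>])
  have eq: "integral UNIV (\<lambda>y. \<psi> y * F (z + r *\<^sub>R y)) = integral (cbox (-a) a) (\<lambda>y. \<psi> y * F (z + r *\<^sub>R y))"
    if F: "continuous_on UNIV F" for F z
    by (rule ccont_integral_cbox)
      (auto simp: a intro!: continuous_intros \<psi>c continuous_on_compose2[OF F])
  have "((\<lambda>t. integral (cbox (-a) a) (\<lambda>y. \<psi> y * W ((x + t *\<^sub>R e) + r *\<^sub>R y))) has_real_derivative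
     integral (cbox (-a) a) (\<lambda>y. \<psi> y * W' ((x + 0 *\<^sub>R e) + r *\<^sub>R y))) (at 0)"
  proof (rule leibniz_rule_field_derivative[where U = UNIV, simplified])
    show "((\<lambda>t. \<psi> y * W (x + t *\<^sub>R e + r *\<^sub>R y)) has_real_derivative \<psi> y * W' (x + t *\<^sub>R e + r *\<^sub>R y)) (at t)" for t y
      using has_pd_line[OF W, of "x + r *\<^sub>R y" t] by (intro DERIV_cmult) (simp add: algebra_simps)
    show "(\<lambda>y. \<psi> y * W (x + t *\<^sub>R e + r *\<^sub>R y)) integrable_on cbox (-a) a" for t
      by (intro integrable_continuous continuous_intros continuous_on_compose2[OF c(1)] continuous_on_compose2[OF \<psi>c]) auto
    show "continuous_on (UNIV \<times> cbox (-a) a) (\<lambda>(t, y). \<psi> y * W' (x + t *\<^sub>R e + r *\<^sub>R y))"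
      unfolding case_prod_unfold
      by (intro continuous_intros continuous_on_compose2[OF c(2)] continuous_on_compose2[OF \<psi>c]) auto
  qed
  then show "((\<lambda>t. integral UNIV (\<lambda>y. \<psi> y * W ((x + t *\<^sub>R e) + r *\<^sub>R y))) has_real_derivative
     integral UNIV (\<lambda>y. \<psi> y * W' (x + r *\<^sub>R y))) (at 0)"
    unfolding eq[OF c(1)] eq[OF c(2)] by simp
qed

lemma twice_differentiable_kernel:
  obtains \<rho> :: "real^'n \<Rightarrow> real" and \<rho>' \<rho>'' where "ccont \<rho>" "integral UNIV \<rho> > 0"
    "\<And>i. ccont (\<rho>' i)" "\<And>i. has_pd \<rho> (\<rho>' i) (axis i 1)"
    "\<And>i j. has_pd (\<rho>' i) (\<rho>'' i j) (axis j 1)" "\<And>i j. \<rho>'' i j = \<rho>'' j i"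
proof -
  define q where "q = (\<lambda>y :: real^'n. 1 - y \<bullet> y)"
  \<comment> \<open>This is the cube of the positive part of 1 - |y|^2, hence of class C^2. Two
    derivatives are needed because the symmetry of the mollified field is read off from second
    derivatives of the kernel.\<close>
  define \<rho> where "\<rho> = (\<lambda>y. q y * pos2 (q y))"
  define \<rho>' where "\<rho>' = (\<lambda>i y. - 6 * (y $ i) * pos2 (q y))"
  define \<rho>'' where "\<rho>'' = (\<lambda>i j y. 24 * (y $ i) * (y $ j) * max 0 (q y) - (if i = j then 6 * pos2 (q y) else 0))"
  have cq: "continuous_on UNIV q" unfolding q_def by (intro continuous_intros)
  have cp: "continuous_on UNIV (\<lambda>y. pos2 (q y))" unfolding pos2_def by (intro continuous_intros cq)
  have cn: "continuous_on UNIV (\<lambda>y :: real^'n. y $ i)" for i by (intro continuous_intros)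
  have dq: "((\<lambda>t. q (y + t *\<^sub>R axis i 1)) has_real_derivative - 2 * y $ i) (at 0)" for y i
  proof -
    have "q (y + t *\<^sub>R axis i 1) = 1 - (y \<bullet> y + 2 * t * y $ i + t * t)" for t
      by (simp add: q_def inner_add_left inner_add_right inner_axis inner_axis' inner_commute algebra_simps)
    then show ?thesis by (auto intro!: derivative_eq_intros)
  qed
  have dp: "((\<lambda>t. pos2 (q (y + t *\<^sub>R axis i 1))) has_real_derivative 2 * max 0 (q y) * (- 2 * y $ i)) (at 0)" for y i
    using DERIV_chain2[OF pos2_derivative dq[of y i]] by simp
  have mp: "q y * max 0 (q y) = pos2 (q y)" for y by (simp add: pos2_def max_def power2_eq_square)
  have pd1: "has_pd \<rho> (\<rho>' i) (axis i 1)" for i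
    unfolding has_pd_def
  proof (intro conjI allI)
    show "continuous_on UNIV \<rho>" unfolding \<rho>_def by (intro continuous_intros cq cp)
    show "continuous_on UNIV (\<rho>' i)" unfolding \<rho>'_def by (intro continuous_intros cn cp)
    fix y
    have "((\<lambda>t. \<rho> (y + t *\<^sub>R axis i 1)) has_real_derivative
        q y * (2 * max 0 (q y) * (- 2 * y $ i)) + (- 2 * y $ i) * pos2 (q y)) (at 0)"
      unfolding \<rho>_def using DERIV_mult'[OF dq[of y i] dp[of y i]] by simp
    moreover have "q y * (2 * max 0 (q y) * (- 2 * y $ i)) + (- 2 * y $ i) * pos2 (q y) = \<rho>' i y"
      using mp[of y] by (simp add: \<rho>'_def algebra_simps)
    ultimately show "((\<lambda>t. \<rho> (y + t *\<^sub>R axis i 1)) has_real_derivative \<rho>' i y) (at 0)" by simp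
  qed
  have pd2: "has_pd (\<rho>' i) (\<rho>'' i j) (axis j 1)" for i j
    unfolding has_pd_def
  proof (intro conjI allI)
    show "continuous_on UNIV (\<rho>' i)" unfolding \<rho>'_def by (intro continuous_intros cn cp)
    show "continuous_on UNIV (\<rho>'' i j)" unfolding \<rho>''_def
      by (cases "i = j") (auto intro!: continuous_intros cn cp cq)
    fix y
    have dn: "((\<lambda>t. (y + t *\<^sub>R axis j 1) $ i) has_real_derivative (if i = j then 1 else 0)) (at 0)"
      by (auto simp: axis_def intro!: derivative_eq_intros)
    have "((\<lambda>t. \<rho>' i (y + t *\<^sub>R axis j 1)) has_real_derivative
       (- 6 * y $ i) * (2 * max 0 (q y) * (- 2 * y $ j)) + (- 6 * (if i = j then 1 else 0)) * pos2 (q y)) (at 0)"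
      unfolding \<rho>'_def using DERIV_mult'[OF DERIV_cmult[OF dn, of "-6"] dp[of y j]] by simp
    moreover have "(- 6 * y $ i) * (2 * max 0 (q y) * (- 2 * y $ j)) + (- 6 * (if i = j then 1 else 0)) * pos2 (q y) = \<rho>'' i j y"
      by (simp add: \<rho>''_def)
    ultimately show "((\<lambda>t. \<rho>' i (y + t *\<^sub>R axis j 1)) has_real_derivative \<rho>'' i j y) (at 0)" by simp
  qed
  have out: "pos2 (q y) = 0" if "y \<notin> cball 0 1" for y
  proof -
    have "1 \<le> norm y" using that by simp
    then have "1\<^sup>2 \<le> (norm y)\<^sup>2" by (intro power_mono) auto
    then show ?thesis by (simp add: q_def pos2_def power2_norm_eq_inner)
  qed
  have cc: "ccont \<rho>" by (rule ccontI[of _ "cball 0 1"]) (use pd1 out in \<open>auto simp: has_pd_def \<rho>_def\<close>)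
  have cc': "ccont (\<rho>' i)" for i
    by (rule ccontI[of _ "cball 0 1"]) (use pd2 out in \<open>auto simp: has_pd_def \<rho>'_def\<close>)
  have nn: "0 \<le> \<rho> y" for y by (simp add: \<rho>_def pos2_def max_def)
  have "integral UNIV \<rho> > 0"
  proof -
    \<comment> \<open>Scaled so that all points of \<open>cbox 0 b\<close> have norm at most 1/2;
      there \<open>q\<close> is at least 3/4, whence the lower bound 27/64 for the kernel.\<close>
    define b where "b = (1 / (2 * norm (One :: real^'n))) *\<^sub>R (One :: real^'n)"
    have on: "norm (One :: real^'n) \<ge> 1"
    proof -
      obtain i :: "real^'n" where i: "i \<in> Basis" using nonempty_Basis by blast
      have "\<bar>One \<bullet> i\<bar> \<le> norm (One :: real^'n)" using i by (rule Basis_le_norm)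
      then show ?thesis using i by simp
    qed
    have nb: "norm y \<le> 1 / 2" if "y \<in> cbox 0 b" for y
    proof -
      have "norm y \<le> norm b" using that by (intro norm_le_componentwise) (auto simp: mem_box)
      also have "norm b = 1 / 2" using on by (simp add: b_def)
      finally show ?thesis .
    qed
    have lb: "27 / 64 \<le> \<rho> y" if "y \<in> cbox 0 b" for y
    proof -
      have "(norm y)\<^sup>2 \<le> (1 / 2)\<^sup>2" using nb[OF that] by (intro power_mono) auto
      then have "y \<bullet> y \<le> 1 / 4" unfolding power2_norm_eq_inner by (simp add: power_divide)
      then have q: "3 / 4 \<le> q y" by (simp add: q_def)
      then have "(3 / 4) ^ 3 \<le> (q y) ^ 3" by (intro power_mono) auto
      then show ?thesis using q by (simp add: \<rho>_def pos2_def max_def power3_eq_cube power2_eq_square)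
    qed
    have "0 < measure lborel (cbox 0 b) * (27 / 64)"
      using on by (auto simp: content_cbox_if b_def box_ne_empty intro!: prod_pos mult_pos_pos)
    also have "\<dots> = integral (cbox 0 b) (\<lambda>y. 27 / 64)" by simp
    also have "\<dots> \<le> integral (cbox 0 b) \<rho>"
      using lb by (intro integral_le integrable_continuous continuous_on_subset[OF ccont_continuous[OF cc]]) auto
    also have "\<dots> \<le> integral UNIV \<rho>"
      using nn by (intro integral_subset_le integrable_continuous continuous_on_subset[OF ccont_continuous[OF cc]]
          ccont_integrable cc) auto
    finally show ?thesis .
  qed
  moreover have "\<rho>'' i j = \<rho>'' j i" for i j by (auto simp: \<rho>''_def fun_eq_iff)
  ultimately show ?thesis using that cc cc' pd1 pd2 by blast
qed

lemma has_vector_derivative_matrix: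
  fixes M :: "real \<Rightarrow> real^'n^'m"
  assumes "\<And>k i. ((\<lambda>t. M t $ k $ i) has_real_derivative N $ k $ i) (at t)"
  shows "(M has_vector_derivative N) (at t)"
proof -
  have "((\<lambda>t. M t \<bullet> b) has_derivative (\<lambda>h. (h *\<^sub>R N) \<bullet> b)) (at t)" if b: "b \<in> Basis" for b
  proof -
    obtain k v where k: "b = axis k v" "v \<in> Basis" using b by (auto simp: Basis_vec_def)
    then obtain i where i: "v = axis i 1" by (auto simp: Basis_vec_def)
    show ?thesis using assms[of k i]
      by (simp add: k i inner_axis has_field_derivative_def mult_commute_abs)
  qed
  then show ?thesis
    unfolding has_vector_derivative_def by (subst has_derivative_componentwise_within) auto
qed

lemma continuous_on_matrix:
  fixes M :: "'a::topological_space \<Rightarrow> real^'n^'m"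
  assumes "\<And>k i. continuous_on S (\<lambda>x. M x $ k $ i)"
  shows "continuous_on S M"
proof -
  have "continuous_on S (\<lambda>x. \<chi> k. \<chi> i. M x $ k $ i)"
    by (intro continuous_on_vec_lambda assms)
  then show ?thesis by simp
qed

text \<open>For differentiable \<open>M\<close> the divergence of \<phi> times a column of
  \<open>NT l M\<close> is the integrand, because the part with \<phi> undifferentiated vanishes by
  \<open>NT_divergence_free\<close>; its integral is 0 by compact support.\<close>

lemma weak_divergence_smooth:
  fixes M :: "real^'n \<Rightarrow> real^'n^'n" and N :: "'n \<Rightarrow> real^'n \<Rightarrow> real^'n^'n"
  assumes dM: "\<And>j k i. has_pd (\<lambda>x. M x $ k $ i) (\<lambda>x. N j x $ k $ i) (axis j 1)"
    and sym: "\<And>x i j k. N j x $ k $ i = N i x $ k $ j"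
    and \<phi>: "ccont \<phi>" "\<And>j. has_pd \<phi> (\<lambda>x. D x $ j) (axis j 1)"
  shows "integral UNIV (\<lambda>x. \<Sum>j\<in>UNIV. NT l (M x) $ j $ i * D x $ j) = 0"
proof -
  have cM: "continuous_on UNIV M"
    using dM unfolding has_pd_def by (intro continuous_on_matrix) auto
  have cN: "continuous_on UNIV (N j)" for j
    using dM unfolding has_pd_def by (intro continuous_on_matrix) auto
  have T: "has_pd (\<lambda>x. NT l (M x) $ j $ i) (\<lambda>x. dNT l (M x) (N j x) $ j $ i) (axis j 1)" for j
    unfolding has_pd_def
  proof (intro conjI allI)
    show "continuous_on UNIV (\<lambda>x. NT l (M x) $ j $ i)"
      by (intro continuous_on_component continuous_on_NT cM)
    show "continuous_on UNIV (\<lambda>x. dNT l (M x) (N j x) $ j $ i)"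
      by (intro continuous_on_component continuous_on_dNT cM cN)
    fix x
    have "((\<lambda>t. M (x + t *\<^sub>R axis j 1)) has_vector_derivative N j x) (at 0)"
      by (rule has_vector_derivative_matrix) (use dM in \<open>auto simp: has_pd_def\<close>)
    from has_vector_derivative_NT[OF this, of l]
    have "((\<lambda>t. NT l (M (x + t *\<^sub>R axis j 1))) has_vector_derivative dNT l (M x) (N j x)) (at 0)" by simp
    from bounded_linear.has_vector_derivative[OF bounded_linear_vec_nth bounded_linear.has_vector_derivative[OF bounded_linear_vec_nth this]]
    show "((\<lambda>t. NT l (M (x + t *\<^sub>R axis j 1)) $ j $ i) has_real_derivative dNT l (M x) (N j x) $ j $ i) (at 0)"
      by (simp add: has_real_derivative_iff_has_vector_derivative)
  qed
  have g: "ccont (\<lambda>x. \<phi> x * NT l (M x) $ j $ i)" for j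
    by (intro ccont_mult \<phi> continuous_on_component continuous_on_NT cM)
  note pd = has_pd_ccont[OF g has_pd_mult[OF \<phi>(2) T]]
  have "integral UNIV (\<lambda>x. \<Sum>j\<in>UNIV. D x $ j * NT l (M x) $ j $ i + dNT l (M x) (N j x) $ j $ i * \<phi> x) = 0"
    using pd by (subst integral_sum) (auto intro: ccont_integrable)
  moreover have "(\<Sum>j\<in>UNIV. D x $ j * NT l (M x) $ j $ i + dNT l (M x) (N j x) $ j $ i * \<phi> x)
     = (\<Sum>j\<in>UNIV. NT l (M x) $ j $ i * D x $ j)" for x
    using NT_divergence_free[of "\<lambda>j. N j x" l "M x" i] sym
    by (simp add: sum.distrib mult.commute flip: sum_distrib_left)
  ultimately show ?thesis by simp
qed

text \<open>For \<open>r \<noteq> 0\<close> the mollified matrix field \<open>A r\<close> has symmetric first derivatives, because both of them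
  can be moved to the kernel; \<open>r \<rightarrow> 0\<close> is a continuity argument, as \<open>A 0 = M\<close>.\<close>

theorem weak_divergence_NT:
  fixes V :: "real^'n \<Rightarrow> real^'n" and M :: "real^'n \<Rightarrow> real^'n^'n"
  assumes V: "\<And>x. (V has_derivative (\<lambda>h. M x *v h)) (at x)" and cM: "continuous_on UNIV M"
    and \<phi>: "ccont \<phi>" "\<And>x. (\<phi> has_derivative (\<lambda>h. D x \<bullet> h)) (at x)" "continuous_on UNIV D"
  shows "integral UNIV (\<lambda>x. \<Sum>j\<in>UNIV. NT l (M x) $ j $ i * D x $ j) = 0"
proof -
  obtain \<rho> :: "real^'n \<Rightarrow> real" and \<rho>' \<rho>'' where \<rho>: "ccont \<rho>" "integral UNIV \<rho> > 0"
    "\<And>i. ccont (\<rho>' i)" "\<And>i. has_pd \<rho> (\<rho>' i) (axis i 1)"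
    "\<And>i j. has_pd (\<rho>' i) (\<rho>'' i j) (axis j 1)" "\<And>i j. \<rho>'' i j = \<rho>'' j i"
    using twice_differentiable_kernel by metis
  define I where "I = integral UNIV \<rho>"
  have I: "I > 0" using \<rho>(2) by (simp add: I_def)
  have cMe: "continuous_on UNIV (\<lambda>x. M x $ k $ i)" for k i by (intro continuous_on_component cM)
  have pdV: "has_pd (\<lambda>x. V x $ k) (\<lambda>x. M x $ k $ j) (axis j 1)" for k j
  proof -
    have "((\<lambda>x. V x $ k) has_derivative (\<lambda>h. M x $ k \<bullet> h)) (at x)" for x
      using bounded_linear.has_derivative[OF bounded_linear_vec_nth V, of k]
      by (simp add: matrix_vector_mul_component)
    from has_pd_gradient[OF this, of "axis j 1"] show ?thesis
      by (simp add: inner_axis continuous_on_component cM)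
  qed
  define A where "A = (\<lambda>r x. (\<chi> k i. integral UNIV (\<lambda>y. \<rho> y * M (x + r *\<^sub>R y) $ k $ i) / I) :: real^'n^'n)"
  define G where "G = (\<lambda>r. integral UNIV (\<lambda>x. \<Sum>j\<in>UNIV. NT l (A r x) $ j $ i * D x $ j))"
  have A0: "A 0 x = M x" for x
    using I by (simp add: A_def vec_eq_iff I_def)
  have pdD: "has_pd \<phi> (\<lambda>x. D x $ j) (axis j 1)" for j
    using has_pd_gradient[OF \<phi>(2,3), of "axis j 1"] by (simp add: inner_axis)
  have zero: "G r = 0" if r: "r \<noteq> 0" for r
    unfolding G_def
  proof (rule weak_divergence_smooth[OF _ _ \<phi>(1) pdD])
    define N where "N = (\<lambda>j x. (\<chi> k i. - integral UNIV (\<lambda>y. \<rho>' i y * M (x + r *\<^sub>R y) $ k $ j) / r / I) :: real^'n^'n)"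
    \<comment> \<open>As \<open>M\<close> is the Jacobian of \<open>V\<close>, its mollification can
      be written with a derivative on the kernel and \<open>V\<close> in place of \<open>M\<close>.
      This makes it differentiable although \<open>M\<close> is only continuous.\<close>
    have Ae: "A r x $ k $ i = (- 1 / r / I) * integral UNIV (\<lambda>y. \<rho>' i y * V (x + r *\<^sub>R y) $ k)" for x k i
      unfolding A_def using convolution_by_parts[OF \<rho>(1) \<rho>(4) pdV r] by simp
    show "has_pd (\<lambda>x. A r x $ k $ i) (\<lambda>x. N j x $ k $ i) (axis j 1)" for j k i
    proof -
      have "has_pd (\<lambda>x. integral UNIV (\<lambda>y. \<rho>' i y * V (x + r *\<^sub>R y) $ k))
          (\<lambda>x. integral UNIV (\<lambda>y. \<rho>' i y * M (x + r *\<^sub>R y) $ k $ j)) (axis j 1)"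
        by (rule convolution_has_pd[OF \<rho>(3) pdV])
      then have "has_pd (\<lambda>x. (- 1 / r / I) * integral UNIV (\<lambda>y. \<rho>' i y * V (x + r *\<^sub>R y) $ k))
          (\<lambda>x. (- 1 / r / I) * integral UNIV (\<lambda>y. \<rho>' i y * M (x + r *\<^sub>R y) $ k $ j)) (axis j 1)"
        by (rule has_pd_cmult)
      then show ?thesis unfolding Ae by (simp add: N_def)
    qed
    \<comment> \<open>A second integration by parts expresses both sides through the same mixed
      second derivative of the kernel.\<close>
    show "N j x $ k $ i = N i x $ k $ j" for x i j k
      unfolding N_def using convolution_by_parts[OF \<rho>(3) \<rho>(5) pdV r] \<rho>(6)[of i j] by simp
  qed
  have contA: "continuous_on UNIV (\<lambda>z. A (fst z) (snd z))"
  proof -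
    have "continuous_on UNIV (\<lambda>z. A (fst z) (snd z) $ k $ i)" for k i
      using convolution_continuous[OF \<rho>(1) cMe, of k i] I
      by (auto simp: A_def case_prod_unfold intro!: continuous_intros)
    then show ?thesis by (rule continuous_on_matrix)
  qed
  have cs: "ccont (\<lambda>x. \<Sum>j\<in>UNIV. \<bar>D x $ j\<bar>)"
    by (intro ccont_sum ccont_abs has_pd_ccont(1)[OF \<phi>(1) pdD])
  obtain a where a: "\<And>x. x \<notin> cbox (-a) a \<Longrightarrow> (\<Sum>j\<in>UNIV. \<bar>D x $ j\<bar>) = 0"
    using ccont_cbox[OF cs] by blast
  have D0: "D x $ j = 0" if "x \<notin> cbox (-a) a" for x j
    using a[OF that] by (simp add: sum_nonneg_eq_0_iff)
  have cz: "continuous_on UNIV (\<lambda>z. \<Sum>j\<in>UNIV. NT l (A (fst z) (snd z)) $ j $ i * D (snd z) $ j)"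
    by (intro continuous_intros continuous_on_component continuous_on_NT contA continuous_on_compose2[OF \<phi>(3)]) auto
  have Gbox: "G r = integral (cbox (-a) a) (\<lambda>x. \<Sum>j\<in>UNIV. NT l (A r x) $ j $ i * D x $ j)" for r
    unfolding G_def
  proof (rule ccont_integral_cbox)
    have "continuous_on UNIV (\<lambda>x. (r, x))" by (intro continuous_intros)
    from continuous_on_compose2[OF cz this]
    show "continuous_on UNIV (\<lambda>x. \<Sum>j\<in>UNIV. NT l (A r x) $ j $ i * D x $ j)" by simp
  qed (simp add: D0)
  have "continuous_on UNIV G"
    unfolding Gbox[abs_def]
    by (rule integral_continuous_on_param) (auto simp: case_prod_unfold intro: continuous_on_subset[OF cz])
  then have "(G \<longlongrightarrow> G 0) (at 0)" by (simp add: continuous_on_def)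
  moreover have "(G \<longlongrightarrow> 0) (at 0)"
    by (rule tendsto_eventually) (auto simp: eventually_at_filter zero)
  ultimately have "G 0 = 0" by (metis LIM_unique)
  then show ?thesis by (simp add: G_def A0)
qed

section \<open>The divergence identity\<close>

lemma NT_commute: "M ** NT l M = NT l M ** M"
proof (induction l)
  case (Suc l)
  have "M ** NT (Suc l) M = sg (Suc l) M *\<^sub>R M - (M ** NT l M) ** M"
    unfolding NT_Suc by (simp add: mmult_simps matrix_mul_assoc)
  also have "\<dots> = NT (Suc l) M ** M"
    unfolding NT_Suc Suc by (simp add: mmult_simps)
  finally show ?case .
qed simp

lemma has_derivative_supported:
  fixes f :: "'a::euclidean_space \<Rightarrow> 'b::real_normed_vector"
  assumes "\<And>x. x \<in> \<Omega> \<Longrightarrow> (f has_derivative f' x) (at x)" "compact K" "K \<subseteq> \<Omega>"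
    "\<And>x. x \<notin> K \<Longrightarrow> f x = 0" "\<And>x. x \<notin> K \<Longrightarrow> f' x = (\<lambda>h. 0)"
  shows "(f has_derivative f' x) (at x)"
proof (cases "x \<in> K")
  case True
  then show ?thesis using assms(1,3) by blast
next
  case False
  have "open (- K)" using assms(2) by (simp add: compact_imp_closed open_Compl)
  then have "(f has_derivative (\<lambda>h. 0)) (at x)"
    by (rule has_derivative_transform_within_open[OF has_derivative_const]) (use False assms(4) in auto)
  then show ?thesis using assms(5)[OF False] by simp
qed

lemma cutoff_times_derivative:
  assumes \<Omega>: "open \<Omega>" and \<theta>: "cutoff \<Omega> \<theta> D\<theta>"
    and h: "\<And>x. x \<in> \<Omega> \<Longrightarrow> (h has_derivative (\<lambda>v. Dh x \<bullet> v)) (at x)" and c: "continuous_on \<Omega> Dh"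
  shows "((\<lambda>x. \<theta> x * h x) has_derivative (\<lambda>v. (\<theta> x *\<^sub>R Dh x + h x *\<^sub>R D\<theta> x) \<bullet> v)) (at x)"
    and "continuous_on UNIV (\<lambda>x. \<theta> x *\<^sub>R Dh x + h x *\<^sub>R D\<theta> x)"
    and "ccont (\<lambda>x. \<theta> x * h x)"
proof -
  obtain K where K: "compact K" "K \<subseteq> \<Omega>" "\<And>x. x \<notin> K \<Longrightarrow> \<theta> x = 0 \<and> D\<theta> x = 0"
    using \<theta> unfolding cutoff_def by metis
  have ch: "continuous_on \<Omega> h"
    using h \<Omega> by (meson continuous_at_imp_continuous_on has_derivative_continuous)
  have cD: "continuous_on \<Omega> D\<theta>" using \<theta> continuous_on_subset unfolding cutoff_def by blast
  show "((\<lambda>x. \<theta> x * h x) has_derivative (\<lambda>v. (\<theta> x *\<^sub>R Dh x + h x *\<^sub>R D\<theta> x) \<bullet> v)) (at x)"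
  proof (rule has_derivative_supported[where K = K and \<Omega> = \<Omega>])
    fix x assume "x \<in> \<Omega>"
    from h[OF this] show "((\<lambda>x. \<theta> x * h x) has_derivative (\<lambda>v. (\<theta> x *\<^sub>R Dh x + h x *\<^sub>R D\<theta> x) \<bullet> v)) (at x)"
      using \<theta> unfolding cutoff_def by (auto intro!: derivative_eq_intros simp: inner_add_left mult.commute)
  qed (use K in auto)
  show "continuous_on UNIV (\<lambda>x. \<theta> x *\<^sub>R Dh x + h x *\<^sub>R D\<theta> x)"
    by (rule continuous_on_UNIV_supported[OF \<Omega> _ K(1,2)])
      (use K(3) in \<open>auto intro!: continuous_intros c ch cD cutoff_continuous[OF \<theta>]\<close>)
  show "ccont (\<lambda>x. \<theta> x * h x)" by (rule ccont_cutoff[OF \<Omega> \<theta> ch])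
qed

lemma C2_with_continuous:
  assumes "open \<Omega>" "C2_with \<Omega> u Du H"
  shows "continuous_on \<Omega> u" "continuous_on \<Omega> Du" "continuous_on \<Omega> H"
  using assms unfolding C2_with_def
  by (auto intro!: continuous_at_imp_continuous_on intro: has_derivative_continuous)

lemma C2_with_symmetric:
  assumes "open \<Omega>" "C2_with \<Omega> u Du H" "x \<in> \<Omega>"
  shows "transpose (H x) = H x"
  using assms second_derivative_matrix_symmetric[of \<Omega> x u Du H] unfolding C2_with_def by blast

text \<open>The weak identity for index \<open>i\<close> is tested with \<theta> h times the i-th
  component of \<open>Du\<close>, a C^1 function since \<open>u\<close> is C^2; summing over
  \<open>i\<close> produces the trace of \<open>NT l H ** H\<close>, which is (l+1) S_(l+1). The
  free function \<open>h\<close> is later a power of 1 - u or of \<open>rho Du\<close>.\<close>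

lemma divergence_identity:
  fixes u :: "real^'n \<Rightarrow> real"
  assumes \<Omega>: "open \<Omega>" and u: "C2_with \<Omega> u Du H" and \<theta>: "cutoff \<Omega> \<theta> D\<theta>"
    and h: "\<And>x. x \<in> \<Omega> \<Longrightarrow> (h has_derivative (\<lambda>v. Dh x \<bullet> v)) (at x)" and cDh: "continuous_on \<Omega> Dh"
  shows "integral UNIV (\<lambda>x. \<theta> x * h x * (real (Suc l) * sg (Suc l) (H x))
      + (\<theta> x *\<^sub>R Dh x + h x *\<^sub>R D\<theta> x) \<bullet> (NT l (H x) *v Du x)) = 0" (is ?A)
    and "ccont (\<lambda>x. \<theta> x * h x * (real (Suc l) * sg (Suc l) (H x))
      + (\<theta> x *\<^sub>R Dh x + h x *\<^sub>R D\<theta> x) \<bullet> (NT l (H x) *v Du x))" (is ?B)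
proof -
  obtain K where K: "compact K" "K \<subseteq> \<Omega>" "\<And>x. x \<notin> K \<Longrightarrow> \<theta> x = 0 \<and> D\<theta> x = 0"
    using \<theta> unfolding cutoff_def by metis
  obtain \<tau> D\<tau> U where \<tau>: "cutoff \<Omega> \<tau> D\<tau>" and U: "open U" "K \<subseteq> U" "\<And>x. x \<in> U \<Longrightarrow> \<tau> x = 1 \<and> D\<tau> x = 0"
    using cutoff_plateau[OF \<Omega> K(1,2)] by metis
  obtain L where L: "compact L" "L \<subseteq> \<Omega>" "\<And>x. x \<notin> L \<Longrightarrow> \<tau> x = 0 \<and> D\<tau> x = 0"
    using \<tau> unfolding cutoff_def by metis
  have c: "continuous_on \<Omega> u" "continuous_on \<Omega> Du" "continuous_on \<Omega> H"
    using C2_with_continuous[OF \<Omega> u] by auto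
  have dDu: "(Du has_derivative (\<lambda>h. H x *v h)) (at x)" if "x \<in> \<Omega>" for x
    using u that unfolding C2_with_def by blast
  \<comment> \<open>\<tau> is 1 near the support of \<theta>, so the global Jacobian
    \<open>M\<close> agrees with \<open>H\<close> wherever the test functions live. Elsewhere the
    term from the derivative of \<tau> may destroy its symmetry, which
    \<open>weak_divergence_NT\<close> tolerates.\<close>
  define V where "V = (\<lambda>x. \<tau> x *\<^sub>R Du x)"
  define M where "M = (\<lambda>x. (\<chi> i j. \<tau> x * H x $ i $ j + Du x $ i * D\<tau> x $ j) :: real^'n^'n)"
  have M: "M x *v h = \<tau> x *\<^sub>R (H x *v h) + (D\<tau> x \<bullet> h) *\<^sub>R Du x" for x h
    by (simp add: vec_eq_iff M_def matrix_vector_mult_def inner_vec_def sum.distrib sum_distrib_left sum_distrib_right algebra_simps)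
  have dV: "(V has_derivative (\<lambda>h. M x *v h)) (at x)" for x
  proof (rule has_derivative_supported[where K = L and \<Omega> = \<Omega>])
    fix x assume "x \<in> \<Omega>"
    from dDu[OF this] show "(V has_derivative (\<lambda>h. M x *v h)) (at x)"
      unfolding V_def M using \<tau> unfolding cutoff_def by (auto intro!: derivative_eq_intros)
  next
    fix x assume "x \<notin> L"
    then show "V x = 0" "(\<lambda>h. M x *v h) = (\<lambda>h. 0)" using L(3) unfolding V_def M by auto
  qed (use L in auto)
  have cM: "continuous_on UNIV M"
  proof (rule continuous_on_UNIV_supported[OF \<Omega> _ L(1,2)])
    have "continuous_on \<Omega> D\<tau>" using \<tau> continuous_on_subset unfolding cutoff_def by blast
    then show "continuous_on \<Omega> M" unfolding M_def
      by (intro continuous_on_vec_lambda continuous_intros continuous_on_component c cutoff_continuous[OF \<tau>])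
    show "M x = 0" if "x \<notin> L" for x using L(3)[OF that] by (simp add: M_def vec_eq_iff)
  qed
  define f where "f = (\<lambda>x. \<theta> x * h x)"
  define Df where "Df = (\<lambda>x. \<theta> x *\<^sub>R Dh x + h x *\<^sub>R D\<theta> x)"
  define DD where "DD = (\<lambda>i x. \<theta> x *\<^sub>R (Du x $ i *\<^sub>R Dh x + h x *\<^sub>R H x $ i) + (h x * Du x $ i) *\<^sub>R D\<theta> x)"
  have DD: "DD i x = Du x $ i *\<^sub>R Df x + f x *\<^sub>R H x $ i" for i x
    by (simp add: DD_def Df_def f_def algebra_simps)
  have hi: "((\<lambda>x. h x * Du x $ i) has_derivative (\<lambda>v. (Du x $ i *\<^sub>R Dh x + h x *\<^sub>R H x $ i) \<bullet> v)) (at x)"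
    if x: "x \<in> \<Omega>" for x i
  proof -
    have "((\<lambda>x. Du x $ i) has_derivative (\<lambda>v. H x $ i \<bullet> v)) (at x)"
      using bounded_linear.has_derivative[OF bounded_linear_vec_nth dDu[OF x], of i]
      by (simp add: matrix_vector_mul_component)
    from has_derivative_mult[OF h[OF x] this]
    show ?thesis by (simp add: inner_add_left algebra_simps)
  qed
  have ch: "continuous_on \<Omega> h"
    using h \<Omega> by (meson continuous_at_imp_continuous_on has_derivative_continuous)
  have ci: "continuous_on \<Omega> (\<lambda>x. Du x $ i *\<^sub>R Dh x + h x *\<^sub>R H x $ i)" for i
    by (intro continuous_intros continuous_on_component c cDh ch)
  note test = cutoff_times_derivative[OF \<Omega> \<theta> hi ci]
  have zero: "integral UNIV (\<lambda>x. \<Sum>j\<in>UNIV. NT l (M x) $ j $ i * DD i x $ j) = 0" for i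
  proof (rule weak_divergence_NT[OF dV cM])
    show "ccont (\<lambda>x. \<theta> x * (h x * Du x $ i))" by (rule test(3))
    show "((\<lambda>x. \<theta> x * (h x * Du x $ i)) has_derivative (\<lambda>v. DD i x \<bullet> v)) (at x)" for x
      unfolding DD_def by (rule test(1))
    show "continuous_on UNIV (DD i)" unfolding DD_def by (rule test(2))
  qed
  have cc: "ccont (\<lambda>x. \<Sum>j\<in>UNIV. NT l (M x) $ j $ i * DD i x $ j)" for i
  proof (rule ccontI[OF _ K(1)])
    show "continuous_on UNIV (\<lambda>x. \<Sum>j\<in>UNIV. NT l (M x) $ j $ i * DD i x $ j)"
      using test(2)[of i] by (intro continuous_intros continuous_on_component continuous_on_NT cM) (simp add: DD_def)
    show "(\<Sum>j\<in>UNIV. NT l (M x) $ j $ i * DD i x $ j) = 0" if "x \<notin> K" for x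
      using K(3)[OF that] by (simp add: DD_def)
  qed
  have "integral UNIV (\<lambda>x. \<Sum>i\<in>UNIV. \<Sum>j\<in>UNIV. NT l (M x) $ j $ i * DD i x $ j) = 0"
    using zero cc by (subst integral_sum) (auto intro: ccont_integrable)
  moreover have "ccont (\<lambda>x. \<Sum>i\<in>UNIV. \<Sum>j\<in>UNIV. NT l (M x) $ j $ i * DD i x $ j)"
    by (rule ccont_sum[OF cc])
  moreover have "(\<Sum>i\<in>UNIV. \<Sum>j\<in>UNIV. NT l (M x) $ j $ i * DD i x $ j)
     = f x * (real (Suc l) * sg (Suc l) (H x)) + Df x \<bullet> (NT l (H x) *v Du x)" for x
  proof (cases "x \<in> K")
    case False
    then show ?thesis using K(3)[OF False] by (simp add: DD_def f_def Df_def)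
  next
    case True
    then have "M x = H x" using U by (simp add: M_def vec_eq_iff subset_iff)
    then have "(\<Sum>i\<in>UNIV. \<Sum>j\<in>UNIV. NT l (M x) $ j $ i * DD i x $ j)
       = (\<Sum>i\<in>UNIV. \<Sum>j\<in>UNIV. Df x $ j * (NT l (H x) $ j $ i * Du x $ i))
       + f x * (\<Sum>i\<in>UNIV. \<Sum>j\<in>UNIV. NT l (H x) $ j $ i * H x $ i $ j)"
      by (simp add: DD sum.distrib sum_distrib_left algebra_simps)
    also have "(\<Sum>i\<in>UNIV. \<Sum>j\<in>UNIV. Df x $ j * (NT l (H x) $ j $ i * Du x $ i)) = Df x \<bullet> (NT l (H x) *v Du x)"
      by (subst sum.swap) (simp add: inner_vec_def matrix_vector_mult_def sum_distrib_left)
    also have "(\<Sum>i\<in>UNIV. \<Sum>j\<in>UNIV. NT l (H x) $ j $ i * H x $ i $ j) = trace (NT l (H x) ** H x)"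
      by (subst sum.swap) (simp add: trace_def matrix_matrix_mult_def)
    finally show ?thesis by (simp add: trace_NT_mult)
  qed
  ultimately show ?A ?B by (simp_all add: f_def Df_def)
qed

section \<open>Locally bounded families\<close>

text \<open>The normalised class over which all constants are uniform. Homogeneity in
  \<open>u\<close> recovers the general estimate at the end.\<close>

definition adm :: "nat \<Rightarrow> (real^'n) set \<Rightarrow> (real^'n \<Rightarrow> real) \<Rightarrow> (real^'n \<Rightarrow> real^'n) \<Rightarrow> (real^'n \<Rightarrow> real^'n^'n) \<Rightarrow> bool" where
  "adm k \<Omega> u Du H \<longleftrightarrow> C2_with \<Omega> u Du H \<and> PhiK k \<Omega> H \<and> (\<forall>x\<in>\<Omega>. u x \<le> 0) \<and>
     (\<lambda>x. \<bar>u x\<bar>) integrable_on \<Omega> \<and> integral \<Omega> (\<lambda>x. \<bar>u x\<bar>) \<le> 1"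

type_synonym 'n family = "(real^'n \<Rightarrow> real) \<Rightarrow> (real^'n \<Rightarrow> real^'n) \<Rightarrow> (real^'n \<Rightarrow> real^'n^'n) \<Rightarrow> real^'n \<Rightarrow> real"

text \<open>Off \<open>\<Omega>\<close> the members of a family are arbitrary, but there \<open>\<eta>\<close> vanishes.\<close>

definition locbd :: "nat \<Rightarrow> (real^'n) set \<Rightarrow> 'n family \<Rightarrow> bool" where
  "locbd k \<Omega> F \<longleftrightarrow> (\<forall>\<eta> D\<eta>. cutoff \<Omega> \<eta> D\<eta> \<longrightarrow>
     (\<exists>C. \<forall>u Du H. adm k \<Omega> u Du H \<longrightarrow> integral UNIV (\<lambda>x. \<eta> x * F u Du H x) \<le> C))"

text \<open>The summand 1 makes real powers, including negative ones, differentiable at critical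
  points of \<open>u\<close>.\<close>

definition rho :: "(real^'n \<Rightarrow> real^'n) \<Rightarrow> real^'n \<Rightarrow> real" where
  "rho Du x = 1 + (norm (Du x))\<^sup>2"

lemma rho_ge_1: "1 \<le> rho Du x"
  by (simp add: rho_def)

lemma rho_pos: "0 < rho Du x"
  using rho_ge_1[of Du x] by linarith

lemma norm_le_sqrt_rho: "norm (Du x) \<le> rho Du x powr (1 / 2)"
proof -
  have "norm (Du x) = sqrt ((norm (Du x))\<^sup>2)" by simp
  also have "\<dots> \<le> sqrt (rho Du x)" by (intro real_sqrt_le_mono) (simp add: rho_def)
  finally show ?thesis using rho_pos[of Du x] by (simp add: powr_half_sqrt)
qed

lemma adm_facts:
  assumes \<Omega>: "open \<Omega>" and u: "adm k \<Omega> u Du H"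
  shows "C2_with \<Omega> u Du H"
    and "x \<in> \<Omega> \<Longrightarrow> transpose (H x) = H x"
    and "x \<in> \<Omega> \<Longrightarrow> j \<le> k \<Longrightarrow> 0 \<le> sg j (H x)"
    and "x \<in> \<Omega> \<Longrightarrow> u x \<le> 0"
    and "x \<in> \<Omega> \<Longrightarrow> (u has_derivative (\<lambda>h. Du x \<bullet> h)) (at x)"
    and "x \<in> \<Omega> \<Longrightarrow> (Du has_derivative (\<lambda>h. H x *v h)) (at x)"
proof -
  show C2: "C2_with \<Omega> u Du H" using u by (simp add: adm_def)
  show sym: "transpose (H x) = H x" if "x \<in> \<Omega>" by (rule C2_with_symmetric[OF \<Omega> C2 that])
  show "0 \<le> sg j (H x)" if "x \<in> \<Omega>" "j \<le> k"
  proof (cases "j = 0")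
    case False
    then have "0 \<le> Fk j H x" using u that by (auto simp: adm_def PhiK_def)
    then show ?thesis by (simp add: Fk_sg[of H x, OF sym[OF that(1)]])
  qed simp
  show "u x \<le> 0" if "x \<in> \<Omega>" using u that by (simp add: adm_def)
  show "(u has_derivative (\<lambda>h. Du x \<bullet> h)) (at x)" if "x \<in> \<Omega>" using C2 that by (simp add: C2_with_def)
  show "(Du has_derivative (\<lambda>h. H x *v h)) (at x)" if "x \<in> \<Omega>" using C2 that by (simp add: C2_with_def)
qed

lemma adm_continuous:
  assumes \<Omega>: "open \<Omega>" and u: "adm k \<Omega> u Du H"
  shows "continuous_on \<Omega> u" "continuous_on \<Omega> Du" "continuous_on \<Omega> H"
    and "continuous_on \<Omega> (\<lambda>x. (1 - u x) powr a)"
    and "continuous_on \<Omega> (\<lambda>x. rho Du x powr a)"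
    and "continuous_on \<Omega> (\<lambda>x. sg j (H x))"
proof -
  show c: "continuous_on \<Omega> u" "continuous_on \<Omega> Du" "continuous_on \<Omega> H"
    using C2_with_continuous[OF \<Omega> adm_facts(1)[OF \<Omega> u]] by auto
  have "1 - u x \<noteq> 0" if "x \<in> \<Omega>" for x using adm_facts(4)[OF \<Omega> u that] by simp
  then show "continuous_on \<Omega> (\<lambda>x. (1 - u x) powr a)" by (intro continuous_intros c) auto
  have "continuous_on \<Omega> (\<lambda>x. rho Du x)" unfolding rho_def by (intro continuous_intros c)
  then show "continuous_on \<Omega> (\<lambda>x. rho Du x powr a)"
    by (intro continuous_on_powr continuous_on_const) (auto simp: rho_pos less_imp_neq[symmetric])
  show "continuous_on \<Omega> (\<lambda>x. sg j (H x))" by (rule continuous_on_sg[OF c(3)])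
qed

text \<open>Stated in the exact shapes of the integrands below, so that continuity side conditions
  close by a single rule application.\<close>

lemma adm_continuous_forms:
  assumes \<Omega>: "open \<Omega>" and u: "adm k \<Omega> u Du H"
  shows "continuous_on \<Omega> (\<lambda>x. - u x)"
    and "continuous_on \<Omega> (\<lambda>x. (1 - u x) powr a)"
    and "continuous_on \<Omega> (\<lambda>x. rho Du x powr a)"
    and "continuous_on \<Omega> (\<lambda>x. (1 - u x) powr a * (norm (Du x))\<^sup>2)"
    and "continuous_on \<Omega> (\<lambda>x. (c * (1 - u x) powr a) *\<^sub>R Du x)"
    and "continuous_on \<Omega> (\<lambda>x. norm ((c * (1 - u x) powr a) *\<^sub>R Du x))"
    and "continuous_on \<Omega> (\<lambda>x. rho Du x powr a * sg j (H x))"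
    and "continuous_on \<Omega> (\<lambda>x. (c * rho Du x powr a) *\<^sub>R (H x *v Du x))"
    and "continuous_on \<Omega> (\<lambda>x. norm ((c * rho Du x powr a) *\<^sub>R (H x *v Du x)))"
proof -
  note c = adm_continuous[OF \<Omega> u]
  have Hv: "continuous_on \<Omega> (\<lambda>x. H x *v Du x)"
    unfolding matrix_vector_mult_def
    by (intro continuous_on_vec_lambda continuous_intros continuous_on_component c(2,3))
  show "continuous_on \<Omega> (\<lambda>x. - u x)" by (intro continuous_on_minus c)
  show "continuous_on \<Omega> (\<lambda>x. (1 - u x) powr a)" "continuous_on \<Omega> (\<lambda>x. rho Du x powr a)" by (rule c)+
  show "continuous_on \<Omega> (\<lambda>x. (1 - u x) powr a * (norm (Du x))\<^sup>2)"
    by (intro continuous_on_mult continuous_on_power continuous_on_norm c)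
  show 1: "continuous_on \<Omega> (\<lambda>x. (c * (1 - u x) powr a) *\<^sub>R Du x)"
    by (intro continuous_on_scaleR continuous_on_mult continuous_on_const c)
  show "continuous_on \<Omega> (\<lambda>x. norm ((c * (1 - u x) powr a) *\<^sub>R Du x))" by (rule continuous_on_norm[OF 1])
  show "continuous_on \<Omega> (\<lambda>x. rho Du x powr a * sg j (H x))" by (intro continuous_on_mult c)
  show 2: "continuous_on \<Omega> (\<lambda>x. (c * rho Du x powr a) *\<^sub>R (H x *v Du x))"
    by (intro continuous_on_scaleR continuous_on_mult continuous_on_const c Hv)
  show "continuous_on \<Omega> (\<lambda>x. norm ((c * rho Du x powr a) *\<^sub>R (H x *v Du x)))" by (rule continuous_on_norm[OF 2])
qed

lemma cutoff_pointwise: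
  assumes "cutoff \<Omega> \<eta> D\<eta>" "\<And>x. x \<in> \<Omega> \<Longrightarrow> F x \<le> G x"
  shows "\<eta> x * F x \<le> \<eta> x * G x"
proof (cases "x \<in> \<Omega>")
  case True
  then show ?thesis using assms by (intro mult_left_mono) (auto simp: cutoff_def)
next
  case False
  then have "\<eta> x = 0" using assms(1) unfolding cutoff_def by blast
  then show ?thesis by simp
qed

lemma locbd_dom2:
  assumes \<Omega>: "open \<Omega>" and G: "locbd k \<Omega> G1" "locbd k \<Omega> G2" and c: "0 \<le> c"
    and cF: "\<And>u Du H. adm k \<Omega> u Du H \<Longrightarrow> continuous_on \<Omega> (F u Du H)"
    and cG1: "\<And>u Du H. adm k \<Omega> u Du H \<Longrightarrow> continuous_on \<Omega> (G1 u Du H)"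
    and cG2: "\<And>u Du H. adm k \<Omega> u Du H \<Longrightarrow> continuous_on \<Omega> (G2 u Du H)"
    and le: "\<And>u Du H x. adm k \<Omega> u Du H \<Longrightarrow> x \<in> \<Omega> \<Longrightarrow> F u Du H x \<le> c * (G1 u Du H x + G2 u Du H x)"
  shows "locbd k \<Omega> F"
  unfolding locbd_def
proof (intro allI impI)
  fix \<eta> D\<eta> assume \<eta>: "cutoff \<Omega> \<eta> D\<eta>"
  obtain C1 where C1: "\<And>u Du H. adm k \<Omega> u Du H \<Longrightarrow> integral UNIV (\<lambda>x. \<eta> x * G1 u Du H x) \<le> C1"
    using G(1) \<eta> unfolding locbd_def by blast
  obtain C2 where C2: "\<And>u Du H. adm k \<Omega> u Du H \<Longrightarrow> integral UNIV (\<lambda>x. \<eta> x * G2 u Du H x) \<le> C2"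
    using G(2) \<eta> unfolding locbd_def by blast
  have "integral UNIV (\<lambda>x. \<eta> x * F u Du H x) \<le> c * (C1 + C2)" if u: "adm k \<Omega> u Du H" for u Du H
  proof -
    note cc = ccont_cutoff[OF \<Omega> \<eta> cF[OF u]] ccont_cutoff[OF \<Omega> \<eta> cG1[OF u]] ccont_cutoff[OF \<Omega> \<eta> cG2[OF u]]
    have "integral UNIV (\<lambda>x. \<eta> x * F u Du H x) \<le> integral UNIV (\<lambda>x. c * (\<eta> x * G1 u Du H x + \<eta> x * G2 u Du H x))"
    proof (rule ccont_integral_le)
      show "\<eta> x * F u Du H x \<le> c * (\<eta> x * G1 u Du H x + \<eta> x * G2 u Du H x)" for x
        using cutoff_pointwise[where x = x, OF \<eta> le[OF u]] by (simp add: algebra_simps)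
    qed (intro cc ccont_cmult ccont_add)+
    also have "\<dots> = c * (integral UNIV (\<lambda>x. \<eta> x * G1 u Du H x) + integral UNIV (\<lambda>x. \<eta> x * G2 u Du H x))"
      using cc by (simp add: integral_add ccont_integrable)
    also have "\<dots> \<le> c * (C1 + C2)" using c C1[OF u] C2[OF u] by (intro mult_left_mono) auto
    finally show ?thesis .
  qed
  then show "\<exists>C. \<forall>u Du H. adm k \<Omega> u Du H \<longrightarrow> integral UNIV (\<lambda>x. \<eta> x * F u Du H x) \<le> C" by blast
qed

lemma locbd_0: "locbd k \<Omega> (\<lambda>u Du H x. 0)"
  unfolding locbd_def by (auto intro: exI[of _ 0])

lemma locbd_dom:
  assumes \<Omega>: "open \<Omega>" and G: "locbd k \<Omega> G" and c: "0 \<le> c"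
    and cF: "\<And>u Du H. adm k \<Omega> u Du H \<Longrightarrow> continuous_on \<Omega> (F u Du H)"
    and cG: "\<And>u Du H. adm k \<Omega> u Du H \<Longrightarrow> continuous_on \<Omega> (G u Du H)"
    and le: "\<And>u Du H x. adm k \<Omega> u Du H \<Longrightarrow> x \<in> \<Omega> \<Longrightarrow> F u Du H x \<le> c * G u Du H x"
  shows "locbd k \<Omega> F"
  by (rule locbd_dom2[OF \<Omega> G locbd_0 c cF cG]) (use le in auto)

lemma locbd_1: "locbd k \<Omega> (\<lambda>u Du H x. 1)"
  unfolding locbd_def by auto

text \<open>The source of all further bounds: here the normalisation of the integral of |u| enters,
  through the maximum of the cutoff.\<close>

lemma locbd_u:
  fixes \<Omega> :: "(real^'n) set"
  assumes \<Omega>: "open \<Omega>"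
  shows "locbd k \<Omega> (\<lambda>u Du H x. - u x)"
  unfolding locbd_def
proof (intro allI impI)
  fix \<eta> :: "real^'n \<Rightarrow> real" and D\<eta> assume \<eta>: "cutoff \<Omega> \<eta> D\<eta>"
  obtain K where K: "compact K" "K \<subseteq> \<Omega>" "\<And>x. x \<notin> K \<Longrightarrow> \<eta> x = 0 \<and> D\<eta> x = 0"
    using \<eta> unfolding cutoff_def by metis
  have "ccont \<eta>" by (rule ccontI[OF cutoff_continuous[OF \<eta>] K(1)]) (use K in auto)
  from ccont_bounded[OF this] obtain B where B: "0 \<le> B" "\<And>x. \<bar>\<eta> x\<bar> \<le> B" by blast
  have "integral UNIV (\<lambda>x. \<eta> x * - u x) \<le> B" if u: "adm k \<Omega> u Du H" for u Du H
  proof -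
    have un: "\<bar>u x\<bar> = - u x" if "x \<in> \<Omega>" for x using adm_facts(4)[OF \<Omega> u that] by simp
    have eq: "(\<lambda>x. \<eta> x * - u x) = (\<lambda>x. if x \<in> \<Omega> then \<eta> x * - u x else 0)"
      using K by (auto simp: fun_eq_iff)
    have "continuous_on \<Omega> (\<lambda>x. - u x)" by (rule adm_continuous_forms[OF \<Omega> u])
    then have "(\<lambda>x. \<eta> x * - u x) integrable_on UNIV"
      by (intro ccont_integrable ccont_cutoff[OF \<Omega> \<eta>])
    then have int: "(\<lambda>x. \<eta> x * - u x) integrable_on \<Omega>"
      by (subst (asm) eq) (simp only: integrable_restrict_UNIV)
    have "integral UNIV (\<lambda>x. \<eta> x * - u x) = integral \<Omega> (\<lambda>x. \<eta> x * - u x)"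
      by (subst eq) (rule integral_restrict_UNIV)
    also have "\<dots> \<le> integral \<Omega> (\<lambda>x. B * \<bar>u x\<bar>)"
    proof (rule integral_le[OF int])
      show "(\<lambda>x. B * \<bar>u x\<bar>) integrable_on \<Omega>" using u unfolding adm_def by (intro integrable_on_mult_right) auto
      fix x assume "x \<in> \<Omega>"
      then show "\<eta> x * - u x \<le> B * \<bar>u x\<bar>"
        unfolding un[OF \<open>x \<in> \<Omega>\<close>] using B(2)[of x] adm_facts(4)[OF \<Omega> u] by (intro mult_right_mono) auto
    qed
    also have "\<dots> \<le> B" using u B(1) by (simp add: adm_def mult_left_le)
    finally show ?thesis .
  qed
  then show "\<exists>C. \<forall>u Du H. adm k \<Omega> u Du H \<longrightarrow> integral UNIV (\<lambda>x. \<eta> x * - u x) \<le> C" by blast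
qed

lemma locbd_w:
  assumes \<Omega>: "open \<Omega>"
  shows "locbd k \<Omega> (\<lambda>u Du H x. (1 - u x) powr 1)"
proof (rule locbd_dom2[OF \<Omega> locbd_1 locbd_u[OF \<Omega>], of 1])
  show "(1 - u x) powr 1 \<le> 1 * (1 + - u x)" if "adm k \<Omega> u Du H" "x \<in> \<Omega>" for u Du H x
    using adm_facts(4)[OF \<Omega> that] by simp
qed ((rule adm_continuous_forms[OF \<Omega>], assumption) | simp)+

text \<open>Since \<theta> is at least 1 where \<eta> is nonzero, powers of \<theta> with exponent
  >= 1 still dominate \<eta>. This is needed when the cutoff is placed inside a power, as in
  Sobolev's inequality, or squared.\<close>

lemma cutoff_larger:
  fixes \<eta> :: "'a::euclidean_space \<Rightarrow> real"
  assumes \<Omega>: "open \<Omega>" and \<eta>: "cutoff \<Omega> \<eta> D\<eta>"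
  obtains \<theta> D\<theta> where "cutoff \<Omega> \<theta> D\<theta>" "\<And>x. \<eta> x \<le> \<theta> x" "\<And>x. \<eta> x \<noteq> 0 \<Longrightarrow> 1 \<le> \<theta> x"
proof -
  obtain K where K: "compact K" "K \<subseteq> \<Omega>" "\<And>x. x \<notin> K \<Longrightarrow> \<eta> x = 0 \<and> D\<eta> x = 0"
    using \<eta> unfolding cutoff_def by metis
  have "ccont \<eta>" by (rule ccontI[OF cutoff_continuous[OF \<eta>] K(1)]) (use K in auto)
  from ccont_bounded[OF this] obtain B where B: "0 \<le> B" "\<And>x. \<bar>\<eta> x\<bar> \<le> B" by blast
  obtain \<theta> D\<theta> where \<theta>: "cutoff \<Omega> \<theta> D\<theta>" "\<And>x. x \<in> K \<Longrightarrow> 1 + B \<le> \<theta> x"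
    using cutoff_exists[OF \<Omega> K(1,2)] by metis
  show ?thesis
  proof (rule that[OF \<theta>(1)])
    show "\<eta> x \<le> \<theta> x" for x
    proof (cases "x \<in> K")
      case True
      then show ?thesis using \<theta>(2)[OF True] B(2)[of x] by linarith
    next
      case False
      then show ?thesis using K(3)[OF False] \<theta>(1) by (simp add: cutoff_def)
    qed
    show "1 \<le> \<theta> x" if "\<eta> x \<noteq> 0" for x
    proof -
      have "x \<in> K" using that K(3) by blast
      then show ?thesis using \<theta>(2) B(1) by force
    qed
  qed
qed

text \<open>\<open>sobolev_bound\<close> is applied to \<theta> G. The gradient of this product is
  bounded by a cutoff \<zeta> times G + |DG|, and both integrals are controlled by
  hypothesis.\<close>

lemma locbd_sobolev:
  fixes \<Omega> :: "(real^'n) set"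
  assumes \<Omega>: "open \<Omega>" and p: "real CARD('n) \<le> p" "1 < p" and r: "1 < r" "(p - 1) * (r - 1) < 1"
    and dG: "\<And>u Du H x. adm k \<Omega> u Du H \<Longrightarrow> x \<in> \<Omega> \<Longrightarrow> (G u Du H has_derivative (\<lambda>h. DG u Du H x \<bullet> h)) (at x)"
    and cDG: "\<And>u Du H. adm k \<Omega> u Du H \<Longrightarrow> continuous_on \<Omega> (DG u Du H)"
    and G0: "\<And>u Du H x. adm k \<Omega> u Du H \<Longrightarrow> x \<in> \<Omega> \<Longrightarrow> 0 \<le> G u Du H x"
    and bG: "locbd k \<Omega> G" and bDG: "locbd k \<Omega> (\<lambda>u Du H x. norm (DG u Du H x))"
  shows "locbd k \<Omega> (\<lambda>u Du H x. G u Du H x powr r)"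
  unfolding locbd_def
proof (intro allI impI)
  fix \<eta> :: "real^'n \<Rightarrow> real" and D\<eta> assume \<eta>: "cutoff \<Omega> \<eta> D\<eta>"
  obtain \<theta> D\<theta> where \<theta>: "cutoff \<Omega> \<theta> D\<theta>" "\<And>x. \<eta> x \<le> \<theta> x" "\<And>x. \<eta> x \<noteq> 0 \<Longrightarrow> 1 \<le> \<theta> x"
    using cutoff_larger[OF \<Omega> \<eta>] by metis
  obtain \<zeta> D\<zeta> where \<zeta>: "cutoff \<Omega> \<zeta> D\<zeta>" "\<And>x. \<theta> x \<le> \<zeta> x" "\<And>x. norm (D\<theta> x) \<le> \<zeta> x"
    using cutoff_dominate[OF \<Omega> \<theta>(1)] by metis
  obtain K where K: "compact K" "K \<subseteq> \<Omega>" "\<And>x. x \<notin> K \<Longrightarrow> \<theta> x = 0 \<and> D\<theta> x = 0"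
    using \<theta>(1) unfolding cutoff_def by metis
  obtain a where a: "K \<subseteq> cbox (-a) a"
    using bounded_subset_cbox_symmetric[OF compact_imp_bounded[OF K(1)]] by metis
  have \<theta>0: "0 \<le> \<theta> x" for x using \<theta>(1) by (simp add: cutoff_def)
  have \<zeta>0: "0 \<le> \<zeta> x" for x using \<zeta>(1) by (simp add: cutoff_def)
  obtain B1 where B1: "\<And>u Du H. adm k \<Omega> u Du H \<Longrightarrow> integral UNIV (\<lambda>x. \<zeta> x * G u Du H x) \<le> B1"
    using bG \<zeta>(1) unfolding locbd_def by blast
  obtain B2 where B2: "\<And>u Du H. adm k \<Omega> u Du H \<Longrightarrow> integral UNIV (\<lambda>x. \<zeta> x * norm (DG u Du H x)) \<le> B2"
    using bDG \<zeta>(1) unfolding locbd_def by blast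
  \<comment> \<open>One number has to bound both the integral of \<open>g\<close> and that of its
    gradient norm; the maximum is taken because \<open>B2\<close> is not known to be
    nonnegative.\<close>
  define B where "B = max B1 (B1 + B2)"
  obtain C where C: "\<And>g Dg. (\<forall>x. (g has_derivative (\<lambda>h. Dg x \<bullet> h)) (at x)) \<Longrightarrow> continuous_on UNIV Dg \<Longrightarrow>
     (\<forall>x. 0 \<le> g x) \<Longrightarrow> (\<forall>x. x \<notin> cbox (-a) a \<longrightarrow> g x = 0 \<and> Dg x = 0) \<Longrightarrow>
     integral UNIV g \<le> B \<Longrightarrow> integral UNIV (\<lambda>x. norm (Dg x)) \<le> B \<Longrightarrow>
     integral UNIV (\<lambda>x. g x powr r) \<le> C"
    using sobolev_bound[of p r a B] p r by auto
  have "integral UNIV (\<lambda>x. \<eta> x * G u Du H x powr r) \<le> C" if u: "adm k \<Omega> u Du H" for u Du H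
  proof -
    let ?G = "G u Du H" and ?DG = "DG u Du H"
    define g where "g = (\<lambda>x. \<theta> x * ?G x)"
    define Dg where "Dg = (\<lambda>x. \<theta> x *\<^sub>R ?DG x + ?G x *\<^sub>R D\<theta> x)"
    note cut = cutoff_times_derivative[OF \<Omega> \<theta>(1) dG[OF u] cDG[OF u], folded g_def Dg_def]
    have cG: "continuous_on \<Omega> ?G"
      using dG[OF u] \<Omega> by (meson continuous_at_imp_continuous_on has_derivative_continuous)
    have cG': "ccont (\<lambda>x. \<zeta> x * ?G x)" "ccont (\<lambda>x. \<zeta> x * norm (?DG x))" "ccont (\<lambda>x. \<eta> x * ?G x powr r)"
      using G0[OF u] r by (auto intro!: ccont_cutoff[OF \<Omega> \<zeta>(1)] ccont_cutoff[OF \<Omega> \<eta>] cG continuous_intros cDG[OF u] continuous_on_powr')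
    have outside: "\<theta> x = 0" "\<zeta> x = 0" "\<eta> x = 0" "D\<theta> x = 0" if "x \<notin> \<Omega>" for x
      using that \<theta>(1) \<zeta>(1) \<eta> unfolding cutoff_def by blast+
    have g0: "0 \<le> g x" for x
      using G0[OF u, of x] \<theta>0[of x] outside(1)[of x] by (cases "x \<in> \<Omega>") (auto simp: g_def)
    have zero: "g x = 0 \<and> Dg x = 0" if "x \<notin> cbox (-a) a" for x
    proof -
      have "x \<notin> K" using that a by blast
      then show ?thesis using K(3) by (simp add: g_def Dg_def)
    qed
    have cn: "ccont (\<lambda>x. norm (Dg x))"
      by (rule ccontI[OF _ compact_cbox[of "-a" a]]) (use zero in \<open>auto intro!: continuous_intros cut(2)\<close>)
    have i1: "integral UNIV g \<le> B1"
    proof -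
      have "integral UNIV g \<le> integral UNIV (\<lambda>x. \<zeta> x * ?G x)"
      proof (rule ccont_integral_le[OF cut(3) cG'(1)])
        show "g x \<le> \<zeta> x * ?G x" for x
          using G0[OF u, of x] \<zeta>(2)[of x] outside[of x] by (cases "x \<in> \<Omega>") (auto simp: g_def intro: mult_right_mono)
      qed
      then show ?thesis using B1[OF u] by linarith
    qed
    have i2: "integral UNIV (\<lambda>x. norm (Dg x)) \<le> B1 + B2"
    proof -
      have "integral UNIV (\<lambda>x. norm (Dg x)) \<le> integral UNIV (\<lambda>x. \<zeta> x * ?G x + \<zeta> x * norm (?DG x))"
      proof (rule ccont_integral_le[OF cn ccont_add[OF cG'(1,2)]])
        show "norm (Dg x) \<le> \<zeta> x * ?G x + \<zeta> x * norm (?DG x)" for x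
        proof (cases "x \<in> \<Omega>")
          case True
          have "norm (Dg x) \<le> norm (\<theta> x *\<^sub>R ?DG x) + norm (?G x *\<^sub>R D\<theta> x)"
            unfolding Dg_def by (rule norm_triangle_ineq)
          also have "\<dots> = \<theta> x * norm (?DG x) + ?G x * norm (D\<theta> x)" using \<theta>0 G0[OF u True] by simp
          also have "\<dots> \<le> \<zeta> x * norm (?DG x) + ?G x * \<zeta> x"
            using \<zeta>(2,3)[of x] G0[OF u True] by (intro add_mono mult_right_mono mult_left_mono) auto
          finally show ?thesis by (simp add: mult.commute add.commute)
        next
          case False
          then show ?thesis using outside[OF False] by (simp add: Dg_def)
        qed
      qed
      also have "\<dots> = integral UNIV (\<lambda>x. \<zeta> x * ?G x) + integral UNIV (\<lambda>x. \<zeta> x * norm (?DG x))"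
        using cG' by (intro integral_add ccont_integrable)
      finally show ?thesis using B1[OF u] B2[OF u] by linarith
    qed
    have "integral UNIV (\<lambda>x. \<eta> x * ?G x powr r) \<le> integral UNIV (\<lambda>x. g x powr r)"
    proof (rule ccont_integral_le[OF cG'(3)])
      have "continuous_on UNIV (\<lambda>x. g x powr r)"
        using cut(3) g0 r by (intro continuous_on_powr' ccont_continuous continuous_on_const) auto
      then show "ccont (\<lambda>x. g x powr r)"
        by (rule ccontI[OF _ compact_cbox[of "-a" a]]) (use zero r in auto)
      show "\<eta> x * ?G x powr r \<le> g x powr r" for x
      proof (cases "\<eta> x = 0")
        case True
        then show ?thesis by simp
      next
        case False
        have x: "x \<in> \<Omega>" using False outside(3) by blast
        have "\<eta> x \<le> \<theta> x powr 1" using \<theta>(2)[of x] \<theta>0[of x] by simp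
        also have "\<dots> \<le> \<theta> x powr r" using \<theta>(3)[OF False] r by (intro powr_mono) auto
        finally have "\<eta> x * ?G x powr r \<le> \<theta> x powr r * ?G x powr r" by (intro mult_right_mono) auto
        also have "\<dots> = g x powr r" using \<theta>0[of x] G0[OF u x] by (simp add: g_def powr_mult)
        finally show ?thesis .
      qed
    qed
    also have "\<dots> \<le> C"
    proof (rule C[of g Dg])
      show "\<forall>x. (g has_derivative (\<lambda>h. Dg x \<bullet> h)) (at x)"
        unfolding Dg_def using cut(1) by blast
    qed (use cut(2) g0 zero i1 i2 in \<open>auto simp: B_def\<close>)
    finally show ?thesis .
  qed
  then show "\<exists>C. \<forall>u Du H. adm k \<Omega> u Du H \<longrightarrow> integral UNIV (\<lambda>x. \<eta> x * G u Du H x powr r) \<le> C" by blast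
qed

lemma power_of_w_derivative:
  assumes \<Omega>: "open \<Omega>" and u: "adm k \<Omega> u Du H" and x: "x \<in> \<Omega>"
  shows "((\<lambda>x. (1 - u x) powr a) has_derivative (\<lambda>h. ((- a * (1 - u x) powr (a - 1)) *\<^sub>R Du x) \<bullet> h)) (at x)"
proof -
  have z: "0 < 1 - u x" using adm_facts(4)[OF \<Omega> u x] by simp
  have "((\<lambda>x. 1 - u x) has_derivative (\<lambda>h. - (Du x \<bullet> h))) (at x)"
    using adm_facts(5)[OF \<Omega> u x] by (auto intro!: derivative_eq_intros)
  from DERIV_compose_FDERIV[OF has_real_derivative_powr[OF z, of a] this]
  show ?thesis by (simp add: mult_ac)
qed

lemma power_of_rho_derivative:
  assumes \<Omega>: "open \<Omega>" and u: "adm k \<Omega> u Du H" and x: "x \<in> \<Omega>"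
  shows "((\<lambda>x. rho Du x powr a) has_derivative (\<lambda>h. ((2 * a * rho Du x powr (a - 1)) *\<^sub>R (H x *v Du x)) \<bullet> h)) (at x)"
proof -
  have "(rho Du has_derivative (\<lambda>h. Du x \<bullet> (H x *v h) + (H x *v h) \<bullet> Du x)) (at x)"
    unfolding rho_def[abs_def] power2_norm_eq_inner using adm_facts(6)[OF \<Omega> u x]
    by (auto intro!: derivative_eq_intros)
  also have "(\<lambda>h. Du x \<bullet> (H x *v h) + (H x *v h) \<bullet> Du x) = (\<lambda>h. 2 * ((H x *v Du x) \<bullet> h))"
    using symmetric_inner_matrix[OF adm_facts(2)[OF \<Omega> u x]] by (simp add: inner_commute fun_eq_iff)
  finally have "(rho Du has_derivative (\<lambda>h. 2 * ((H x *v Du x) \<bullet> h))) (at x)" .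
  from DERIV_compose_FDERIV[OF has_real_derivative_powr[OF rho_pos[of Du x], of a] this]
  show ?thesis by (simp add: mult_ac)
qed

section \<open>Bounds for subharmonic functions\<close>

text \<open>The identity for S_1 is tested with \<theta>^2 (1 - u)^(-s). Because of the negative
  exponent the gradient of the test function is a positive multiple of \<open>Du\<close>, so the
  main terms are all nonnegative; the cross term with the derivative of \<theta> is
  absorbed.\<close>

lemma caccioppoli:
  fixes \<Omega> :: "(real^'n) set"
  assumes \<Omega>: "open \<Omega>" and k: "1 \<le> k" and s: "0 < s" "s < 1"
  shows "locbd k \<Omega> (\<lambda>u Du H x. (1 - u x) powr (- s - 1) * (norm (Du x))\<^sup>2)"
  unfolding locbd_def
proof (intro allI impI)
  fix \<eta> :: "real^'n \<Rightarrow> real" and D\<eta> assume \<eta>: "cutoff \<Omega> \<eta> D\<eta>"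
  obtain \<theta> D\<theta> where \<theta>: "cutoff \<Omega> \<theta> D\<theta>" "\<And>x. \<eta> x \<le> \<theta> x" "\<And>x. \<eta> x \<noteq> 0 \<Longrightarrow> 1 \<le> \<theta> x"
    using cutoff_larger[OF \<Omega> \<eta>] by metis
  obtain \<zeta> D\<zeta> where \<zeta>: "cutoff \<Omega> \<zeta> D\<zeta>" "\<And>x. (norm (D\<theta> x))\<^sup>2 \<le> \<zeta> x"
    using cutoff_dominate[OF \<Omega> \<theta>(1)] by metis
  obtain C where C: "\<And>u Du H. adm k \<Omega> u Du H \<Longrightarrow> integral UNIV (\<lambda>x. \<zeta> x * (1 - u x) powr 1) \<le> C"
    using locbd_w[OF \<Omega>] \<zeta>(1) unfolding locbd_def by blast
  have \<theta>\<theta>: "\<eta> x \<le> (\<theta> x)\<^sup>2" for x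
  proof (cases "\<eta> x = 0")
    case False
    have "\<theta> x * 1 \<le> \<theta> x * \<theta> x" using \<theta>(3)[OF False] by (intro mult_left_mono) auto
    then show ?thesis using \<theta>(2)[of x] by (simp add: power2_eq_square)
  qed simp
  have "integral UNIV (\<lambda>x. \<eta> x * ((1 - u x) powr (- s - 1) * (norm (Du x))\<^sup>2)) \<le> (2 / s) * ((2 / s) * C)"
    if u: "adm k \<Omega> u Du H" for u Du H
  proof -
    define q where "q = (\<lambda>x. (1 - u x) powr (- s - 1))"
    define h where "h = (\<lambda>x. (1 - u x) powr (- s))"
    define Dh where "Dh = (\<lambda>x. (s * q x) *\<^sub>R Du x)"
    have dh: "(h has_derivative (\<lambda>v. Dh x \<bullet> v)) (at x)" if "x \<in> \<Omega>" for x
      using power_of_w_derivative[OF \<Omega> u that, of "-s"] by (simp add: h_def Dh_def q_def)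
    have cDh: "continuous_on \<Omega> Dh" unfolding Dh_def q_def by (rule adm_continuous_forms[OF \<Omega> u])
    note id = divergence_identity[OF \<Omega> adm_facts(1)[OF \<Omega> u] cutoff_square[OF \<theta>(1)] dh cDh, of 0]
    define I where "I = (\<lambda>x. (\<theta> x)\<^sup>2 * h x * (real (Suc 0) * sg (Suc 0) (H x))
      + ((\<theta> x)\<^sup>2 *\<^sub>R Dh x + h x *\<^sub>R (2 * \<theta> x) *\<^sub>R D\<theta> x) \<bullet> (NT 0 (H x) *v Du x))"
    have I: "integral UNIV I = 0" "ccont I" using id unfolding I_def by auto
    define F where "F = (\<lambda>x. \<eta> x * (q x * (norm (Du x))\<^sup>2))"
    define Z where "Z = (\<lambda>x. \<zeta> x * (1 - u x) powr 1)"
    have cF: "ccont F" unfolding F_def q_def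
      by (intro ccont_cutoff[OF \<Omega> \<eta>] adm_continuous_forms[OF \<Omega> u])
    have cZ: "ccont Z" unfolding Z_def by (intro ccont_cutoff[OF \<Omega> \<zeta>(1)] adm_continuous[OF \<Omega> u])
    have "integral UNIV (\<lambda>x. s / 2 * F x - 2 / s * Z x) \<le> integral UNIV I"
    proof (rule ccont_integral_le[OF ccont_diff[OF ccont_cmult[OF cF] ccont_cmult[OF cZ]] I(2)])
      fix x
      show "s / 2 * F x - 2 / s * Z x \<le> I x"
      proof (cases "x \<in> \<Omega>")
        case False
        then have "\<eta> x = 0" "\<zeta> x = 0" "\<theta> x = 0"
          using \<eta> \<zeta>(1) \<theta>(1) unfolding cutoff_def by blast+
        then show ?thesis by (simp add: F_def Z_def I_def)
      next
        case True
        define z where "z = 1 - u x"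
        define d where "d = norm (Du x)"
        define t where "t = norm (D\<theta> x)"
        have z: "1 \<le> z" using adm_facts(4)[OF \<Omega> u True] by (simp add: z_def)
        have q0: "0 \<le> q x" by (simp add: q_def)
        have hq: "h x = q x * z" using z powr_add[of z "- s - 1" 1] by (simp add: h_def q_def z_def)
        \<comment> \<open>What remains of the cross term is thereby of first order in 1 - u, the
          only power bounded so far.\<close>
        have qz: "q x * z\<^sup>2 \<le> z"
        proof -
          have "q x * z\<^sup>2 = z powr (1 - s)"
            using z powr_add[of z "- s - 1" 2] by (simp add: q_def z_def powr_realpow[symmetric] flip: powr_numeral)
          also have "\<dots> \<le> z powr 1" using z s by (intro powr_mono) auto
          finally show ?thesis using z by simp
        qed
        have th0: "0 \<le> \<theta> x" using \<theta>(1) by (simp add: cutoff_def)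
        have Ix: "I x = (\<theta> x)\<^sup>2 * h x * sg 1 (H x) + (\<theta> x)\<^sup>2 * (s * q x) * d\<^sup>2 + 2 * h x * \<theta> x * (D\<theta> x \<bullet> Du x)"
          by (simp add: I_def Dh_def d_def inner_add_left power2_norm_eq_inner algebra_simps)
        have n1: "0 \<le> (\<theta> x)\<^sup>2 * h x * sg 1 (H x)"
          using adm_facts(3)[OF \<Omega> u True, of 1] k by (simp add: h_def)
        have "\<bar>D\<theta> x \<bullet> Du x\<bar> \<le> t * d" unfolding t_def d_def by (rule Cauchy_Schwarz_ineq2)
        then have "- (D\<theta> x \<bullet> Du x) \<le> t * d" by linarith
        then have "2 * h x * \<theta> x * - (D\<theta> x \<bullet> Du x) \<le> 2 * h x * \<theta> x * (t * d)"
          using th0 by (intro mult_left_mono) (auto simp: h_def)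
        also have "\<dots> = q x * (2 * (\<theta> x * d) * (z * t))" by (simp add: hq mult_ac)
        also have "\<dots> \<le> q x * (s / 2 * (\<theta> x * d)\<^sup>2 + 2 / s * (z * t)\<^sup>2)"
        proof (rule mult_left_mono[OF _ q0])
          \<comment> \<open>The weights are such that absorbing the cross term costs exactly half of
            the good term \<open>s * X\<close>.\<close>
          have "0 \<le> (s / 2 * (\<theta> x * d) - z * t)\<^sup>2 * (2 / s)" using s by simp
          also have "\<dots> = s / 2 * (\<theta> x * d)\<^sup>2 + 2 / s * (z * t)\<^sup>2 - 2 * (\<theta> x * d) * (z * t)"
            using s by (simp add: power2_eq_square field_simps)
          finally show "2 * (\<theta> x * d) * (z * t) \<le> s / 2 * (\<theta> x * d)\<^sup>2 + 2 / s * (z * t)\<^sup>2" by simp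
        qed
        finally have n2: "2 * h x * \<theta> x * - (D\<theta> x \<bullet> Du x) \<le> s / 2 * ((\<theta> x)\<^sup>2 * q x * d\<^sup>2) + 2 / s * (q x * z\<^sup>2 * t\<^sup>2)"
          by (simp add: power_mult_distrib algebra_simps)
        have "q x * z\<^sup>2 * t\<^sup>2 \<le> z * \<zeta> x"
          using qz \<zeta>(2)[of x] q0 z by (intro mult_mono) (auto simp: t_def)
        then have n3: "2 / s * (q x * z\<^sup>2 * t\<^sup>2) \<le> 2 / s * Z x"
          using s z by (intro mult_left_mono) (auto simp: Z_def z_def mult.commute)
        have "F x \<le> (\<theta> x)\<^sup>2 * (q x * d\<^sup>2)"
          unfolding F_def d_def using \<theta>\<theta>[of x] q0 by (intro mult_right_mono) auto
        then have n4: "s / 2 * F x \<le> s / 2 * ((\<theta> x)\<^sup>2 * q x * d\<^sup>2)"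
          using s by (intro mult_left_mono) (auto simp: mult.assoc)
        define X where "X = (\<theta> x)\<^sup>2 * q x * d\<^sup>2"
        define Y where "Y = 2 * h x * \<theta> x * (D\<theta> x \<bullet> Du x)"
        define R where "R = 2 / s * (q x * z\<^sup>2 * t\<^sup>2)"
        have "I x = (\<theta> x)\<^sup>2 * h x * sg 1 (H x) + s * X + Y"
          unfolding Ix X_def Y_def by (simp add: mult_ac)
        moreover have "- Y \<le> s * X / 2 + R" using n2 by (simp add: X_def Y_def R_def)
        moreover have "s / 2 * F x \<le> s * X / 2" using n4 by (simp add: X_def)
        moreover have "R \<le> 2 / s * Z x" using n3 by (simp add: R_def)
        ultimately show ?thesis using n1 by linarith
      qed
    qed
    then have "integral UNIV (\<lambda>x. s / 2 * F x) - integral UNIV (\<lambda>x. 2 / s * Z x) \<le> 0"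
      using I(1) integral_diff[OF ccont_integrable[OF ccont_cmult[OF cF, of "s / 2"]] ccont_integrable[OF ccont_cmult[OF cZ, of "2 / s"]]]
      by simp
    then have "s / 2 * integral UNIV F \<le> 2 / s * integral UNIV Z" by simp
    also have "\<dots> \<le> 2 / s * C" using C[OF u] s by (intro mult_left_mono) (auto simp: Z_def)
    finally have "(2 / s) * (s / 2 * integral UNIV F) \<le> (2 / s) * ((2 / s) * C)"
      using s by (intro mult_left_mono) auto
    then show ?thesis using s by (simp add: F_def q_def)
  qed
  then show "\<exists>C. \<forall>u Du H. adm k \<Omega> u Du H \<longrightarrow>
     integral UNIV (\<lambda>x. \<eta> x * ((1 - u x) powr (- s - 1) * (norm (Du x))\<^sup>2)) \<le> C" by blast
qed

text \<open>Sobolev's inequality for \<open>(1 - u)\<^sup>t\<close> with \<open>t = (a + 1 - s)/2\<close>, whose gradient is bounded by the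
  arithmetic-geometric mean of the Caccioppoli integrand and \<open>(1 - u)\<^sup>a\<close>.\<close>

lemma w_gain:
  fixes \<Omega> :: "(real^'n) set"
  assumes \<Omega>: "open \<Omega>" and k: "1 \<le> k" and s: "0 < s" "s < 1" and a: "1 \<le> a"
    and p: "real CARD('n) \<le> p" "1 < p" and r: "1 < r" "(p - 1) * (r - 1) < 1"
    and b: "locbd k \<Omega> (\<lambda>u Du H x. (1 - u x) powr a)"
  shows "locbd k \<Omega> (\<lambda>u Du H x. (1 - u x) powr (r * (a + 1 - s) / 2))"
proof -
  define t where "t = (a + 1 - s) / 2"
  have t: "0 < t" "t \<le> a" using a s by (auto simp: t_def)
  have "locbd k \<Omega> (\<lambda>u Du H x. ((1 - u x) powr t) powr r)"
  proof (rule locbd_sobolev[OF \<Omega> p r, where DG = "\<lambda>u Du H x. (- t * (1 - u x) powr (t - 1)) *\<^sub>R Du x"])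
    show "locbd k \<Omega> (\<lambda>u Du H x. (1 - u x) powr t)"
    proof (rule locbd_dom[OF \<Omega> b, of 1])
      show "(1 - u x) powr t \<le> 1 * (1 - u x) powr a" if "adm k \<Omega> u Du H" "x \<in> \<Omega>" for u Du H x
        using adm_facts(4)[OF \<Omega> that] t by (simp add: powr_mono)
    qed ((rule adm_continuous_forms[OF \<Omega>], assumption) | simp)+
    show "locbd k \<Omega> (\<lambda>u Du H x. norm ((- t * (1 - u x) powr (t - 1)) *\<^sub>R Du x))"
    proof (rule locbd_dom2[OF \<Omega> caccioppoli[OF \<Omega> k s] b, of t])
      fix u Du H x assume u: "adm k \<Omega> u Du H" and x: "x \<in> \<Omega>"
      define z where "z = 1 - u x"
      define d where "d = norm (Du x)"
      have z: "1 \<le> z" using adm_facts(4)[OF \<Omega> u x] by (simp add: z_def)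
      define \<alpha> where "\<alpha> = z powr ((- s - 1) / 2) * d"
      define \<beta> where "\<beta> = z powr (a / 2)"
      have "0 \<le> \<alpha> * \<beta>" by (simp add: \<alpha>_def \<beta>_def d_def)
      moreover have "2 * (\<alpha> * \<beta>) \<le> \<alpha>\<^sup>2 + \<beta>\<^sup>2"
        using sum_squares_bound[of \<alpha> \<beta>] by (simp add: mult.assoc)
      ultimately have "\<alpha> * \<beta> \<le> \<alpha>\<^sup>2 + \<beta>\<^sup>2" by linarith
      moreover have "\<alpha> * \<beta> = z powr (t - 1) * d"
      proof -
        have "z powr ((- s - 1) / 2) * z powr (a / 2) = z powr (t - 1)"
          by (simp add: powr_add[symmetric] t_def field_simps)
        then show ?thesis by (simp add: \<alpha>_def \<beta>_def mult_ac)
      qed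
      moreover have "\<alpha>\<^sup>2 = z powr (- s - 1) * d\<^sup>2" "\<beta>\<^sup>2 = z powr a"
      proof -
        have h: "(z powr (c / 2))\<^sup>2 = z powr c" for c
          by (simp add: power2_eq_square powr_add[symmetric])
        show "\<alpha>\<^sup>2 = z powr (- s - 1) * d\<^sup>2" using h[of "- s - 1"] by (simp add: \<alpha>_def power_mult_distrib)
        show "\<beta>\<^sup>2 = z powr a" using h[of a] by (simp add: \<beta>_def)
      qed
      ultimately have "t * (z powr (t - 1) * d) \<le> t * (z powr (- s - 1) * d\<^sup>2 + z powr a)"
        using t by (intro mult_left_mono) auto
      then show "norm ((- t * (1 - u x) powr (t - 1)) *\<^sub>R Du x)
         \<le> t * ((1 - u x) powr (- s - 1) * (norm (Du x))\<^sup>2 + (1 - u x) powr a)"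
        using t by (simp add: z_def d_def abs_mult mult.assoc)
    qed ((rule adm_continuous_forms[OF \<Omega>], assumption) | (use t in simp))+
  qed ((rule adm_continuous_forms[OF \<Omega>], assumption) | (rule power_of_w_derivative[OF \<Omega>], assumption, assumption) | simp)+
  then show ?thesis by (simp add: powr_powr t_def mult_ac)
qed

text \<open>\<open>w_gain\<close> sends the exponent a to r(a+1-s)/2. As r <= 2, its gain over a
  decreases in a, so every a <= A gains at least the amount \<delta> gained at A. Finitely many
  steps lead from exponent 1 to A.\<close>

lemma w_power_bound:
  fixes \<Omega> :: "(real^'n) set"
  assumes \<Omega>: "open \<Omega>" and k: "1 \<le> k" and s: "0 < s" "s < 1" and A: "1 \<le> A" "A < r * (A + 1 - s) / 2"
    and p: "real CARD('n) \<le> p" "1 < p" and r: "1 < r" "r \<le> 2" "(p - 1) * (r - 1) < 1"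
  shows "locbd k \<Omega> (\<lambda>u Du H x. (1 - u x) powr A)"
proof -
  define \<delta> where "\<delta> = r * (A + 1 - s) / 2 - A"
  have \<delta>: "0 < \<delta>" using A by (simp add: \<delta>_def)
  have mono: "locbd k \<Omega> (\<lambda>u Du H x. (1 - u x) powr a)"
    if "locbd k \<Omega> (\<lambda>u Du H x. (1 - u x) powr b)" "a \<le> b" for a b
  proof (rule locbd_dom[OF \<Omega> that(1), of 1])
    show "(1 - u x) powr a \<le> 1 * (1 - u x) powr b" if "adm k \<Omega> u Du H" "x \<in> \<Omega>" for u Du H x
      using adm_facts(4)[OF \<Omega> that] \<open>a \<le> b\<close> by (simp add: powr_mono)
  qed ((rule adm_continuous_forms[OF \<Omega>], assumption) | simp)+
  have "locbd k \<Omega> (\<lambda>u Du H x. (1 - u x) powr (min A (1 + real m * \<delta>)))" for m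
  proof (induction m)
    case 0
    then show ?case using locbd_w[OF \<Omega>] A by simp
  next
    case (Suc m)
    define a where "a = min A (1 + real m * \<delta>)"
    have a: "1 \<le> a" "a \<le> A" using A \<delta> by (auto simp: a_def)
    have "(1 - r / 2) * a \<le> (1 - r / 2) * A" using a r by (intro mult_left_mono) auto
    then have "a + \<delta> \<le> r * (a + 1 - s) / 2" by (simp add: \<delta>_def field_simps)
    moreover have "min A (1 + real (Suc m) * \<delta>) \<le> a + \<delta>" using \<delta> by (auto simp: a_def min_def algebra_simps)
    ultimately have "min A (1 + real (Suc m) * \<delta>) \<le> r * (a + 1 - s) / 2" by linarith
    then show ?case
      by (rule mono[OF w_gain[OF \<Omega> k s a(1) p r(1,3) Suc[folded a_def]]])
  qed
  moreover obtain m :: nat where "A \<le> 1 + real m * \<delta>"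
  proof -
    obtain m :: nat where "A / \<delta> \<le> real m" using real_arch_simple by blast
    then have "A \<le> real m * \<delta>" using \<delta> by (simp add: pos_divide_le_eq)
    then show ?thesis using that[of m] by linarith
  qed
  ultimately show ?thesis by (metis min.absorb1)
qed

text \<open>|Du|^q is interpolated between the Caccioppoli integrand and (1 - u)^A. In the limit of
  small s, A tends to q/(2-q), while powers of 1 - u are available below r/(2-r); this is where q <
  r is needed.\<close>

lemma gradient_base_bound:
  fixes \<Omega> :: "(real^'n) set"
  assumes \<Omega>: "open \<Omega>" and k: "1 \<le> k" and q: "1 \<le> q" "q < r"
    and p: "real CARD('n) \<le> p" "1 < p" and r: "1 < r" "r \<le> 2" "(p - 1) * (r - 1) < 1"
  shows "locbd k \<Omega> (\<lambda>u Du H x. rho Du x powr (q / 2))"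
proof -
  \<comment> \<open>Then s q = (r - q)/2, half of the available gap, which keeps 2(s+1)q = q + r
    below 2r.\<close>
  define s where "s = (r - q) / (2 * q)"
  have s: "0 < s" using q by (simp add: s_def)
  have s1: "s < 1" using q r by (simp add: s_def divide_less_eq)
  \<comment> \<open>The exponent for which d^q is the product of (z^(-s-1) d^2)^(q/2) and
    (z^A)^(1-q/2).\<close>
  define A where "A = (s + 1) * q / (2 - q)"
  have q2: "q < 2" using q r by simp
  have "(2 - q) * 1 \<le> (s + 1) * q" using q s by (simp add: algebra_simps add_increasing)
  then have A1: "1 \<le> A" using q2 by (simp add: A_def le_divide_eq)
  obtain s' where s': "0 < s'" "s' < 1" "A < r * (A + 1 - s') / 2"
  proof -
    have A2: "A < r * (A + 1) / 2"
    proof -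
      have "A + 1 = (2 + s * q) / (2 - q)" using q2 by (simp add: A_def field_simps)
      have "2 * ((s + 1) * q) < r * (2 + s * q)"
      proof -
        have sq: "s * q = (r - q) / 2" using q by (simp add: s_def)
        have "2 * ((s + 1) * q) = q + r" using sq by (simp add: algebra_simps)
        moreover have "r * (2 + s * q) = 2 * r + r * (s * q)" by (simp add: algebra_simps)
        moreover have "0 \<le> r * (s * q)" using r s q by simp
        ultimately show ?thesis using q by linarith
      qed
      then have "2 * ((s + 1) * q) / (2 - q) < r * (2 + s * q) / (2 - q)"
        using q2 by (intro divide_strict_right_mono) auto
      then have "2 * A < r * (A + 1)" using \<open>A + 1 = (2 + s * q) / (2 - q)\<close> by (simp add: A_def)
      then show ?thesis by simp
    qed
    \<comment> \<open>\<open>A2\<close> is the condition of \<open>w_power_bound\<close> with s' =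
      0; half of its slack still satisfies it.\<close>
    define s' where "s' = min (1 / 2) ((A + 1 - 2 * A / r) / 2)"
    have pos: "0 < A + 1 - 2 * A / r" using A2 r by (simp add: field_simps)
    have "s' < A + 1 - 2 * A / r" using pos by (simp add: s'_def min_def)
    then have "A < r * (A + 1 - s') / 2" using r by (simp add: field_simps)
    moreover have "0 < s'" using pos by (simp add: s'_def)
    moreover have "s' < 1" by (simp add: s'_def)
    ultimately show ?thesis using that by blast
  qed
  have bA: "locbd k \<Omega> (\<lambda>u Du H x. (1 - u x) powr A)"
    by (rule w_power_bound[OF \<Omega> k s'(1,2) A1 s'(3) p r])
  show ?thesis
  proof (rule locbd_dom2[OF \<Omega> caccioppoli[OF \<Omega> k s s1] bA, of 4])
    fix u Du H x assume u: "adm k \<Omega> u Du H" and x: "x \<in> \<Omega>"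
    define z where "z = 1 - u x"
    define d where "d = norm (Du x)"
    have z: "1 \<le> z" using adm_facts(4)[OF \<Omega> u x] by (simp add: z_def)
    have d0: "0 \<le> d" by (simp add: d_def)
    have zA: "1 \<le> z powr A" using z A1 by (simp add: ge_one_powr_ge_zero)
    have dq: "d powr q \<le> z powr (- s - 1) * d\<^sup>2 + z powr A"
    proof (cases "d = 0")
      case True
      then show ?thesis using q by simp
    next
      case False
      then have d: "0 < d" using d0 by simp
      show ?thesis
      \<comment> \<open>A direct proof of the interpolation: d^q is bounded by the first term when
        this case holds and by z^A otherwise.\<close>
      proof (cases "z powr (s + 1) \<le> d powr (2 - q)")
        case True
        have "z powr (- s - 1) * z powr (s + 1) = 1" using z by (simp add: powr_add[symmetric])
        then have "d powr q = z powr (- s - 1) * (z powr (s + 1) * d powr q)" by (simp add: mult.assoc[symmetric])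
        also have "\<dots> \<le> z powr (- s - 1) * (d powr (2 - q) * d powr q)"
          using True by (intro mult_left_mono mult_right_mono) auto
        also have "d powr (2 - q) * d powr q = d\<^sup>2" using d by (simp add: powr_add[symmetric] powr_realpow[symmetric] flip: powr_numeral)
        finally show ?thesis by (simp add: add_increasing2)
      next
        case False
        have "d powr q = (d powr (2 - q)) powr (q / (2 - q))" using q2 by (simp add: powr_powr)
        also have "\<dots> \<le> (z powr (s + 1)) powr (q / (2 - q))"
          using False q q2 by (intro powr_mono2) auto
        also have "\<dots> = z powr A" by (simp add: powr_powr A_def)
        finally show ?thesis by (simp add: add_increasing)
      qed
    qed
    have "rho Du x powr (q / 2) \<le> 2 * (1 + d powr q)"
    proof (cases "d \<le> 1")
      case True
      have "rho Du x \<le> 2" using True d0 by (simp add: rho_def d_def abs_square_le_1)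
      then have "rho Du x powr (q / 2) \<le> 2 powr (q / 2)" using rho_pos[of Du x] q by (intro powr_mono2) auto
      also have "\<dots> \<le> 2 powr 1" using q2 by (intro powr_mono) auto
      also have "\<dots> \<le> 2 * (1 + d powr q)" by simp
      finally show ?thesis .
    next
      case False
      have "1 \<le> d\<^sup>2" using False by (simp add: one_le_power)
      then have "rho Du x \<le> 2 * d\<^sup>2" by (simp add: rho_def d_def)
      then have "rho Du x powr (q / 2) \<le> (2 * d\<^sup>2) powr (q / 2)" using rho_pos[of Du x] q by (intro powr_mono2) auto
      also have "\<dots> = 2 powr (q / 2) * d powr q"
        using False by (simp add: powr_mult powr_powr powr_realpow[symmetric] flip: powr_numeral)
      also have "\<dots> \<le> 2 powr 1 * d powr q" using q2 by (intro mult_right_mono powr_mono) auto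
      also have "\<dots> \<le> 2 * (1 + d powr q)" by simp
      finally show ?thesis .
    qed
    also have "\<dots> \<le> 2 * (z powr A + (z powr (- s - 1) * d\<^sup>2 + z powr A))"
      using dq zA by (intro mult_left_mono add_mono) auto
    also have "\<dots> \<le> 4 * (z powr (- s - 1) * d\<^sup>2 + z powr A)" by simp
    finally show "rho Du x powr (q / 2) \<le> 4 * ((1 - u x) powr (- s - 1) * (norm (Du x))\<^sup>2 + (1 - u x) powr A)"
      by (simp add: z_def d_def)
  qed ((rule adm_continuous_forms[OF \<Omega>], assumption) | simp)+
qed

section \<open>Gradient and Hessian bounds\<close>

lemma rho_powr_mono:
  assumes "a \<le> b"
  shows "rho Du x powr a \<le> rho Du x powr b"
  using rho_ge_1[of Du x] assms by (rule powr_mono[rotated])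

lemma locbd_rho_mono:
  assumes \<Omega>: "open \<Omega>" and b: "locbd k \<Omega> (\<lambda>u Du H x. rho Du x powr b)" and "a \<le> b"
  shows "locbd k \<Omega> (\<lambda>u Du H x. rho Du x powr a)"
proof (rule locbd_dom[OF \<Omega> b, of 1])
  show "rho Du x powr a \<le> 1 * rho Du x powr b" for Du :: "real^'a \<Rightarrow> real^'a" and x
    using rho_powr_mono[OF \<open>a \<le> b\<close>] by simp
qed ((rule adm_continuous_forms[OF \<Omega>], assumption) | simp)+

text \<open>The identity of order \<open>m\<close> is tested with
  \<open>h = rho^(\<alpha>/2)\<close>. The terms carrying \<eta> are bounded below by
  \<open>NT_lower_bound\<close>; the term with the derivative of \<eta> contains
  \<open>NT m\<close>, is bounded by \<open>NT_bound\<close> since m < k, and brings in one factor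
  |Du| <= rho^(1/2).\<close>

lemma curvature_step:
  fixes \<Omega> :: "(real^'n) set"
  assumes \<Omega>: "open \<Omega>" and k: "k \<le> CARD('n)" and l: "Suc m \<le> k" and \<alpha>: "0 \<le> \<alpha>"
    and cond: "k = CARD('n) \<or> \<alpha> * real (CARD('n) - k) < real (CARD('n) * (k - Suc m))"
    and b: "locbd k \<Omega> (\<lambda>u Du H x. rho Du x powr ((\<alpha> + 1) / 2) * sg m (H x))"
  shows "locbd k \<Omega> (\<lambda>u Du H x. rho Du x powr (\<alpha> / 2) * sg (Suc m) (H x))"
  unfolding locbd_def
proof (intro allI impI)
  fix \<eta> :: "real^'n \<Rightarrow> real" and D\<eta> assume \<eta>: "cutoff \<Omega> \<eta> D\<eta>"
  have l1: "1 \<le> Suc m" by simp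
  obtain c where c: "c > 0" and lower: "\<forall>(M :: real^'n^'n) v \<rho>. transpose M = M \<longrightarrow> (\<forall>j\<le>k. 0 \<le> sg j M) \<longrightarrow> (norm v)\<^sup>2 \<le> \<rho> \<longrightarrow>
      c * sg (Suc m) M * \<rho> \<le> real (Suc m) * sg (Suc m) M * \<rho> + \<alpha> * (sg (Suc m) M * (norm v)\<^sup>2 - v \<bullet> (NT (Suc m) M *v v))"
    using NT_lower_bound[OF l1 l k \<alpha> cond] by (elim exE conjE) rule
  obtain \<zeta> D\<zeta> where \<zeta>: "cutoff \<Omega> \<zeta> D\<zeta>" "\<And>x. norm (D\<eta> x) \<le> \<zeta> x"
    using cutoff_dominate[OF \<Omega> \<eta>] by metis
  obtain C where C: "\<And>u Du H. adm k \<Omega> u Du H \<Longrightarrow> integral UNIV (\<lambda>x. \<zeta> x * (rho Du x powr ((\<alpha> + 1) / 2) * sg m (H x))) \<le> C"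
    using b \<zeta>(1) unfolding locbd_def by blast
  define n where "n = real CARD('n)"
  have "integral UNIV (\<lambda>x. \<eta> x * (rho Du x powr (\<alpha> / 2) * sg (Suc m) (H x))) \<le> n * C / c"
    if u: "adm k \<Omega> u Du H" for u Du H
  proof -
    define h where "h = (\<lambda>x. rho Du x powr (\<alpha> / 2))"
    define Dh where "Dh = (\<lambda>x. (\<alpha> * rho Du x powr (\<alpha> / 2 - 1)) *\<^sub>R (H x *v Du x))"
    have dh: "(h has_derivative (\<lambda>v. Dh x \<bullet> v)) (at x)" if "x \<in> \<Omega>" for x
      using power_of_rho_derivative[OF \<Omega> u that, of "\<alpha> / 2"] by (simp add: h_def Dh_def)
    have cDh: "continuous_on \<Omega> Dh" unfolding Dh_def by (rule adm_continuous_forms[OF \<Omega> u])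
    define I where "I = (\<lambda>x. \<eta> x * h x * (real (Suc m) * sg (Suc m) (H x))
      + (\<eta> x *\<^sub>R Dh x + h x *\<^sub>R D\<eta> x) \<bullet> (NT m (H x) *v Du x))"
    have I: "integral UNIV I = 0" "ccont I"
      unfolding I_def using divergence_identity[OF \<Omega> adm_facts(1)[OF \<Omega> u] \<eta> dh cDh, of m] by auto
    define F where "F = (\<lambda>x. \<eta> x * (rho Du x powr (\<alpha> / 2) * sg (Suc m) (H x)))"
    define Z where "Z = (\<lambda>x. \<zeta> x * (rho Du x powr ((\<alpha> + 1) / 2) * sg m (H x)))"
    have cF: "ccont F" unfolding F_def
      by (intro ccont_cutoff[OF \<Omega> \<eta>] adm_continuous_forms[OF \<Omega> u])
    have cZ: "ccont Z" unfolding Z_def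
      by (intro ccont_cutoff[OF \<Omega> \<zeta>(1)] adm_continuous_forms[OF \<Omega> u])
    have "integral UNIV (\<lambda>x. c * F x - n * Z x) \<le> integral UNIV I"
    proof (rule ccont_integral_le[OF ccont_diff[OF ccont_cmult[OF cF] ccont_cmult[OF cZ]] I(2)])
      fix x
      show "c * F x - n * Z x \<le> I x"
      proof (cases "x \<in> \<Omega>")
        case False
        then have "\<eta> x = 0" "\<zeta> x = 0" "D\<eta> x = 0"
          using \<eta> \<zeta>(1) unfolding cutoff_def by blast+
        then show ?thesis by (simp add: F_def Z_def I_def)
      next
        case True
        define \<rho> where "\<rho> = rho Du x"
        define v where "v = Du x"
        define M where "M = H x"
        define g where "g = \<rho> powr (\<alpha> / 2 - 1)"
        have \<rho>: "0 < \<rho>" "(norm v)\<^sup>2 \<le> \<rho>" using rho_pos[of Du x] by (auto simp: \<rho>_def rho_def v_def)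
        have M: "transpose M = M" "\<And>j. j \<le> k \<Longrightarrow> 0 \<le> sg j M"
          using adm_facts(2,3)[OF \<Omega> u True] by (auto simp: M_def)
        have hx: "h x = g * \<rho>" using \<rho>(1) powr_add[of \<rho> "\<alpha> / 2 - 1" 1] by (simp add: h_def g_def \<rho>_def)
        have g0: "0 \<le> g" by (simp add: g_def)
        have \<eta>0: "0 \<le> \<eta> x" using \<eta> by (simp add: cutoff_def)
        \<comment> \<open>The recursion for \<open>NT (Suc m)\<close> converts the Hessian produced
          by differentiating \<open>h\<close> into the expression treated in
          \<open>NT_lower_bound\<close>.\<close>
        have Hv: "(M *v v) \<bullet> (NT m M *v v) = sg (Suc m) M * (norm v)\<^sup>2 - v \<bullet> (NT (Suc m) M *v v)"
        proof -
          have "(M *v v) \<bullet> (NT m M *v v) = v \<bullet> ((M ** NT m M) *v v)"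
            by (simp add: symmetric_inner_matrix[OF M(1)] matrix_vector_mul_assoc)
          also have "M ** NT m M = sg (Suc m) M *\<^sub>R mat 1 - NT (Suc m) M"
            unfolding NT_commute NT_Suc by simp
          also have "v \<bullet> ((sg (Suc m) M *\<^sub>R mat 1 - NT (Suc m) M) *v v) = sg (Suc m) M * (v \<bullet> v) - v \<bullet> (NT (Suc m) M *v v)"
            by (simp add: matrix_vector_mult_diff_rdistrib scaleR_matrix_vector_assoc[symmetric] inner_diff_right)
          finally show ?thesis by (simp add: power2_norm_eq_inner)
        qed
        have Ix: "I x = \<eta> x * g * (real (Suc m) * sg (Suc m) M * \<rho> + \<alpha> * (sg (Suc m) M * (norm v)\<^sup>2 - v \<bullet> (NT (Suc m) M *v v)))
            + h x * (D\<eta> x \<bullet> (NT m M *v v))"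
        proof -
          have "(\<eta> x *\<^sub>R Dh x + h x *\<^sub>R D\<eta> x) \<bullet> (NT m (H x) *v Du x)
             = \<eta> x * (\<alpha> * g) * ((M *v v) \<bullet> (NT m M *v v)) + h x * (D\<eta> x \<bullet> (NT m M *v v))"
            by (simp add: inner_add_left Dh_def g_def \<rho>_def M_def v_def)
          then show ?thesis unfolding I_def Hv by (simp add: hx M_def algebra_simps)
        qed
        have "\<eta> x * g * (c * sg (Suc m) M * \<rho>)
           \<le> \<eta> x * g * (real (Suc m) * sg (Suc m) M * \<rho> + \<alpha> * (sg (Suc m) M * (norm v)\<^sup>2 - v \<bullet> (NT (Suc m) M *v v)))"
          using lower M \<rho>(2) \<eta>0 g0 by (intro mult_left_mono) auto
        moreover have "\<eta> x * g * (c * sg (Suc m) M * \<rho>) = c * F x"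
          using hx by (simp add: F_def h_def M_def mult_ac)
        moreover have "- (h x * (D\<eta> x \<bullet> (NT m M *v v))) \<le> n * Z x"
        proof -
          have h0: "0 \<le> h x" by (simp add: h_def)
          have "\<bar>D\<eta> x \<bullet> (NT m M *v v)\<bar> \<le> n * sg m M * (norm (D\<eta> x) * norm v)"
            unfolding n_def using l by (intro NT_bound[OF M(1), of k]) (auto intro: M(2))
          also have "\<dots> \<le> n * sg m M * (\<zeta> x * \<rho> powr (1 / 2))"
            using \<zeta>(2)[of x] norm_le_sqrt_rho[of Du x] M(2)[of m] l
            by (intro mult_left_mono mult_mono) (auto simp: n_def v_def \<rho>_def intro: order_trans[OF norm_ge_zero])
          finally have "h x * \<bar>D\<eta> x \<bullet> (NT m M *v v)\<bar> \<le> h x * (n * sg m M * (\<zeta> x * \<rho> powr (1 / 2)))"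
            using h0 by (rule mult_left_mono)
          also have "\<dots> = n * Z x"
          proof -
            have "h x * \<rho> powr (1 / 2) = \<rho> powr ((\<alpha> + 1) / 2)"
              by (simp add: h_def \<rho>_def powr_add[symmetric] add_divide_distrib)
            then have "n * sg m M * \<zeta> x * (h x * \<rho> powr (1 / 2)) = n * Z x"
              by (simp add: Z_def \<rho>_def M_def)
            then show ?thesis by (simp add: mult_ac)
          qed
          finally have "h x * \<bar>D\<eta> x \<bullet> (NT m M *v v)\<bar> \<le> n * Z x" .
          moreover have "- (h x * (D\<eta> x \<bullet> (NT m M *v v))) \<le> \<bar>h x * (D\<eta> x \<bullet> (NT m M *v v))\<bar>" by linarith
          moreover have "\<bar>h x * (D\<eta> x \<bullet> (NT m M *v v))\<bar> = h x * \<bar>D\<eta> x \<bullet> (NT m M *v v)\<bar>"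
            using h0 by (simp add: abs_mult)
          ultimately show ?thesis by linarith
        qed
        ultimately show ?thesis unfolding Ix by linarith
      qed
    qed
    then have "c * integral UNIV F \<le> n * integral UNIV Z"
      using I(1) integral_diff[OF ccont_integrable[OF ccont_cmult[OF cF, of c]] ccont_integrable[OF ccont_cmult[OF cZ, of n]]]
      by simp
    also have "\<dots> \<le> n * C" using C[OF u] by (intro mult_left_mono) (auto simp: Z_def n_def)
    finally show ?thesis using c by (simp add: F_def pos_le_divide_eq mult.commute)
  qed
  then show "\<exists>C. \<forall>u Du H. adm k \<Omega> u Du H \<longrightarrow>
     integral UNIV (\<lambda>x. \<eta> x * (rho Du x powr (\<alpha> / 2) * sg (Suc m) (H x))) \<le> C" by blast
qed

text \<open>The gradient of rho^(q/2) is q rho^(q/2-1) H Du, and \<open>hessian_le_trace\<close>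
  bounds its norm by q rho^((q-1)/2) S_1, the second bounded quantity.\<close>

lemma gradient_gain:
  fixes \<Omega> :: "(real^'n) set"
  assumes \<Omega>: "open \<Omega>" and k: "2 \<le> k \<or> CARD('n) = 1 \<and> k = 1"
    and p: "real CARD('n) \<le> p" "1 < p" and r: "1 < r" "(p - 1) * (r - 1) < 1" and q: "1 \<le> q"
    and b: "locbd k \<Omega> (\<lambda>u Du H x. rho Du x powr (q / 2))"
    and b1: "locbd k \<Omega> (\<lambda>u Du H x. rho Du x powr ((q - 1) / 2) * sg 1 (H x))"
  shows "locbd k \<Omega> (\<lambda>u Du H x. rho Du x powr (r * q / 2))"
proof -
  have "locbd k \<Omega> (\<lambda>u Du H x. (rho Du x powr (q / 2)) powr r)"
  proof (rule locbd_sobolev[OF \<Omega> p r, where DG = "\<lambda>u Du H x. (2 * (q / 2) * rho Du x powr (q / 2 - 1)) *\<^sub>R (H x *v Du x)"])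
    show "locbd k \<Omega> (\<lambda>u Du H x. norm ((2 * (q / 2) * rho Du x powr (q / 2 - 1)) *\<^sub>R (H x *v Du x)))"
    proof (rule locbd_dom[OF \<Omega> b1, of q])
      fix u Du H x assume u: "adm k \<Omega> u Du H" and x: "x \<in> \<Omega>"
      have s1: "0 \<le> sg 1 (H x)" using adm_facts(3)[OF \<Omega> u x, of 1] k by auto
      have "norm (H x *v Du x) \<le> sg 1 (H x) * norm (Du x)"
        using adm_facts(2,3)[OF \<Omega> u x] k by (intro hessian_le_trace[of _ k]) auto
      also have "\<dots> \<le> sg 1 (H x) * rho Du x powr (1 / 2)"
        using s1 norm_le_sqrt_rho by (intro mult_left_mono) auto
      finally have "rho Du x powr (q / 2 - 1) * norm (H x *v Du x)
          \<le> rho Du x powr (q / 2 - 1) * (sg 1 (H x) * rho Du x powr (1 / 2))"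
        by (intro mult_left_mono) auto
      also have "\<dots> = (rho Du x powr (q / 2 - 1) * rho Du x powr (1 / 2)) * sg 1 (H x)" by (simp add: mult_ac)
      also have "rho Du x powr (q / 2 - 1) * rho Du x powr (1 / 2) = rho Du x powr ((q - 1) / 2)"
        by (simp add: powr_add[symmetric] field_simps)
      finally have "q * (rho Du x powr (q / 2 - 1) * norm (H x *v Du x))
        \<le> q * (rho Du x powr ((q - 1) / 2) * sg 1 (H x))"
        using q by (intro mult_left_mono) auto
      then show "norm ((2 * (q / 2) * rho Du x powr (q / 2 - 1)) *\<^sub>R (H x *v Du x))
        \<le> q * (rho Du x powr ((q - 1) / 2) * sg 1 (H x))"
        using q by (simp add: mult.assoc)
    qed ((rule adm_continuous_forms[OF \<Omega>], assumption) | (use q in simp))+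
    show "((\<lambda>x. rho Du x powr (q / 2)) has_derivative
        (\<lambda>h. ((2 * (q / 2) * rho Du x powr (q / 2 - 1)) *\<^sub>R (H x *v Du x)) \<bullet> h)) (at x)"
      if "adm k \<Omega> u Du H" "x \<in> \<Omega>" for u Du H x
      by (rule power_of_rho_derivative[OF \<Omega> that])
  qed ((rule adm_continuous_forms[OF \<Omega>], assumption) | (rule b) | simp)+
  then show ?thesis by (simp add: powr_powr mult_ac)
qed

text \<open>Each round multiplies the exponent by r, so powers of r exhaust the range until the cap
  is met. The cap is r k(n-1)/(n-k) because the last gain starts from an exponent below
  k(n-1)/(n-k); it tends to nk/(n-k) as r approaches n/(n-1).\<close>

lemma gradient_bound_iterate:
  fixes \<Omega> :: "(real^'n) set"
  assumes \<Omega>: "open \<Omega>" and k: "2 \<le> k \<or> CARD('n) = 1 \<and> k = 1" "k \<le> CARD('n)"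
    and p: "real CARD('n) \<le> p" "1 < p" and r: "1 < r" "r \<le> 2" "(p - 1) * (r - 1) < 1"
    and q: "0 \<le> q" "k = CARD('n) \<or> q * real (CARD('n) - k) < r * real (k * (CARD('n) - 1))"
  shows "locbd k \<Omega> (\<lambda>u Du H x. rho Du x powr (q / 2))"
proof -
  have k1: "1 \<le> k" using k by auto
  have base: "locbd k \<Omega> (\<lambda>u Du H x. rho Du x powr (1 / 2))"
    by (rule gradient_base_bound[OF \<Omega> k1 order_refl r(1) p r])
  have it: "locbd k \<Omega> (\<lambda>u Du H x. rho Du x powr (q' / 2))" if "q' \<le> q" "q' \<le> r ^ m" for q' m
    using that
  proof (induction m arbitrary: q')
    case 0
    then show ?case by (intro locbd_rho_mono[OF \<Omega> base]) simp
  next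
    case (Suc m)
    \<comment> \<open>The exponent from which one gain reaches q'; it is raised to 1 where
      necessary, since \<open>gradient_gain\<close> starts at 1 and that exponent is covered by
      \<open>base\<close>.\<close>
    define q0 where "q0 = max 1 (q' / r)"
    have q0: "1 \<le> q0" "q' \<le> r * q0" using r by (auto simp: q0_def max_def field_simps)
    have b: "locbd k \<Omega> (\<lambda>u Du H x. rho Du x powr (q0 / 2))"
    proof (cases "q' / r \<le> 1")
      case True
      then show ?thesis using base by (simp add: q0_def max_def)
    next
      case False
      have "0 \<le> q'" using False r by (simp add: not_le divide_simps split: if_splits)
      then have "q' / r \<le> q'" using mult_left_mono[of 1 r q'] r by (simp add: pos_divide_le_eq)
      moreover have "q' / r \<le> r ^ m" using Suc.prems r by (simp add: divide_le_eq mult.commute)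
      ultimately show ?thesis using False Suc.IH[of "q' / r"] Suc.prems by (simp add: q0_def max_def)
    qed
    \<comment> \<open>With n(k-1) + (n-k) = k(n-1), the condition of \<open>curvature_step\<close>
      for \<alpha> = q0 - 1 and l = 1 reads q0 (n-k) < k(n-1).\<close>
    have cond: "k = CARD('n) \<or> (q0 - 1) * real (CARD('n) - k) < real (CARD('n) * (k - Suc 0))"
    proof (cases "k = CARD('n)")
      case False
      then have kn: "k < CARD('n)" "2 \<le> k" using k by auto
      define N K where "N = real CARD('n)" and "K = real k"
      have NK: "K < N" "2 \<le> K" using kn by (auto simp: N_def K_def)
      have e: "real (CARD('n) - k) = N - K" "real (CARD('n) * (k - Suc 0)) = N * (K - 1)"
        "real (k * (CARD('n) - 1)) = K * (N - 1)"
        using kn by (auto simp: N_def K_def of_nat_diff)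
      have "q * (N - K) < r * (K * (N - 1))" using q(2) False unfolding e by simp
      moreover have "q' * (N - K) \<le> q * (N - K)" using Suc.prems(1) NK by (intro mult_right_mono) auto
      ultimately have "q' * (N - K) < r * (K * (N - 1))" by linarith
      then have a1: "q' / r * (N - K) < K * (N - 1)" using r by (simp add: pos_divide_less_eq mult.commute)
      have "1 * (N - K) < K * (N - 1)"
      proof -
        have "0 < (K - 1) * N" using NK by simp
        then show ?thesis by (simp add: algebra_simps)
      qed
      with a1 have "q0 * (N - K) < K * (N - 1)" by (simp add: q0_def max_def)
      then have "(q0 - 1) * (N - K) < N * (K - 1)" by (simp add: algebra_simps)
      then show ?thesis unfolding e by simp
    qed simp
    have b1: "locbd k \<Omega> (\<lambda>u Du H x. rho Du x powr ((q0 - 1) / 2) * sg 1 (H x))"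
      using curvature_step[OF \<Omega> k(2) _ _ cond] k1 q0 b by simp
    show ?case
      by (rule locbd_rho_mono[OF \<Omega> gradient_gain[OF \<Omega> k(1) p r(1,3) q0(1) b b1]]) (use q0 in simp)
  qed
  obtain m where "q < r ^ m" using real_arch_pow[OF r(1)] by blast
  then show ?thesis using it[of q m] by simp
qed

lemma gradient_bound:
  fixes \<Omega> :: "(real^'n) set"
  assumes \<Omega>: "open \<Omega>" and k: "1 \<le> k" "k \<le> CARD('n)"
    and q: "0 \<le> q" "k = CARD('n) \<or> q * real (CARD('n) - k) < real (CARD('n) * k)"
  shows "locbd k \<Omega> (\<lambda>u Du H x. rho Du x powr (q / 2))"
proof (cases "k = CARD('n)")
  case True
  \<comment> \<open>For k = n no exponent is excluded and any r > 1 will do. Taking p = n + 1 also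
    covers n = 1, where p = n would violate p > 1.\<close>
  define p r where "p = real CARD('n) + 1" and "r = 1 + 1 / p"
  have n1: "1 \<le> real CARD('n)" using True k by simp
  have p: "real CARD('n) \<le> p" "1 < p" using n1 by (auto simp: p_def)
  have r: "1 < r" "r \<le> 2" "(p - 1) * (r - 1) < 1" using p by (auto simp: r_def divide_simps)
  have "2 \<le> k \<or> CARD('n) = 1 \<and> k = 1" using True k by arith
  then show ?thesis
    by (rule gradient_bound_iterate[OF \<Omega> _ k(2) p r q(1)]) (use True in simp)
next
  case False
  then have kn: "k < CARD('n)" using k by simp
  define N K where "N = real CARD('n)" and "K = real k"
  have NK: "1 \<le> K" "K < N" "2 \<le> N" using k kn by (auto simp: N_def K_def)
  have e: "real (CARD('n) - k) = N - K" "real (CARD('n) * k) = N * K" "real (k * (CARD('n) - 1)) = K * (N - 1)"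
    using kn by (auto simp: N_def K_def of_nat_diff)
  have q': "q * (N - K) < N * K" using q(2) False unfolding e by simp
  \<comment> \<open>The lower limit for r, from the cap in \<open>gradient_bound_iterate\<close>. It
    lies below n/(n-1), the upper limit of Sobolev's inequality, precisely when q <
    nk/(n-k).\<close>
  define b where "b = max 1 (q * (N - K) / (K * (N - 1)))"
  have "b < N / (N - 1)"
  proof -
    have "1 < N / (N - 1)" using NK by (simp add: field_simps)
    moreover have "q * (N - K) / (K * (N - 1)) < N / (N - 1)" using q' NK by (simp add: divide_simps)
    ultimately show ?thesis by (simp add: b_def)
  qed
  then obtain r where rb: "b < r" "r < N / (N - 1)" using dense by blast
  have r1: "1 < r" using rb by (simp add: b_def)
  have rN: "r * (N - 1) < N" using rb(2) NK by (simp add: pos_less_divide_eq)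
  have r2: "r \<le> 2"
  proof -
    have "N / (N - 1) \<le> 2" using NK by (simp add: divide_le_eq)
    then show ?thesis using rb by simp
  qed
  have p: "real CARD('n) \<le> N" "1 < N" using NK by (auto simp: N_def)
  have r3: "(N - 1) * (r - 1) < 1" using rN by (simp add: algebra_simps)
  have qr: "q * (N - K) < r * (K * (N - 1))"
  proof -
    have "q * (N - K) / (K * (N - 1)) < r" using rb(1) by (simp add: b_def)
    then show ?thesis using NK by (simp add: pos_divide_less_eq)
  qed
  show ?thesis
  \<comment> \<open>For k = 1 the cap on q is r itself, which \<open>gradient_base_bound\<close>
    already attains.\<close>
  proof (cases "k = 1")
    case True
    have "q < r" using qr NK True by (simp add: K_def)
    then have "max 1 q < r" using r1 by simp
    from gradient_base_bound[OF \<Omega> k(1) _ this p r1 r2 r3]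
    have "locbd k \<Omega> (\<lambda>u Du H x. rho Du x powr (max 1 q / 2))" by simp
    then show ?thesis by (rule locbd_rho_mono[OF \<Omega>]) simp
  next
    case False
    then have "2 \<le> k \<or> CARD('n) = 1 \<and> k = 1" using k by arith
    moreover have "k = CARD('n) \<or> q * real (CARD('n) - k) < r * real (k * (CARD('n) - 1))"
      unfolding e using qr by blast
    ultimately show ?thesis by (rule gradient_bound_iterate[OF \<Omega> _ k(2) p r1 r2 r3 q(1)])
  qed
qed

text \<open>Going from order l+1 down to l replaces q by q + 1. The left side of the exponent
  condition grows by n - k, the right side by n, so the condition persists down to l = 0.\<close>

lemma curvature_bound:
  fixes \<Omega> :: "(real^'n) set"
  assumes \<Omega>: "open \<Omega>" and k: "1 \<le> k" "k \<le> CARD('n)" and l: "l < k"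
    and q: "0 \<le> q" "k = CARD('n) \<or> q * real (CARD('n) - k) < real (CARD('n) * (k - l))"
  shows "locbd k \<Omega> (\<lambda>u Du H x. rho Du x powr (q / 2) * sg l (H x))"
  using l q
proof (induction l arbitrary: q)
  case 0
  then show ?case using gradient_bound[OF \<Omega> k, of q] by simp
next
  case (Suc l)
  have "k = CARD('n) \<or> (q + 1) * real (CARD('n) - k) < real (CARD('n) * (k - l))"
  proof (cases "k = CARD('n)")
    case False
    have "k - l = Suc (k - Suc l)" using Suc.prems(1) by simp
    then have "real (CARD('n) * (k - l)) = real (CARD('n) * (k - Suc l)) + real CARD('n)"
      by (simp add: algebra_simps)
    moreover have "real (CARD('n) - k) \<le> real CARD('n)" by simp
    moreover have "q * real (CARD('n) - k) < real (CARD('n) * (k - Suc l))"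
      using Suc.prems(3) False by blast
    moreover have "(q + 1) * real (CARD('n) - k) = q * real (CARD('n) - k) + real (CARD('n) - k)"
      by (simp only: distrib_right mult_1)
    ultimately have "(q + 1) * real (CARD('n) - k) < real (CARD('n) * (k - l))" by linarith
    then show ?thesis ..
  qed simp
  then have "locbd k \<Omega> (\<lambda>u Du H x. rho Du x powr ((q + 1) / 2) * sg l (H x))"
    using Suc.prems by (intro Suc.IH) auto
  from curvature_step[OF \<Omega> k(2) _ Suc.prems(2,3) this] show ?case using Suc.prems by simp
qed

section \<open>Scaling\<close>

lemma S_sym_scale: "S_sym j (t *\<^sub>R lam) = t ^ j * S_sym j lam"
  unfolding S_sym_def sum_distrib_left by (intro sum.cong) (auto simp: prod.distrib)

lemma sg_scale:
  fixes M :: "real^'n^'n"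
  assumes "transpose M = M"
  shows "sg j (t *\<^sub>R M) = t ^ j * sg j M"
proof -
  obtain P lam where E: "eig_decomp M P lam" using eig_decomp_exists[OF assms] .
  have "diag_mat (t *\<^sub>R lam) = t *\<^sub>R diag_mat lam" by (simp add: diag_mat_def vec_eq_iff)
  then have "eig_decomp (t *\<^sub>R M) P (t *\<^sub>R lam)"
    using E by (simp add: eig_decomp_def mmult_simps)
  from sg_eig[OF this] sg_eig[OF E] S_sym_scale[of j t lam] show ?thesis by (simp add: S_sym_esym)
qed

lemma C2_with_scale:
  assumes "C2_with \<Omega> u Du H"
  shows "C2_with \<Omega> (\<lambda>x. t * u x) (\<lambda>x. t *\<^sub>R Du x) (\<lambda>x. t *\<^sub>R H x)"
  using assms unfolding C2_with_def
  by (auto intro!: derivative_eq_intros continuous_intros simp: scaleR_matrix_vector_assoc[symmetric])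

lemma rpow_mult: "0 \<le> s \<Longrightarrow> 0 \<le> t \<Longrightarrow> rpow (s * t) q = rpow s q * rpow t q"
  by (simp add: rpow_def powr_mult)

text \<open>Whether the integrand is integrable on \<open>\<Omega>'\<close> does not matter: otherwise the integral is \<open>0\<close>.\<close>

lemma integral_bound_normalised:
  fixes \<Omega> \<Omega>' :: "(real^'n) set"
  assumes \<Omega>: "open \<Omega>" and K: "compact (closure \<Omega>')" "closure \<Omega>' \<subseteq> \<Omega>"
    and k: "1 \<le> k" "k \<le> CARD('n)" and l: "l < k"
    and q: "0 \<le> q" "k = CARD('n) \<or> q * real (CARD('n) - k) < real (CARD('n) * (k - l))"
  shows "\<exists>C\<ge>0. \<forall>u Du H. adm k \<Omega> u Du H \<longrightarrow>
     integral \<Omega>' (\<lambda>x. rpow (norm (Du x)) q * sg l (H x)) \<le> C"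
proof -
  obtain \<eta> D\<eta> where \<eta>: "cutoff \<Omega> \<eta> D\<eta>" "\<And>x. x \<in> closure \<Omega>' \<Longrightarrow> 1 \<le> \<eta> x"
    using cutoff_exists[OF \<Omega> K] by metis
  obtain C where C: "\<And>u Du H. adm k \<Omega> u Du H \<Longrightarrow>
      integral UNIV (\<lambda>x. \<eta> x * (rho Du x powr (q / 2) * sg l (H x))) \<le> C"
    using curvature_bound[OF \<Omega> k l q] \<eta>(1) unfolding locbd_def by blast
  have "integral \<Omega>' (\<lambda>x. rpow (norm (Du x)) q * sg l (H x)) \<le> max 0 C" if u: "adm k \<Omega> u Du H" for u Du H
  proof (cases "(\<lambda>x. rpow (norm (Du x)) q * sg l (H x)) integrable_on \<Omega>'")
    case False
    then show ?thesis by (simp add: not_integrable_integral)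
  next
    case True
    have sub: "\<Omega>' \<subseteq> \<Omega>" using K(2) closure_subset by blast
    define F where "F = (\<lambda>x. \<eta> x * (rho Du x powr (q / 2) * sg l (H x)))"
    have cF: "ccont F" unfolding F_def
      by (intro ccont_cutoff[OF \<Omega> \<eta>(1)] adm_continuous_forms[OF \<Omega> u])
    have F0: "0 \<le> F x" for x
    proof (cases "x \<in> \<Omega>")
      case True
      then show ?thesis using adm_facts(3)[OF \<Omega> u True, of l] l \<eta>(1) by (simp add: F_def cutoff_def)
    next
      case False
      then have "\<eta> x = 0" using \<eta>(1) unfolding cutoff_def by blast
      then show ?thesis by (simp add: F_def)
    qed
    have "integral \<Omega>' (\<lambda>x. rpow (norm (Du x)) q * sg l (H x))
       = integral UNIV (\<lambda>x. if x \<in> \<Omega>' then rpow (norm (Du x)) q * sg l (H x) else 0)"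
      by (rule integral_restrict_UNIV[symmetric])
    also have "\<dots> \<le> integral UNIV F"
    proof (rule integral_le)
      show "(\<lambda>x. if x \<in> \<Omega>' then rpow (norm (Du x)) q * sg l (H x) else 0) integrable_on UNIV"
        using True by (simp only: integrable_restrict_UNIV)
      show "F integrable_on UNIV" by (rule ccont_integrable[OF cF])
      show "(if x \<in> \<Omega>' then rpow (norm (Du x)) q * sg l (H x) else 0) \<le> F x" for x
      proof (cases "x \<in> \<Omega>'")
        case False
        then show ?thesis using F0[of x] by simp
      next
        case True
        have s: "0 \<le> sg l (H x)" using adm_facts(3)[OF \<Omega> u, of x l] True sub l by auto
        have "rpow (norm (Du x)) q \<le> rho Du x powr (q / 2)"
        proof (cases "q = 0")
          case True
          then show ?thesis using rho_pos[of Du x] by (simp add: rpow_def)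
        next
          case False
          have "norm (Du x) powr q \<le> (rho Du x powr (1 / 2)) powr q"
            using norm_le_sqrt_rho[of Du x] q(1) by (intro powr_mono2) auto
          then show ?thesis using False by (simp add: rpow_def powr_powr)
        qed
        moreover have "1 \<le> \<eta> x" using \<eta>(2)[of x] True closure_subset by blast
        ultimately have "1 * (rpow (norm (Du x)) q * sg l (H x)) \<le> \<eta> x * (rho Du x powr (q / 2) * sg l (H x))"
          using s by (intro mult_mono) (auto simp: rpow_def)
        then show ?thesis using True by (simp add: F_def)
      qed
    qed
    also have "\<dots> \<le> C" using C[OF u] by (simp add: F_def)
    finally show ?thesis by simp
  qed
  then show ?thesis by (intro exI[of _ "max 0 C"]) auto
qed

theorem theorem4p1:
  fixes \<Omega> \<Omega>' :: "(real^'n) set" and k l :: nat and q :: real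
  assumes "open \<Omega>" and "connected \<Omega>"
    and "open \<Omega>'" and "connected \<Omega>'"
    and "compact (closure \<Omega>')" and "closure \<Omega>' \<subseteq> \<Omega>"
    and "1 \<le> k" and "k \<le> CARD('n)"
    and "l \<le> k - 1"
    and "0 \<le> q"
    and "k = CARD('n) \<or> q < real (CARD('n) * (k - l)) / real (CARD('n) - k)"
  shows "\<exists>C. \<forall>u Du H.
           C2_with \<Omega> u Du H \<and> PhiK k \<Omega> H \<and> (\<forall>x\<in>\<Omega>. u x \<le> 0) \<and>
           (\<lambda>x. \<bar>u x\<bar>) integrable_on \<Omega>
           \<longrightarrow> integral \<Omega>' (\<lambda>x. rpow (norm (Du x)) q * Fk l H x)
               \<le> C * rpow (integral \<Omega> (\<lambda>x. \<bar>u x\<bar>)) (q + real l)"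
proof -
  have l: "l < k" using assms by simp
  have "k = CARD('n) \<or> q * real (CARD('n) - k) < real (CARD('n) * (k - l))"
  proof (cases "k = CARD('n)")
    case False
    then have "0 < real (CARD('n) - k)" using assms(8) by simp
    then show ?thesis using assms(11) False by (simp add: pos_less_divide_eq)
  qed simp
  then obtain C where C0: "0 \<le> C" and C: "\<And>u Du H. adm k \<Omega> u Du H \<Longrightarrow>
     integral \<Omega>' (\<lambda>x. rpow (norm (Du x)) q * sg l (H x)) \<le> C"
    using integral_bound_normalised[OF assms(1,5,6,7,8) l assms(10)] by blast
  have "integral \<Omega>' (\<lambda>x. rpow (norm (Du x)) q * Fk l H x) \<le> C * rpow (integral \<Omega> (\<lambda>x. \<bar>u x\<bar>)) (q + real l)"
    if C2: "C2_with \<Omega> u Du H" and Phi: "PhiK k \<Omega> H" and neg: "\<forall>x\<in>\<Omega>. u x \<le> 0"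
      and int: "(\<lambda>x. \<bar>u x\<bar>) integrable_on \<Omega>" for u Du H
  proof -
    define m where "m = integral \<Omega> (\<lambda>x. \<bar>u x\<bar>)"
    define A where "A = integral \<Omega>' (\<lambda>x. rpow (norm (Du x)) q * sg l (H x))"
    have m0: "0 \<le> m" unfolding m_def by (intro integral_nonneg[OF int]) auto
    have sub: "\<Omega>' \<subseteq> \<Omega>" using assms(6) closure_subset by blast
    have sym: "transpose (H x) = H x" if "x \<in> \<Omega>" for x by (rule C2_with_symmetric[OF assms(1) C2 that])
    have Feq: "Fk j H x = sg j (H x)" if "x \<in> \<Omega>" for j x
      using Fk_sg[of H x j] sym[OF that] by blast
    have AF: "integral \<Omega>' (\<lambda>x. rpow (norm (Du x)) q * Fk l H x) = A"
      unfolding A_def using sub Feq by (intro integral_cong) auto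
    \<comment> \<open>Every multiple t u with integral at most 1 is admissible, and the left-hand
      side is homogeneous of degree q + l. The freedom in t also serves the degenerate
      cases.\<close>
    have scaled: "rpow t q * t ^ l * A \<le> C" if t: "0 \<le> t" "t * m \<le> 1" for t
    proof -
      have "adm k \<Omega> (\<lambda>x. t * u x) (\<lambda>x. t *\<^sub>R Du x) (\<lambda>x. t *\<^sub>R H x)"
        unfolding adm_def
      proof (intro conjI)
        show "C2_with \<Omega> (\<lambda>x. t * u x) (\<lambda>x. t *\<^sub>R Du x) (\<lambda>x. t *\<^sub>R H x)" by (rule C2_with_scale[OF C2])
        show "PhiK k \<Omega> (\<lambda>x. t *\<^sub>R H x)"
          unfolding PhiK_def
        proof (intro ballI)
          fix j x assume j: "j \<in> {1..k}" and x: "x \<in> \<Omega>"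
          have "transpose (t *\<^sub>R H x) = t *\<^sub>R H x" using sym[OF x] by (simp add: transpose_def vec_eq_iff)
          \<comment> \<open>The scaling law is taken from \<open>sg\<close>, because the eigenvalues
            chosen for the scaled matrix need not be the scaled choice.\<close>
          then have "Fk j (\<lambda>x. t *\<^sub>R H x) x = t ^ j * Fk j H x"
            using Fk_sg[of "\<lambda>x. t *\<^sub>R H x" x j] sg_scale[OF sym[OF x]] Feq[OF x] by simp
          then show "0 \<le> Fk j (\<lambda>x. t *\<^sub>R H x) x" using Phi j x t by (simp add: PhiK_def)
        qed
        show "\<forall>x\<in>\<Omega>. t * u x \<le> 0" using neg t by (simp add: mult_nonneg_nonpos)
        have e: "\<bar>t * u x\<bar> = t * \<bar>u x\<bar>" for x using t by (simp add: abs_mult)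
        show "(\<lambda>x. \<bar>t * u x\<bar>) integrable_on \<Omega>" unfolding e by (intro integrable_on_mult_right int)
        show "integral \<Omega> (\<lambda>x. \<bar>t * u x\<bar>) \<le> 1" unfolding e using t by (simp add: m_def)
      qed
      from C[OF this]
      have "integral \<Omega>' (\<lambda>x. rpow (norm (t *\<^sub>R Du x)) q * sg l (t *\<^sub>R H x)) \<le> C" .
      also have "integral \<Omega>' (\<lambda>x. rpow (norm (t *\<^sub>R Du x)) q * sg l (t *\<^sub>R H x))
         = integral \<Omega>' (\<lambda>x. (rpow t q * t ^ l) * (rpow (norm (Du x)) q * sg l (H x)))"
        using sub t by (intro integral_cong) (auto simp: sg_scale[OF sym] rpow_mult subset_iff)
      finally show ?thesis by (simp add: A_def)
    qed
    have "A \<le> C * rpow m (q + real l)"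
    proof (cases "q + real l = 0")
      case True
      then have "q = 0" "l = 0" using assms(10) by auto
      \<comment> \<open>With t = 0 both \<open>rpow 0 0\<close> and the zeroth power of 0 are 1, so
        the bound holds for A itself whatever the value of m.\<close>
      then show ?thesis using scaled[of 0] by (simp add: rpow_def)
    next
      case False
      then have ql: "0 < q + real l" using assms(10) by simp
      have tp: "rpow t q * t ^ l = t powr (q + real l)" if "0 < t" for t
        using that by (simp add: rpow_def powr_add powr_realpow)
      show ?thesis
      proof (cases "m = 0")
        case True
        have "A \<le> 0"
        proof (rule ccontr)
          assume "\<not> A \<le> 0"
          then have A: "0 < A" by simp
          \<comment> \<open>If m = 0 every t is allowed; this one would give t^(q+l) A = C + 1 >
            C.\<close>
          define t where "t = ((C + 1) / A) powr (1 / (q + real l))"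
          have t: "0 < t" using A C0 by (simp add: t_def)
          have "t powr (q + real l) = (C + 1) / A" using ql A C0 by (simp add: t_def powr_powr)
          then have "C + 1 \<le> C" using scaled[of t] tp[OF t] t A True by simp
          then show False by simp
        qed
        then show ?thesis using True ql by (simp add: rpow_def)
      next
        case False
        then have m: "0 < m" using m0 by simp
        \<comment> \<open>For m > 0 the largest admissible factor t = 1/m gives the
          estimate.\<close>
        have "(1 / m) powr (q + real l) * A \<le> C"
          using scaled[of "1 / m"] tp[of "1 / m"] m by simp
        then have "m powr (q + real l) * ((1 / m) powr (q + real l) * A) \<le> m powr (q + real l) * C"
          by (intro mult_left_mono) auto
        moreover have "m powr (q + real l) * (1 / m) powr (q + real l) = 1"
          using m by (simp add: powr_mult[symmetric])
        ultimately have "A \<le> m powr (q + real l) * C" by (simp add: mult.assoc[symmetric])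
        then show ?thesis using ql by (simp add: rpow_def mult.commute)
      qed
    qed
    then show ?thesis unfolding AF m_def .
  qed
  then show ?thesis by blast
qed

end
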